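(* Let $p$ be a prime number, let $E$ be a field of characteristic $p$, let $K$ be the perfect closure of the rational function field $E(\alpha,\beta)$ in two independent variables over $E$, and let $F=K(t)$ be the rational function field in one variable over $K$. Then the algebra $[\alpha,t)_{p,F}$ contains an $F$-subalgebra isomorphic to the field $F[x : x^p-x=\alpha]$, while $[\beta,t)_{p,F}$ does not. Consequently, for $p$-algebras of degree $p$ over a field of characteristic $p$, sharing all the (purely) inseparable degree $p$ field extensions of the center does not imply sharing all the cyclic separable degree $p$ field extensions of the center.
   Context: A $p$-algebra is a central simple algebra of prime power degree $p^m$ over a field of characteristic $p$. For a field $F$ of characteristic $p$, $a \in F$ and $b \in F^\times$, the symbol $[a,b)_{p,F}$ denotes the $F$-algebra generated by $x$ and $y$ subject to the relations $x^p-x=a$, $y^p=b$ and $yxy^{-1}=x+1$; it is a central simple algebra of degree $p$ over $F$. The notation $F[x : x^p-x=\alpha]$ means $F[X]/(X^p-X-\alpha)$. Two $p$-algebras $A,A'$ of degree $p$ over $F$ share all the purely inseparable (respectively cyclic separable) degree $p$ field extensions of the center if, for every purely inseparable (respectively cyclic separable) field extension $L/F$ of degree $p$, $L$ embeds as an $F$-algebra into $A$ if and only if it embeds into $A'$. *)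

theory Defs
  imports
    "HOL-Algebra.Algebraic_Closure_Type"
    "HOL-Algebra.Elementary_Groups"
    "HOL-Algebra.Bij"
    "HOL-Algebra.Module"
begin

section \<open>The perfect closure of a field\<close>

text \<open>The characteristic exponent: the characteristic if it is positive, and 1 otherwise.\<close>

definition char_exponent :: "'a::Fields.field itself \<Rightarrow> nat" where
  "char_exponent _ = (if CHAR('a) = 0 then 1 else CHAR('a))"

text \<open>The elements of the algebraic closure that are purely inseparable over the field.\<close>

definition purely_inseparable_elements :: "'a::Fields.field alg_closure set" where
  "purely_inseparable_elements =
     {x. \<exists>n. x ^ (char_exponent TYPE('a) ^ n) \<in> range to_ac}"

lemma char_exponent_power_add:
  fixes x y :: "'a::Fields.field alg_closure"
  shows "(x + y) ^ (char_exponent TYPE('a) ^ n)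
       = x ^ (char_exponent TYPE('a) ^ n) + y ^ (char_exponent TYPE('a) ^ n)"
proof (cases "CHAR('a) = 0")
  case True
  then show ?thesis by (simp add: char_exponent_def)
next
  case False
  then have "Factorial_Ring.prime CHAR('a alg_closure)"
    by (intro prime_CHAR_semidom) auto
  then show ?thesis
    using False by (intro freshmans_dream') (auto simp: char_exponent_def)
qed

lemma purely_inseparable_elements_level:
  fixes x :: "'a::Fields.field alg_closure"
  assumes "x ^ (char_exponent TYPE('a) ^ m) \<in> range to_ac" and "m \<le> n"
  shows "x ^ (char_exponent TYPE('a) ^ n) \<in> range to_ac"
proof -
  obtain a where a: "x ^ (char_exponent TYPE('a) ^ m) = to_ac a"
    using assms(1) by auto
  have "char_exponent TYPE('a) ^ n
      = char_exponent TYPE('a) ^ m * char_exponent TYPE('a) ^ (n - m)"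
    using assms(2) by (simp flip: power_add)
  then have "x ^ (char_exponent TYPE('a) ^ n) = to_ac (a ^ (char_exponent TYPE('a) ^ (n - m)))"
    by (simp add: power_mult a)
  then show ?thesis by blast
qed

lemma purely_inseparable_elements_common:
  fixes x y :: "'a::Fields.field alg_closure"
  assumes "x \<in> purely_inseparable_elements" "y \<in> purely_inseparable_elements"
  obtains n a b where "x ^ (char_exponent TYPE('a) ^ n) = to_ac a"
    and "y ^ (char_exponent TYPE('a) ^ n) = to_ac b"
proof -
  obtain k l where "x ^ (char_exponent TYPE('a) ^ k) \<in> range to_ac"
    and "y ^ (char_exponent TYPE('a) ^ l) \<in> range to_ac"
    using assms by (auto simp: purely_inseparable_elements_def)
  then have "x ^ (char_exponent TYPE('a) ^ max k l) \<in> range to_ac"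
    and "y ^ (char_exponent TYPE('a) ^ max k l) \<in> range to_ac"
    by (auto intro: purely_inseparable_elements_level)
  then show ?thesis using that by auto
qed

lemma purely_inseparable_elementsI:
  fixes x :: "'a::Fields.field alg_closure"
  assumes "x ^ (char_exponent TYPE('a) ^ n) = to_ac a"
  shows "x \<in> purely_inseparable_elements"
  using assms by (auto simp: purely_inseparable_elements_def)

lemma to_ac_in_purely_inseparable_elements: "to_ac a \<in> purely_inseparable_elements"
  by (rule purely_inseparable_elementsI[of _ 0 a]) simp

lemma purely_inseparable_elements_add:
  fixes x y :: "'a::Fields.field alg_closure"
  assumes "x \<in> purely_inseparable_elements" "y \<in> purely_inseparable_elements"
  shows "x + y \<in> purely_inseparable_elements"
proof -
  obtain n a b where "x ^ (char_exponent TYPE('a) ^ n) = to_ac a"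
    and "y ^ (char_exponent TYPE('a) ^ n) = to_ac b"
    using purely_inseparable_elements_common[OF assms] .
  then have "(x + y) ^ (char_exponent TYPE('a) ^ n) = to_ac (a + b)"
    by (simp add: char_exponent_power_add)
  then show ?thesis by (rule purely_inseparable_elementsI)
qed

lemma purely_inseparable_elements_mult:
  fixes x y :: "'a::Fields.field alg_closure"
  assumes "x \<in> purely_inseparable_elements" "y \<in> purely_inseparable_elements"
  shows "x * y \<in> purely_inseparable_elements"
proof -
  obtain n a b where "x ^ (char_exponent TYPE('a) ^ n) = to_ac a"
    and "y ^ (char_exponent TYPE('a) ^ n) = to_ac b"
    using purely_inseparable_elements_common[OF assms] .
  then have "(x * y) ^ (char_exponent TYPE('a) ^ n) = to_ac (a * b)"
    by (simp add: power_mult_distrib)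
  then show ?thesis by (rule purely_inseparable_elementsI)
qed

lemma purely_inseparable_elements_inverse:
  fixes x :: "'a::Fields.field alg_closure"
  assumes "x \<in> purely_inseparable_elements"
  shows "inverse x \<in> purely_inseparable_elements"
proof -
  obtain n a where "x ^ (char_exponent TYPE('a) ^ n) = to_ac a"
    using assms by (auto simp: purely_inseparable_elements_def)
  then have "inverse x ^ (char_exponent TYPE('a) ^ n) = to_ac (inverse a)"
    by (simp add: power_inverse)
  then show ?thesis by (rule purely_inseparable_elementsI)
qed

lemma purely_inseparable_elements_uminus:
  fixes x :: "'a::Fields.field alg_closure"
  assumes "x \<in> purely_inseparable_elements"
  shows "- x \<in> purely_inseparable_elements"
  using purely_inseparable_elements_mult[OF to_ac_in_purely_inseparable_elements[of "- 1"] assms]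
  by simp

typedef (overloaded) 'a perfect_closure =
  "purely_inseparable_elements :: 'a::Fields.field alg_closure set"
  using to_ac_in_purely_inseparable_elements by blast

setup_lifting type_definition_perfect_closure

instantiation perfect_closure :: (Fields.field) Fields.field
begin

lift_definition zero_perfect_closure :: "'a perfect_closure" is 0
  using to_ac_in_purely_inseparable_elements[of 0] by simp

lift_definition one_perfect_closure :: "'a perfect_closure" is 1
  using to_ac_in_purely_inseparable_elements[of 1] by simp

lift_definition plus_perfect_closure ::
    "'a perfect_closure \<Rightarrow> 'a perfect_closure \<Rightarrow> 'a perfect_closure" is "(+)"
  by (rule purely_inseparable_elements_add)

lift_definition uminus_perfect_closure :: "'a perfect_closure \<Rightarrow> 'a perfect_closure" is uminus
  by (rule purely_inseparable_elements_uminus)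

lift_definition minus_perfect_closure ::
    "'a perfect_closure \<Rightarrow> 'a perfect_closure \<Rightarrow> 'a perfect_closure" is "(-)"
  using purely_inseparable_elements_add[OF _ purely_inseparable_elements_uminus] by fastforce

lift_definition times_perfect_closure ::
    "'a perfect_closure \<Rightarrow> 'a perfect_closure \<Rightarrow> 'a perfect_closure" is "(*)"
  by (rule purely_inseparable_elements_mult)

lift_definition inverse_perfect_closure :: "'a perfect_closure \<Rightarrow> 'a perfect_closure" is inverse
  by (rule purely_inseparable_elements_inverse)

lift_definition divide_perfect_closure ::
    "'a perfect_closure \<Rightarrow> 'a perfect_closure \<Rightarrow> 'a perfect_closure" is "(/)"
  using purely_inseparable_elements_mult[OF _ purely_inseparable_elements_inverse]
  by (fastforce simp: divide_inverse)

instance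
  by (standard; transfer) (auto simp: algebra_simps divide_inverse)

end

lift_definition to_perf :: "'a::Fields.field \<Rightarrow> 'a perfect_closure" is to_ac
  by (rule to_ac_in_purely_inseparable_elements)

lemma to_perf_0 [simp]: "to_perf 0 = 0" by transfer simp
lemma to_perf_1 [simp]: "to_perf 1 = 1" by transfer simp
lemma to_perf_add [simp]: "to_perf (x + y) = to_perf x + to_perf y" by transfer simp
lemma to_perf_mult [simp]: "to_perf (x * y) = to_perf x * to_perf y" by transfer simp

lemma Rep_perfect_closure_power:
  "Rep_perfect_closure (x ^ n) = Rep_perfect_closure x ^ n"
  by (induction n) (simp_all add: one_perfect_closure.rep_eq times_perfect_closure.rep_eq)

lemma perfect_closure_purely_inseparable:
  fixes x :: "'a::Fields.field perfect_closure"
  shows "\<exists>n. x ^ (char_exponent TYPE('a) ^ n) \<in> range to_perf"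
proof -
  obtain n a where "Rep_perfect_closure x ^ (char_exponent TYPE('a) ^ n) = to_ac a"
    using Rep_perfect_closure[of x] by (auto simp: purely_inseparable_elements_def)
  then have "x ^ (char_exponent TYPE('a) ^ n) = to_perf a"
    by (simp add: Rep_perfect_closure_power to_perf.rep_eq flip: Rep_perfect_closure_inject)
  then show ?thesis by blast
qed

lemma perfect_closure_perfect:
  fixes x :: "'a::Fields.field perfect_closure"
  shows "\<exists>y. y ^ char_exponent TYPE('a) = x"
proof -
  obtain n a where n: "Rep_perfect_closure x ^ (char_exponent TYPE('a) ^ n) = to_ac a"
    using Rep_perfect_closure[of x] by (auto simp: purely_inseparable_elements_def)
  obtain z where z: "z ^ char_exponent TYPE('a) = Rep_perfect_closure x"
    using nth_root_exists[of "char_exponent TYPE('a)" "Rep_perfect_closure x"]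
    by (metis char_exponent_def gr0I zero_less_one)
  have "z ^ (char_exponent TYPE('a) ^ Suc n) = to_ac a"
    by (simp add: power_mult z n)
  then have "z \<in> purely_inseparable_elements"
    by (rule purely_inseparable_elementsI)
  then have "Abs_perfect_closure z ^ char_exponent TYPE('a) = x"
    by (simp add: Rep_perfect_closure_power Abs_perfect_closure_inverse z
             flip: Rep_perfect_closure_inject)
  then show ?thesis by blast
qed


section \<open>Associative algebras over a field\<close>

text \<open>The library's locale \<open>algebra\<close> requires the algebra to be commutative.\<close>

locale assoc_algebra = module F A + ring A for F and A (structure) +
  assumes smult_mult_left:
      "\<lbrakk>c \<in> carrier F; x \<in> carrier A; y \<in> carrier A\<rbrakk> \<Longrightarrow>
        (c \<odot>\<^bsub>A\<^esub> x) \<otimes>\<^bsub>A\<^esub> y = c \<odot>\<^bsub>A\<^esub> (x \<otimes>\<^bsub>A\<^esub> y)"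
    and smult_mult_right:
      "\<lbrakk>c \<in> carrier F; x \<in> carrier A; y \<in> carrier A\<rbrakk> \<Longrightarrow>
        x \<otimes>\<^bsub>A\<^esub> (c \<odot>\<^bsub>A\<^esub> y) = c \<odot>\<^bsub>A\<^esub> (x \<otimes>\<^bsub>A\<^esub> y)"

definition algebra_of :: "('a, 'm) ring_scheme \<Rightarrow> ('f \<Rightarrow> 'a) \<Rightarrow> ('f, 'a) module" where
  "algebra_of R \<iota> =
     \<lparr>carrier = carrier R, monoid.mult = monoid.mult R, one = \<one>\<^bsub>R\<^esub>,
      ring.zero = \<zero>\<^bsub>R\<^esub>, add = add R, module.smult = (\<lambda>c x. \<iota> c \<otimes>\<^bsub>R\<^esub> x)\<rparr>"

definition scalars :: "('f, 'k) ring_scheme \<Rightarrow> ('f, 'a, 'm) module_scheme \<Rightarrow> 'a set" where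
  "scalars F A = (\<lambda>c. c \<odot>\<^bsub>A\<^esub> \<one>\<^bsub>A\<^esub>) ` carrier F"

definition algebra_hom ::
  "('f, 'k) ring_scheme \<Rightarrow> ('f, 'a, 'm) module_scheme \<Rightarrow> ('f, 'b, 'n) module_scheme \<Rightarrow> ('a \<Rightarrow> 'b) set"
where
  "algebra_hom F A B =
     {h \<in> ring_hom A B. \<forall>c\<in>carrier F. \<forall>x\<in>carrier A. h (c \<odot>\<^bsub>A\<^esub> x) = c \<odot>\<^bsub>B\<^esub> h x}"

definition algebra_embeds ::
  "('f, 'k) ring_scheme \<Rightarrow> ('f, 'a, 'm) module_scheme \<Rightarrow> ('f, 'b, 'n) module_scheme \<Rightarrow> bool"
where
  "algebra_embeds F A B \<longleftrightarrow> (\<exists>h\<in>algebra_hom F A B. inj_on h (carrier A))"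

definition algebra_isomorphic ::
  "('f, 'k) ring_scheme \<Rightarrow> ('f, 'a, 'm) module_scheme \<Rightarrow> ('f, 'b, 'n) module_scheme \<Rightarrow> bool"
where
  "algebra_isomorphic F A B \<longleftrightarrow>
     (\<exists>h\<in>algebra_hom F A B. bij_betw h (carrier A) (carrier B))"

text \<open>The library's \<open>subalgebra\<close> only asks for a linear subspace; here subalgebras are
  closed under multiplication and contain the unit.\<close>

definition is_subalgebra ::
  "('f, 'k) ring_scheme \<Rightarrow> 'a set \<Rightarrow> ('f, 'a, 'm) module_scheme \<Rightarrow> bool"
where
  "is_subalgebra F S A \<longleftrightarrow>
     subring S A \<and> (\<forall>c\<in>carrier F. \<forall>x\<in>S. c \<odot>\<^bsub>A\<^esub> x \<in> S)"

definition contains_subalgebra_isomorphic_to ::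
  "('f, 'k) ring_scheme \<Rightarrow> ('f, 'a, 'm) module_scheme \<Rightarrow> ('f, 'b, 'n) module_scheme \<Rightarrow> bool"
where
  "contains_subalgebra_isomorphic_to F A B \<longleftrightarrow>
     (\<exists>S. is_subalgebra F S A \<and> algebra_isomorphic F B (A\<lparr>carrier := S\<rparr>))"


section \<open>Central simple algebras and p-algebras\<close>

definition ring_center :: "('a, 'm) ring_scheme \<Rightarrow> 'a set" where
  "ring_center A =
     {z \<in> carrier A. \<forall>x\<in>carrier A. z \<otimes>\<^bsub>A\<^esub> x = x \<otimes>\<^bsub>A\<^esub> z}"

definition simple_ring :: "('a, 'm) ring_scheme \<Rightarrow> bool" where
  "simple_ring A \<longleftrightarrow>
     ring A \<and> \<one>\<^bsub>A\<^esub> \<noteq> \<zero>\<^bsub>A\<^esub> \<and> (\<forall>I. ideal I A \<longrightarrow> I = {\<zero>\<^bsub>A\<^esub>} \<or> I = carrier A)"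

text \<open>Central simple of degree \<open>n\<close>, i.e. of dimension \<open>n\<^sup>2\<close> over its center \<open>F\<close>.\<close>

definition central_simple_algebra ::
  "('f, 'k) ring_scheme \<Rightarrow> ('f, 'a, 'm) module_scheme \<Rightarrow> nat \<Rightarrow> bool"
where
  "central_simple_algebra F A n \<longleftrightarrow>
     field F \<and> assoc_algebra F A \<and> simple_ring A \<and> ring_center A = scalars F A \<and>
     ring.dimension A (n\<^sup>2) (scalars F A) (carrier A)"

definition field_of_char :: "nat \<Rightarrow> ('f, 'k) ring_scheme \<Rightarrow> bool" where
  "field_of_char p F \<longleftrightarrow>
     Factorial_Ring.prime p \<and> field F \<and> [p] \<cdot>\<^bsub>F\<^esub> \<one>\<^bsub>F\<^esub> = \<zero>\<^bsub>F\<^esub>"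

definition p_algebra ::
  "nat \<Rightarrow> ('f, 'k) ring_scheme \<Rightarrow> ('f, 'a, 'm) module_scheme \<Rightarrow> bool"
where
  "p_algebra p F A \<longleftrightarrow> field_of_char p F \<and> (\<exists>m. central_simple_algebra F A (p ^ m))"

definition p_algebra_of_degree_p ::
  "nat \<Rightarrow> ('f, 'k) ring_scheme \<Rightarrow> ('f, 'a, 'm) module_scheme \<Rightarrow> bool"
where
  "p_algebra_of_degree_p p F A \<longleftrightarrow> p_algebra p F A \<and> central_simple_algebra F A p"


section \<open>Field extensions\<close>

definition field_extension ::
  "('f, 'k) ring_scheme \<Rightarrow> ('f, 'l, 'm) module_scheme \<Rightarrow> bool"
where
  "field_extension F L \<longleftrightarrow> field F \<and> field L \<and> assoc_algebra F L"

definition extension_of_degree ::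
  "('f, 'k) ring_scheme \<Rightarrow> ('f, 'l, 'm) module_scheme \<Rightarrow> nat \<Rightarrow> bool"
where
  "extension_of_degree F L n \<longleftrightarrow>
     field_extension F L \<and> ring.dimension L n (scalars F L) (carrier L)"

definition purely_inseparable_extension ::
  "nat \<Rightarrow> ('f, 'k) ring_scheme \<Rightarrow> ('f, 'l, 'm) module_scheme \<Rightarrow> bool"
where
  "purely_inseparable_extension p F L \<longleftrightarrow>
     field_extension F L \<and> (\<forall>x\<in>carrier L. \<exists>n::nat. x [^]\<^bsub>L\<^esub> (p ^ n) \<in> scalars F L)"

definition galois_group ::
  "('f, 'k) ring_scheme \<Rightarrow> ('f, 'l, 'm) module_scheme \<Rightarrow> ('l \<Rightarrow> 'l) monoid"
where
  "galois_group F L =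
     (BijGroup (carrier L))\<lparr>carrier := Bij (carrier L) \<inter> algebra_hom F L L\<rparr>"

text \<open>A finite extension is Galois (normal and separable) iff the fixed field of its
  automorphism group is the base field.\<close>

definition galois_extension ::
  "('f, 'k) ring_scheme \<Rightarrow> ('f, 'l, 'm) module_scheme \<Rightarrow> bool"
where
  "galois_extension F L \<longleftrightarrow>
     (\<exists>n. extension_of_degree F L n) \<and>
     {x \<in> carrier L. \<forall>\<sigma>\<in>carrier (galois_group F L). \<sigma> x = x} = scalars F L"

definition cyclic_separable_extension ::
  "('f, 'k) ring_scheme \<Rightarrow> ('f, 'l, 'm) module_scheme \<Rightarrow> bool"
where
  "cyclic_separable_extension F L \<longleftrightarrow>
     galois_extension F L \<and> cyclic_group (galois_group F L)"

text \<open>In the next two definitions \<open>L\<close> ranges over the extensions whose elements live in the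
  type \<open>'l\<close>. Every extension of \<open>F\<close> of finite degree \<open>n\<close> is in bijection with \<open>F\<^sup>n\<close>, so it has
  an isomorphic copy in \<open>'l\<close> as soon as \<open>'l\<close> has room for \<open>F\<^sup>n\<close>.\<close>

definition share_purely_inseparable ::
  "'l itself \<Rightarrow> nat \<Rightarrow> ('f, 'k) ring_scheme \<Rightarrow>
     ('f, 'a, 'm) module_scheme \<Rightarrow> ('f, 'b, 'n) module_scheme \<Rightarrow> bool"
where
  "share_purely_inseparable _ p F A A' \<longleftrightarrow>
     (\<forall>L :: ('f, 'l) module.
        extension_of_degree F L p \<and> purely_inseparable_extension p F L \<longrightarrow>
        (algebra_embeds F L A \<longleftrightarrow> algebra_embeds F L A'))"

definition share_cyclic_separable ::
  "'l itself \<Rightarrow> nat \<Rightarrow> ('f, 'k) ring_scheme \<Rightarrow>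
     ('f, 'a, 'm) module_scheme \<Rightarrow> ('f, 'b, 'n) module_scheme \<Rightarrow> bool"
where
  "share_cyclic_separable _ p F A A' \<longleftrightarrow>
     (\<forall>L :: ('f, 'l) module.
        extension_of_degree F L p \<and> cyclic_separable_extension F L \<longrightarrow>
        (algebra_embeds F L A \<longleftrightarrow> algebra_embeds F L A'))"


section \<open>The algebra F[x : x^p - x = a]\<close>

definition artin_schreier_poly :: "nat \<Rightarrow> ('f, 'k) ring_scheme \<Rightarrow> 'f \<Rightarrow> 'f list" where
  "artin_schreier_poly p F a =
     (X\<^bsub>F\<^esub> [^]\<^bsub>poly_ring F\<^esub> p \<ominus>\<^bsub>poly_ring F\<^esub> X\<^bsub>F\<^esub>) \<ominus>\<^bsub>poly_ring F\<^esub> ring.poly_of_const F a"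

definition artin_schreier_algebra ::
  "nat \<Rightarrow> ('f, 'k) ring_scheme \<Rightarrow> 'f \<Rightarrow> ('f, 'f list set) module"
where
  "artin_schreier_algebra p F a =
     algebra_of (Rupt\<^bsub>F\<^esub> (carrier F) (artin_schreier_poly p F a))
       (\<lambda>c. ring.rupture_surj F (carrier F) (artin_schreier_poly p F a) (ring.poly_of_const F c))"


section \<open>The symbol algebra [a, b)\<close>

datatype symbol_gen = Gen_x | Gen_y

text \<open>The free algebra on \<open>x\<close>, \<open>y\<close>: finitely supported functions on words, where the product
  sums over all ways of cutting a word in two.\<close>

definition free_algebra :: "('f, 'k) ring_scheme \<Rightarrow> (symbol_gen list \<Rightarrow> 'f) ring" where
  "free_algebra F =
     \<lparr>carrier = {f. (\<forall>w. f w \<in> carrier F) \<and> finite {w. f w \<noteq> \<zero>\<^bsub>F\<^esub>}},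
      monoid.mult = (\<lambda>f g w. \<Oplus>\<^bsub>F\<^esub>i\<in>{..length w}. f (take i w) \<otimes>\<^bsub>F\<^esub> g (drop i w)),
      one = (\<lambda>w. if w = [] then \<one>\<^bsub>F\<^esub> else \<zero>\<^bsub>F\<^esub>),
      ring.zero = (\<lambda>w. \<zero>\<^bsub>F\<^esub>),
      add = (\<lambda>f g w. f w \<oplus>\<^bsub>F\<^esub> g w)\<rparr>"

definition free_const :: "('f, 'k) ring_scheme \<Rightarrow> 'f \<Rightarrow> symbol_gen list \<Rightarrow> 'f" where
  "free_const F c = (\<lambda>w. if w = [] then c else \<zero>\<^bsub>F\<^esub>)"

definition free_gen :: "('f, 'k) ring_scheme \<Rightarrow> symbol_gen \<Rightarrow> symbol_gen list \<Rightarrow> 'f" where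
  "free_gen F s = (\<lambda>w. if w = [s] then \<one>\<^bsub>F\<^esub> else \<zero>\<^bsub>F\<^esub>)"

text \<open>For \<open>b \<noteq> 0\<close> the relation \<open>y\<^sup>p = b\<close> makes \<open>y\<close> invertible with inverse \<open>b\<inverse> y\<^sup>p\<^sup>-\<^sup>1\<close>; the
  relation \<open>y x y\<inverse> = x + 1\<close> is written below as \<open>y x = (x + 1) y\<close>.\<close>

definition symbol_relations ::
  "nat \<Rightarrow> ('f, 'k) ring_scheme \<Rightarrow> 'f \<Rightarrow> 'f \<Rightarrow> (symbol_gen list \<Rightarrow> 'f) set"
where
  "symbol_relations p F a b =
     (let R = free_algebra F; x = free_gen F Gen_x; y = free_gen F Gen_y in
       {(x [^]\<^bsub>R\<^esub> p \<ominus>\<^bsub>R\<^esub> x) \<ominus>\<^bsub>R\<^esub> free_const F a,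
        y [^]\<^bsub>R\<^esub> p \<ominus>\<^bsub>R\<^esub> free_const F b,
        (y \<otimes>\<^bsub>R\<^esub> x) \<ominus>\<^bsub>R\<^esub> ((x \<oplus>\<^bsub>R\<^esub> \<one>\<^bsub>R\<^esub>) \<otimes>\<^bsub>R\<^esub> y)})"

definition symbol_ideal ::
  "nat \<Rightarrow> ('f, 'k) ring_scheme \<Rightarrow> 'f \<Rightarrow> 'f \<Rightarrow> (symbol_gen list \<Rightarrow> 'f) set"
where
  "symbol_ideal p F a b = Idl\<^bsub>free_algebra F\<^esub> (symbol_relations p F a b)"

definition symbol_algebra ::
  "nat \<Rightarrow> ('f, 'k) ring_scheme \<Rightarrow> 'f \<Rightarrow> 'f \<Rightarrow> ('f, (symbol_gen list \<Rightarrow> 'f) set) module"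
where
  "symbol_algebra p F a b =
     algebra_of (free_algebra F Quot symbol_ideal p F a b)
       (\<lambda>c. symbol_ideal p F a b +>\<^bsub>free_algebra F\<^esub> free_const F c)"


section \<open>The fields E(\<alpha>, \<beta>), K and F = K(t)\<close>

text \<open>\<open>'e ratfun2\<close> is \<open>Frac E[\<alpha>][\<beta>]\<close>, with \<open>\<alpha>\<close> the variable of the inner polynomial ring.\<close>

type_synonym 'e ratfun2 = "'e poly poly fract"
type_synonym 'e perf_ratfun2 = "'e ratfun2 perfect_closure"
type_synonym 'e main_field = "'e perf_ratfun2 poly fract"

definition const_main :: "'e::Fields.field perf_ratfun2 \<Rightarrow> 'e main_field" where
  "const_main c = to_fract [:c:]"

definition \<alpha>_main :: "'e::Fields.field main_field" where
  "\<alpha>_main = const_main (to_perf (to_fract [:[:0, 1:]:]))"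

definition \<beta>_main :: "'e::Fields.field main_field" where
  "\<beta>_main = const_main (to_perf (to_fract [:0, 1:]))"

definition t_main :: "'e::Fields.field main_field" where
  "t_main = to_fract [:0, 1:]"

end

theory Submission
  imports Defs "HOL-Computational_Algebra.Formal_Laurent_Series"
begin

text \<open>
  Write \<open>K\<close> for the perfect closure of \<open>E(\<alpha>, \<beta>)\<close> and \<open>F = K(t)\<close>. Both symbol algebras
  \<open>[\<alpha>, t)\<close> and \<open>[\<beta>, t)\<close> contain an element \<open>y\<close> with \<open>y\<^sup>p = t\<close>. Since \<open>K\<close> is perfect,
  \<open>1, t, \<dots>, t\<^sup>p\<^sup>-\<^sup>1\<close> is a basis of \<open>F\<close> over its \<open>p\<close>-th powers (\<open>rational_function_p_basis\<close>), so
  every purely inseparable extension of degree \<open>p\<close>, generated by a \<open>p\<close>-th root of an element of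
  \<open>F\<close>, is generated by a \<open>p\<close>-th root of some \<open>\<Sum> d\<^sub>i\<^sup>p t\<^sup>i\<close>, and such a root is \<open>\<Sum> d\<^sub>i y\<^sup>i\<close> in either algebra (\<open>insep_embeds\<close>). This is why
  the two algebras share all these extensions.

  The cyclic extension \<open>F[x : x\<^sup>p - x = \<alpha>]\<close> lies in \<open>[\<alpha>, t)\<close> by definition. In \<open>[\<beta>, t)\<close> let
  \<open>x\<close> be the generator with \<open>x\<^sup>p - x = \<beta>\<close>. The algebra \<open>[\<beta>, t)\<close> embeds into the skew Laurent
  series in \<open>y\<close> over \<open>K(x)\<close>, because \<open>t = y\<^sup>p\<close>. If \<open>z\<^sup>p - z = \<alpha>\<close>, then \<open>z\<close> has no pole: the
  lowest term of \<open>z\<^sup>p\<close> would have no counterpart. So the constant term \<open>c\<close> of \<open>z\<close> is an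
  element of \<open>K(x)\<close> with \<open>c\<^sup>p - c = \<alpha>\<close> (\<open>AS_root_constant_term\<close>). Replacing \<open>x\<close> by \<open>x + 1\<close>
  changes \<open>c\<close> by an element \<open>k\<close> of the prime field, hence \<open>c = k x + e\<close> with \<open>e\<close> in \<open>K\<close>, and
  \<open>e\<^sup>p - e = \<alpha> - k \<beta>\<close> (\<open>AS_root_imp\<close>). Raised to a suitable power of \<open>p\<close>, and by
  \<open>\<gamma>\<^sup>p = \<gamma> + (\<gamma>\<^sup>p - \<gamma>)\<close>, this equation descends from \<open>K\<close> to \<open>E(\<alpha>, \<beta>)\<close>
  (\<open>perfect_closure_AS_root\<close>), where it contradicts a comparison of degrees: \<open>p\<close> would divide \<open>1\<close>
  (\<open>no_AS_root_linear_comb\<close>).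

  The symbol algebra is given by generators and relations, so its structure is read off a
  representation (locale \<open>symbol_rep\<close>). On functions on the set \<open>\<xi> + {0, \<dots>, p - 1}\<close> of roots of
  \<open>X\<^sup>p - X = a\<close>, with values in a field containing a \<open>p\<close>-th root \<open>\<eta>\<close> of \<open>b\<close>, let \<open>x\<close> act as
  multiplication by the argument and \<open>y\<close> as the translation by \<open>1\<close> followed by multiplication by
  \<open>\<eta>\<close>. This shows that the monomials \<open>x\<^sup>i y\<^sup>j\<close> with \<open>i, j < p\<close> are linearly independent
  (\<open>symbol_indep_A\<close>), and central simplicity follows by taking commutators with \<open>x\<close> and
  conjugating with \<open>y\<close> (\<open>one_mem_ideal\<close>). With Laurent series in \<open>\<eta> = y\<close> as the field of values,
  the same representation carries the valuation argument above.

  Extensions generated by one element are handled through \<open>presented_by\<close>, which says that an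
  algebra is the quotient of the polynomial ring by a given polynomial; embeddings, degrees and
  automorphisms are then computed with ordinary polynomials over \<open>F\<close>.\<close>

hide_const (open) Polynomials.degree

section \<open>Polynomials over a field of characteristic p\<close>

lemma of_nat_inj_below_char:
  assumes "CHAR('a::Fields.field) = p"
  shows "inj_on (of_nat :: nat \<Rightarrow> 'a) {..<p}"
proof (rule inj_onI)
  fix i j assume ij: "i \<in> {..<p}" "j \<in> {..<p}" and eq: "(of_nat i :: 'a) = of_nat j"
  have *: "i = j" if "i \<le> j" "j < p" "(of_nat i :: 'a) = of_nat j" for i j
  proof -
    have "(of_nat (j - i) :: 'a) = 0" using that by (simp add: of_nat_diff)
    then have "p dvd j - i" using assms of_nat_eq_0_iff_char_dvd by blast
    then show ?thesis using that by (metis dvd_imp_le less_imp_diff_less not_le zero_less_diff diff_diff_cancel diff_is_0_eq le_antisym)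
  qed
  show "i = j" using *[of i j] *[of j i] ij eq by (metis lessThan_iff nat_le_linear)
qed

text \<open>Such a polynomial takes one value at all \<open>p\<close> points of the prime field, which is more points
  than its degree allows.\<close>

lemma shift_invariant_imp_constant:
  fixes P :: "'a::Fields.field poly"
  assumes char: "CHAR('a) = p" and deg: "degree P < p" and inv: "P \<circ>\<^sub>p [:1, 1:] = P"
  obtains c where "P = [:c:]"
proof -
  have step: "poly P (z + 1) = poly P z" for z
    using arg_cong[OF inv, of "\<lambda>Q. poly Q z"] by (simp add: poly_pcompose add.commute)
  have "poly P (of_nat k) = poly P 0" for k
    by (induction k) (simp, metis step of_nat_Suc add.commute)
  then have "P = [:poly P 0:]"
    using deg of_nat_inj_below_char[OF char] char
    by (intro poly_eqI_degree[of "of_nat ` {..<p}"]) (auto simp: card_image)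
  then show ?thesis using that by blast
qed

lemma degree_shift_diff_less:
  fixes P :: "'a::Fields.field poly"
  assumes "degree P > 0"
  shows "degree (P \<circ>\<^sub>p [:1, 1:] - P) < degree P"
proof -
  have "degree (P \<circ>\<^sub>p [:1, 1:] - P) \<le> degree P"
    by (intro degree_diff_le) (simp_all add: degree_pcompose)
  moreover have "poly.coeff (P \<circ>\<^sub>p [:1, 1:] - P) (degree P) = 0"
    using lead_coeff_comp[of "[:1,1:]" P] by (simp add: degree_pcompose)
  ultimately show ?thesis
    using assms by (metis leading_coeff_0_iff degree_0 le_neq_implies_less)
qed

lemma of_nat_power_char:
  assumes p: "Factorial_Ring.prime p" and char: "CHAR('a::Fields.field) = p"
  shows "(of_nat k :: 'a) ^ p = of_nat k"
proof (induction k)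
  case 0
  then show ?case using p by (simp add: prime_gt_0_nat)
next
  case (Suc k)
  have "(of_nat (Suc k) :: 'a) ^ p = (1 + of_nat k) ^ p" by simp
  also have "\<dots> = 1 ^ p + of_nat k ^ p"
    using p char by (intro freshmans_dream) auto
  finally show ?case using Suc by simp
qed

text \<open>The \<open>p\<close> elements of the prime field already exhaust the roots of \<open>X\<^sup>p - X\<close>.\<close>

lemma fixed_by_frobenius:
  fixes d :: "'a::Fields.field"
  assumes p: "Factorial_Ring.prime p" and char: "CHAR('a) = p" and d: "d ^ p = d"
  shows "\<exists>k<p. d = of_nat k"
proof (rule ccontr)
  assume *: "\<not> ?thesis"
  let ?P = "Polynomial.monom 1 p - [:0, 1::'a:]"
  have p1: "p > 1" using p prime_gt_1_nat by blast
  note pow = of_nat_power_char[OF p char]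
  have deg: "degree ?P = p"
    using p1
    by (subst diff_conv_add_uminus, subst degree_add_eq_left) (auto simp: degree_monom_eq)
  then have nz: "?P \<noteq> 0" using p1 by auto
  have "insert d (of_nat ` {..<p}) \<subseteq> {x. poly ?P x = 0}"
    using pow d by (auto simp: poly_monom)
  then have "card (insert d (of_nat ` {..<p})) \<le> degree ?P"
    using card_poly_roots_bound[OF nz] poly_roots_finite[OF nz]
    by (meson card_mono le_trans)
  moreover have "card (insert d (of_nat ` {..<p}) :: 'a set) = Suc p"
    using * of_nat_inj_below_char[OF char] by (subst card_insert_disjoint) (auto simp: card_image)
  ultimately show False using deg by simp
qed

lemma power_char_diff:
  fixes x y :: "'a::Fields.field"
  assumes p: "Factorial_Ring.prime p" and char: "CHAR('a) = p"
  shows "(x - y) ^ p = x ^ p - y ^ p"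
proof -
  have "(x - y + y) ^ p = (x - y) ^ p + y ^ p"
    using p char by (intro freshmans_dream) auto
  then show ?thesis by (simp add: algebra_simps)
qed

lemma prod_linear_dvd:
  fixes P :: "'a::Fields.field poly"
  assumes "finite A" and "P dvd (\<Prod>k\<in>A. [:- g k, 1:])"
  shows "\<exists>B c. B \<subseteq> A \<and> P = Polynomial.smult c (\<Prod>k\<in>B. [:- g k, 1:])"
  using assms
proof (induction A arbitrary: P rule: finite_induct)
  case empty
  then have "P dvd 1" by simp
  then obtain c where "P = [:c:]"
    by (metis is_unit_polyE)
  then show ?case by (intro exI[of _ "{}"] exI[of _ c]) simp
next
  case (insert a A)
  let ?l = "[:- g a, 1:]" and ?G = "\<Prod>k\<in>A. [:- g k, 1:]"
  have dvd: "P dvd ?l * ?G" using insert by simp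
  then obtain Q where Q: "?l * ?G = P * Q" by (auto simp: dvd_def)
  show ?case
  proof (cases "poly P (g a) = 0")
    case True
    then obtain P' where P': "P = ?l * P'" by (metis poly_eq_0_iff_dvd dvd_def)
    then have "P' dvd ?G" using dvd by (simp only: dvd_mult_cancel_left) simp
    then obtain B c where B: "B \<subseteq> A" "P' = Polynomial.smult c (\<Prod>k\<in>B. [:- g k, 1:])"
      using insert.IH by blast
    have "a \<notin> B" "finite B" using B insert.hyps finite_subset by auto
    then have "P = Polynomial.smult c (\<Prod>k\<in>insert a B. [:- g k, 1:])"
      using P' B by simp
    then show ?thesis using B by blast
  next
    case False
    have "poly (P * Q) (g a) = 0" by (simp flip: Q)
    then have "poly Q (g a) = 0" using False by simp
    then obtain Q' where Q': "Q = ?l * Q'" by (metis poly_eq_0_iff_dvd dvd_def)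
    have "?l * ?G = ?l * (P * Q')" using Q Q' by (simp only: mult_ac)
    then have "?G = P * Q'" by (metis mult_cancel_left pCons_eq_0_iff zero_neq_one)
    then show ?thesis using insert.IH[of P] by (metis dvd_triv_left subset_insertI2)
  qed
qed

lemma degree_prod_linear:
  fixes g :: "'i \<Rightarrow> 'a::Fields.field"
  assumes "finite B"
  shows "degree (\<Prod>k\<in>B. [:- g k, 1:]) = card B"
  by (subst degree_prod_eq_sum_degree) (auto simp: assms)

lemma lead_coeff_prod_linear:
  fixes g :: "'i \<Rightarrow> 'a::Fields.field"
  assumes "finite B"
  shows "poly.coeff (\<Prod>k\<in>B. [:- g k, 1:]) (card B) = 1"
  using lead_coeff_prod[of "\<lambda>k. [:- g k, 1:]" B] degree_prod_linear[OF assms, of g] by simp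

lemma subleading_coeff_prod_linear:
  fixes g :: "'i \<Rightarrow> 'a::Fields.field"
  assumes "finite B" and "card B = Suc n"
  shows "poly.coeff (\<Prod>k\<in>B. [:- g k, 1:]) n = - (\<Sum>k\<in>B. g k)"
  using assms
proof (induction B arbitrary: n rule: finite_induct)
  case (insert a B)
  then have n: "card B = n" by simp
  show ?case
  proof (cases n)
    case 0
    then show ?thesis using insert n by simp
  next
    case (Suc m)
    then show ?thesis
      using insert n lead_coeff_prod_linear[OF insert.hyps(1), of g] by (simp add: coeff_pCons)
  qed
qed simp

locale field_embedding =
  fixes \<iota> :: "'a::Fields.field \<Rightarrow> 'b::Fields.field"
  assumes emb_add: "\<iota> (x + y) = \<iota> x + \<iota> y"
    and emb_mult: "\<iota> (x * y) = \<iota> x * \<iota> y"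
    and emb_1: "\<iota> 1 = 1"
begin

lemma emb_0: "\<iota> 0 = 0" by (metis add_cancel_right_right emb_add)

lemma emb_uminus: "\<iota> (- x) = - \<iota> x" by (metis add.right_inverse add_eq_0_iff emb_0 emb_add)

lemma emb_diff: "\<iota> (x - y) = \<iota> x - \<iota> y" using emb_add[of x "- y"] by (simp add: emb_uminus)

lemma emb_eq_0_iff: "\<iota> x = 0 \<longleftrightarrow> x = 0"
proof
  assume "\<iota> x = 0"
  then show "x = 0" using emb_mult[of x "inverse x"] emb_1 by (cases "x = 0") auto
qed (simp add: emb_0)

lemma emb_eq_iff: "\<iota> x = \<iota> y \<longleftrightarrow> x = y"
  using emb_eq_0_iff[of "x - y"] by (simp add: emb_diff)

lemma emb_inverse: "\<iota> (inverse x) = inverse (\<iota> x)"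
proof (cases "x = 0")
  case False
  have "\<iota> x * \<iota> (inverse x) = 1" using False by (simp add: emb_1 flip: emb_mult)
  then show ?thesis by (simp add: inverse_unique)
qed (simp add: emb_0)

lemma emb_power: "\<iota> (x ^ n) = \<iota> x ^ n" by (induction n) (simp_all add: emb_1 emb_mult)

lemma emb_of_nat: "\<iota> (of_nat n) = of_nat n" by (induction n) (simp_all add: emb_0 emb_1 emb_add)

lemma emb_sum: "\<iota> (sum h A) = (\<Sum>i\<in>A. \<iota> (h i))"
  by (induction A rule: infinite_finite_induct) (simp_all add: emb_0 emb_add)

lemma map_emb_add: "map_poly \<iota> (P + Q) = map_poly \<iota> P + map_poly \<iota> Q"
  by (intro poly_eqI) (simp add: coeff_map_poly emb_0 emb_add)

lemma map_emb_smult: "map_poly \<iota> (Polynomial.smult c P) = Polynomial.smult (\<iota> c) (map_poly \<iota> P)"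
  by (intro poly_eqI) (simp add: coeff_map_poly emb_0 emb_mult)

lemma map_emb_diff: "map_poly \<iota> (P - Q) = map_poly \<iota> P - map_poly \<iota> Q"
  by (intro poly_eqI) (simp add: coeff_map_poly emb_0 emb_diff)

lemma map_emb_pCons: "map_poly \<iota> (pCons c P) = pCons (\<iota> c) (map_poly \<iota> P)"
  by (simp add: map_poly_pCons emb_0)

lemma map_emb_mult: "map_poly \<iota> (P * Q) = map_poly \<iota> P * map_poly \<iota> Q"
  by (induction P) (simp_all add: map_emb_add map_emb_smult map_emb_pCons emb_0)

lemma map_emb_monom: "map_poly \<iota> (Polynomial.monom c n) = Polynomial.monom (\<iota> c) n"
  by (simp add: map_poly_monom emb_0)

lemma degree_map_emb: "degree (map_poly \<iota> P) = degree P"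
  by (rule degree_map_poly) (simp add: emb_eq_0_iff)

lemma map_emb_eq_0_iff: "map_poly \<iota> P = 0 \<longleftrightarrow> P = 0"
  by (simp add: map_poly_eq_0_iff emb_0 emb_eq_0_iff)

lemma char_emb: "CHAR('b) = CHAR('a)"
  by (rule CHAR_eqI) (metis emb_of_nat emb_eq_0_iff of_nat_CHAR, metis emb_of_nat emb_eq_0_iff of_nat_eq_0_iff_char_dvd)

text \<open>The subleading coefficient of a factor of degree \<open>d\<close> of \<open>f\<close> is \<open>- (d \<xi> + k e)\<close> for some
  natural number \<open>k\<close>. Since \<open>d\<close> is invertible modulo \<open>p\<close> for \<open>0 < d < p\<close>, a proper factor over
  the base field would put \<open>\<xi>\<close> into the base field. The case \<open>e = 1\<close> is the Artin-Schreier
  polynomial, the case \<open>e = 0\<close> is \<open>X\<^sup>p - \<xi>\<^sup>p\<close>.\<close>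

lemma no_annihilator_of_small_degree:
  assumes p: "Factorial_Ring.prime p" and char: "CHAR('a) = p"
    and f: "map_poly \<iota> f = (\<Prod>k<p. [:- (\<xi> + of_nat k * \<iota> e), 1:])"
    and \<xi>: "\<xi> \<notin> range \<iota>"
    and R: "poly (map_poly \<iota> R) \<xi> = 0" "degree R < p"
  shows "R = 0"
proof (rule ccontr)
  assume "R \<noteq> 0"
  \<comment> \<open>\<open>M\<close> below plays the role of the minimal polynomial of \<open>\<xi>\<close>, so it divides \<open>f\<close>.\<close>
  let ?Ann = "\<lambda>n. \<exists>R. R \<noteq> 0 \<and> poly (map_poly \<iota> R) \<xi> = 0 \<and> degree R = n"
  define d where "d = (LEAST n. ?Ann n)"
  have "?Ann (degree R)" using R \<open>R \<noteq> 0\<close> by blast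
  then have "?Ann d" and dle: "d \<le> degree R" unfolding d_def by (rule LeastI, rule Least_le)
  then obtain M where M: "M \<noteq> 0" "poly (map_poly \<iota> M) \<xi> = 0" "degree M = d" by blast
  have dp: "d < p" using dle R by simp
  let ?r = "f mod M"
  have "f = f div M * M + ?r" by simp
  then have "map_poly \<iota> f = map_poly \<iota> (f div M) * map_poly \<iota> M + map_poly \<iota> ?r"
    by (metis map_emb_add map_emb_mult)
  moreover have "poly (map_poly \<iota> f) \<xi> = 0"
    unfolding f poly_prod using p by (intro prod_zero) (auto intro!: bexI[of _ 0] simp: prime_gt_0_nat)
  ultimately have "poly (map_poly \<iota> ?r) \<xi> = 0" using M by simp
  moreover have "?r = 0 \<or> degree ?r < d" using degree_mod_less M by blast
  ultimately have "?r = 0" using not_less_Least[of "degree ?r" ?Ann] unfolding d_def by blast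
  then have "f = M * (f div M)" by (metis mult.commute add.right_neutral div_mult_mod_eq)
  then have "map_poly \<iota> M dvd map_poly \<iota> f" by (metis map_emb_mult dvd_triv_left)
  then obtain B c where B: "B \<subseteq> {..<p}" and
    MB: "map_poly \<iota> M = Polynomial.smult c (\<Prod>k\<in>B. [:- (\<xi> + of_nat k * \<iota> e), 1:])" 
    using prod_linear_dvd[OF finite_lessThan, of "map_poly \<iota> M" "\<lambda>k. \<xi> + of_nat k * \<iota> e" p] unfolding f by blast
  have finB: "finite B" using B finite_subset by blast
  have c: "c \<noteq> 0" by (metis MB M(1) map_emb_eq_0_iff smult_0_left)
  have cd: "card B = d"
    using arg_cong[OF MB, of degree] c M by (simp add: degree_map_emb degree_prod_linear[OF finB] del: minus_add_distrib)
  have d0: "d \<noteq> 0"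
  proof
    assume "d = 0"
    then obtain m where "M = [:m:]" using M degree_eq_zeroE by blast
    then show False using M by (simp add: map_emb_pCons emb_eq_0_iff)
  qed
  then obtain n where n: "d = Suc n" using not0_implies_Suc by blast
  have cc: "\<iota> (poly.coeff M d) = c"
    using arg_cong[OF MB, of "\<lambda>P. poly.coeff P d"] lead_coeff_prod_linear[OF finB, of "\<lambda>k. \<xi> + of_nat k * \<iota> e"] cd
    by (simp add: coeff_map_poly emb_0)
  have "\<iota> (poly.coeff M n) = - c * (\<Sum>k\<in>B. \<xi> + of_nat k * \<iota> e)"
    using arg_cong[OF MB, of "\<lambda>P. poly.coeff P n"] subleading_coeff_prod_linear[OF finB, of n "\<lambda>k. \<xi> + of_nat k * \<iota> e"] cd n
    by (simp add: coeff_map_poly emb_0)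
  then have "- \<iota> (poly.coeff M n) / c = of_nat d * \<xi> + (\<Sum>k\<in>B. of_nat k * \<iota> e)"
    using c cd by (simp add: sum.distrib)
  then have eq: "of_nat d * \<xi> = \<iota> (- poly.coeff M n / poly.coeff M d - (\<Sum>k\<in>B. of_nat k * e))"
    by (simp add: emb_diff emb_sum emb_mult emb_uminus emb_of_nat emb_inverse cc divide_inverse)
  have "\<not> p dvd d" using dp d0 by (auto dest: dvd_imp_le)
  then have "(of_nat d :: 'a) \<noteq> 0" using char of_nat_eq_0_iff_char_dvd by blast
  then have "\<xi> = \<iota> ((- poly.coeff M n / poly.coeff M d - (\<Sum>k\<in>B. of_nat k * e)) / of_nat d)"
    using eq emb_of_nat[of d] by (simp add: divide_inverse emb_mult emb_inverse emb_eq_0_iff) (metis emb_eq_0_iff emb_of_nat mult.commute nonzero_mult_div_cancel_right divide_inverse)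
  then show False using \<xi> by blast
qed

end

abbreviation AS_poly :: "nat \<Rightarrow> 'a::Fields.field \<Rightarrow> 'a poly" where
  "AS_poly p a \<equiv> Polynomial.monom 1 p - [:a, 1:]"

abbreviation radical_poly :: "nat \<Rightarrow> 'a::Fields.field \<Rightarrow> 'a poly" where
  "radical_poly p c \<equiv> Polynomial.monom 1 p - [:c:]"

lemma degree_AS_poly: "p > 1 \<Longrightarrow> degree (AS_poly p a) = p"
  by (subst diff_conv_add_uminus, subst degree_add_eq_left) (auto simp: degree_monom_eq)

lemma degree_radical_poly: "p > 0 \<Longrightarrow> degree (radical_poly p a) = p"
  by (subst diff_conv_add_uminus, subst degree_add_eq_left) (auto simp: degree_monom_eq)

lemma AS_poly_factorization:
  fixes \<xi> :: "'a::Fields.field"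
  assumes p: "Factorial_Ring.prime p" and char: "CHAR('a) = p"
  shows "AS_poly p (\<xi> ^ p - \<xi>) = (\<Prod>k<p. [:- (\<xi> + of_nat k), 1:])"
proof (rule poly_eqI_degree_lead_coeff[of _ p _ "(\<lambda>k. \<xi> + of_nat k) ` {..<p}"])
  have p1: "p > 1" using p prime_gt_1_nat by blast
  have lc: "poly.coeff (\<Prod>k<p. [:- (\<xi> + of_nat k), 1:]) p = 1"
    using lead_coeff_prod_linear[of "{..<p}" "\<lambda>k. \<xi> + of_nat k"] by simp
  show "poly.coeff (AS_poly p (\<xi> ^ p - \<xi>)) p = poly.coeff (\<Prod>k<p. [:- (\<xi> + of_nat k), 1:]) p"
    unfolding lc using p1 by (cases p) (auto simp: coeff_pCons split: nat.split)
  show "p \<le> card ((\<lambda>k. \<xi> + of_nat k) ` {..<p})"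
    using of_nat_inj_below_char[OF char] by (subst card_image) (auto simp: inj_on_def)
  show "degree (AS_poly p (\<xi> ^ p - \<xi>)) \<le> p" using degree_AS_poly p1 by (metis order_refl)
  show "degree (\<Prod>k<p. [:- (\<xi> + of_nat k), 1:]) \<le> p"
    using degree_prod_linear[of "{..<p}" "\<lambda>k. \<xi> + of_nat k"] by simp
  fix z assume "z \<in> (\<lambda>k. \<xi> + of_nat k) ` {..<p}"
  then obtain k where k: "z = \<xi> + of_nat k" "k < p" by blast
  have "z ^ p = \<xi> ^ p + of_nat k ^ p"
    unfolding k(1) using p char by (intro freshmans_dream) auto
  then have "z ^ p = \<xi> ^ p + of_nat k" by (simp only: of_nat_power_char[OF p char])
  then have "poly (AS_poly p (\<xi> ^ p - \<xi>)) z = 0" by (simp add: poly_monom k)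
  moreover have "poly (\<Prod>k<p. [:- (\<xi> + of_nat k), 1:]) z = 0"
    unfolding poly_prod using k by (intro prod_zero) auto
  ultimately show "poly (AS_poly p (\<xi> ^ p - \<xi>)) z = poly (\<Prod>k<p. [:- (\<xi> + of_nat k), 1:]) z" by simp
qed

lemma radical_poly_factorization:
  fixes \<xi> :: "'a::Fields.field"
  assumes p: "Factorial_Ring.prime p" and char: "CHAR('a) = p"
  shows "radical_poly p (\<xi> ^ p) = (\<Prod>k<p. [:- \<xi>, 1:])"
proof -
  have "([:- \<xi>, 1:] + [:\<xi>:]) ^ p = [:- \<xi>, 1:] ^ p + [:\<xi>:] ^ p"
    using p char by (intro freshmans_dream) auto
  then show ?thesis by (simp add: monom_altdef poly_const_pow algebra_simps)
qed

context field_embedding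
begin

lemma AS_no_annihilator:
  assumes p: "Factorial_Ring.prime p" and char: "CHAR('a) = p"
    and \<xi>: "\<xi> ^ p - \<xi> = \<iota> a" and a: "\<nexists>c. c ^ p - c = a"
    and R: "poly (map_poly \<iota> R) \<xi> = 0" "degree R < p"
  shows "R = 0"
proof (rule no_annihilator_of_small_degree[OF p char _ _ R])
  show "map_poly \<iota> (AS_poly p a) = (\<Prod>k<p. [:- (\<xi> + of_nat k * \<iota> 1), 1:])"
    using AS_poly_factorization[OF p, of \<xi>] char_emb char
    by (simp add: map_emb_diff map_emb_monom map_emb_pCons emb_1 \<xi>)
  show "\<xi> \<notin> range \<iota>"
  proof
    assume "\<xi> \<in> range \<iota>"
    then obtain c where "\<xi> = \<iota> c" by blast
    then have "\<iota> (c ^ p - c) = \<iota> a" using \<xi> by (simp add: emb_diff emb_power)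
    then show False using a emb_eq_iff by blast
  qed
qed

lemma radical_no_annihilator:
  assumes p: "Factorial_Ring.prime p" and char: "CHAR('a) = p"
    and \<xi>: "\<xi> ^ p = \<iota> c" and c: "\<nexists>d. d ^ p = c"
    and R: "poly (map_poly \<iota> R) \<xi> = 0" "degree R < p"
  shows "R = 0"
proof (rule no_annihilator_of_small_degree[OF p char _ _ R])
  show "map_poly \<iota> (radical_poly p c) = (\<Prod>k<p. [:- (\<xi> + of_nat k * \<iota> 0), 1:])"
    using radical_poly_factorization[OF p, of \<xi>] char_emb char
    by (simp add: map_emb_diff map_emb_monom map_emb_pCons emb_1 emb_0 \<xi>)
  show "\<xi> \<notin> range \<iota>"
  proof
    assume "\<xi> \<in> range \<iota>"
    then obtain d where "\<xi> = \<iota> d" by blast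
    then have "\<iota> (d ^ p) = \<iota> c" using \<xi> by (simp add: emb_power)
    then show False using c emb_eq_iff by blast
  qed
qed

end

abbreviation base_ring :: "'f::Fields.field ring" (\<open>\<F>\<close>) where
  "\<F> \<equiv> ring_of_type_algebra"

section \<open>Polynomial evaluation in an associative algebra\<close>

lemma Units_carrier_updI:
  fixes A (structure)
  assumes "x \<in> K" "y \<in> K" "y \<otimes> x = \<one>" "x \<otimes> y = \<one>"
  shows "x \<in> Units (A\<lparr>carrier := K\<rparr>)"
  using assms by (auto simp: Units_def)

locale type_algebra = assoc_algebra \<F> A
  for A :: "('f::Fields.field, 'a, 'm) module_scheme" (structure)
begin

lemma smult_mem [simp, intro]: "u \<in> carrier A \<Longrightarrow> c \<odot> u \<in> carrier A"
  using smult_closed by (simp add: ring_of_type_algebra_def)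

lemma add_smult: "u \<in> carrier A \<Longrightarrow> (c + d) \<odot> u = c \<odot> u \<oplus> d \<odot> u"
  using smult_l_distr[of c d u] by (simp add: ring_of_type_algebra_def)

lemma smult_add: "u \<in> carrier A \<Longrightarrow> v \<in> carrier A \<Longrightarrow> c \<odot> (u \<oplus> v) = c \<odot> u \<oplus> c \<odot> v"
  using smult_r_distr[of c u v] by (simp add: ring_of_type_algebra_def)

lemma smult_smult: "u \<in> carrier A \<Longrightarrow> c \<odot> (d \<odot> u) = (c * d) \<odot> u"
  using smult_assoc1[of c d u] by (simp add: ring_of_type_algebra_def)

lemma one_smult [simp]: "u \<in> carrier A \<Longrightarrow> 1 \<odot> u = u"
  using smult_one[of u] by (simp add: ring_of_type_algebra_def)

lemma smult_mult: "u \<in> carrier A \<Longrightarrow> v \<in> carrier A \<Longrightarrow> (c \<odot> u) \<otimes> v = c \<odot> (u \<otimes> v)"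
  using smult_mult_left[of c u v] by (simp add: ring_of_type_algebra_def)

lemma mult_smult: "u \<in> carrier A \<Longrightarrow> v \<in> carrier A \<Longrightarrow> u \<otimes> (c \<odot> v) = c \<odot> (u \<otimes> v)"
  using smult_mult_right[of c u v] by (simp add: ring_of_type_algebra_def)

lemma zero_smult [simp]: "u \<in> carrier A \<Longrightarrow> 0 \<odot> u = \<zero>"
  using smult_l_null[of u] by (simp add: ring_of_type_algebra_def)

lemma smult_zero [simp]: "c \<odot> \<zero> = \<zero>"
  using smult_r_null[of c] by (simp add: ring_of_type_algebra_def)

lemma uminus_smult: "u \<in> carrier A \<Longrightarrow> (- c) \<odot> u = \<ominus> (c \<odot> u)"
proof -
  assume u: "u \<in> carrier A"
  have "(- c) \<odot> u \<oplus> c \<odot> u = \<zero>" using u add_smult[of u "- c" c] by simp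
  then show ?thesis using u by (simp add: M.minus_equality)
qed

lemma smult_cancel:
  assumes "u \<in> carrier A" "c \<odot> u = \<zero>" "c \<noteq> 0"
  shows "u = \<zero>"
proof -
  have "inverse c \<odot> (c \<odot> u) = u" using assms(1,3) by (simp add: smult_smult)
  then show ?thesis using assms(2) by simp
qed

lemma scalars_eq: "scalars \<F> A = range (\<lambda>c. c \<odot> \<one>)"
  by (simp add: scalars_def ring_of_type_algebra_def)

text \<open>The coefficients come from the base field and the argument from the algebra, so that identities
  between polynomials over the base field transfer to commuting elements of the algebra.\<close>

definition ev :: "'a \<Rightarrow> 'f poly \<Rightarrow> 'a" where
  "ev w P = fold_coeffs (\<lambda>c u. c \<odot> \<one> \<oplus> w \<otimes> u) P \<zero>"

lemma ev_0 [simp]: "ev w 0 = \<zero>"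
  by (simp add: ev_def)

context
  fixes w assumes w [simp, intro]: "w \<in> carrier A"
begin

lemma ev_pCons: "ev w (pCons c P) = c \<odot> \<one> \<oplus> w \<otimes> ev w P"
  by (cases "c = 0 \<and> P = 0") (auto simp: ev_def)

lemma ev_closed [simp, intro]: "ev w P \<in> carrier A"
  by (induction P) (auto simp: ev_pCons)

lemma ev_const: "ev w [:c:] = c \<odot> \<one>"
  by (simp add: ev_pCons)

lemma ev_one: "ev w 1 = \<one>"
  by (simp add: one_pCons ev_const)

lemma ev_X: "ev w [:0, 1:] = w"
  by (simp add: ev_pCons)

lemma ev_add: "ev w (P + Q) = ev w P \<oplus> ev w Q"
proof (induction P arbitrary: Q)
  case (pCons c P)
  show ?case
  proof (cases Q)
    case (pCons d Q')
    have "ev w (pCons c P + Q) = (c \<odot> \<one> \<oplus> d \<odot> \<one>) \<oplus> (w \<otimes> ev w P \<oplus> w \<otimes> ev w Q')"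
      by (simp add: pCons ev_pCons pCons.IH add_smult r_distr)
    also have "\<dots> = (c \<odot> \<one> \<oplus> w \<otimes> ev w P) \<oplus> (d \<odot> \<one> \<oplus> w \<otimes> ev w Q')"
      by (simp add: M.a_ac)
    finally show ?thesis by (simp add: pCons ev_pCons)
  qed
qed simp

lemma ev_smult: "ev w (Polynomial.smult c P) = c \<odot> ev w P"
  by (induction P) (simp_all add: ev_pCons smult_smult smult_add mult_smult)

lemma ev_uminus: "ev w (- P) = \<ominus> ev w P"
  using ev_smult[of "- 1" P] by (simp add: uminus_smult)

lemma ev_diff: "ev w (P - Q) = ev w P \<ominus> ev w Q"
  using ev_add[of P "- Q"] by (simp add: ev_uminus M.minus_eq)

lemma ev_mult: "ev w (P * Q) = ev w P \<otimes> ev w Q"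
proof (induction P)
  case (pCons c P)
  have "ev w (pCons c P * Q) = c \<odot> ev w Q \<oplus> w \<otimes> (ev w P \<otimes> ev w Q)"
    by (simp add: ev_add ev_smult ev_pCons pCons.IH)
  also have "\<dots> = ev w (pCons c P) \<otimes> ev w Q"
    by (simp add: ev_pCons l_distr smult_mult m_assoc)
  finally show ?case .
qed simp

lemma ev_power: "ev w (P ^ n) = ev w P [^] n"
  by (induction n) (simp_all only: power_0 power_Suc2 ev_one ev_mult nat_pow_0 nat_pow_Suc)

lemma ev_sum: "finite I \<Longrightarrow> ev w (\<Sum>i\<in>I. P i) = (\<Oplus>i\<in>I. ev w (P i))"
  by (induction I rule: finite_induct) (simp_all add: ev_add)

lemma ev_commute: "ev w P \<otimes> ev w Q = ev w Q \<otimes> ev w P"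
  by (metis ev_mult mult.commute)

lemma ev_X_power: "w [^] n = ev w ([:0, 1:] ^ n)"
  by (simp add: ev_power ev_X)

lemma ev_monom: "ev w (Polynomial.monom c n) = c \<odot> (w [^] n)"
  by (simp add: monom_altdef ev_smult ev_X_power)

lemma ev_AS_poly: "ev w (AS_poly p a) = (w [^] p \<ominus> w) \<ominus> a \<odot> \<one>"
proof -
  have "AS_poly p a = (Polynomial.monom 1 p - [:0, 1:]) - [:a:]" by simp
  then show ?thesis by (simp only: ev_diff ev_const ev_X ev_monom) simp
qed

lemma ev_radical_poly: "ev w (radical_poly p c) = w [^] p \<ominus> c \<odot> \<one>"
  by (simp add: ev_diff ev_const ev_monom)

end

lemma ev_pcompose:
  assumes w: "w \<in> carrier A"
  shows "ev w (P \<circ>\<^sub>p Q) = ev (ev w Q) P"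
  by (induction P) (simp_all add: w pcompose_pCons ev_add ev_mult ev_const ev_pCons)

subsection \<open>Linear combinations and dimension\<close>

text \<open>Coordinates are indexed by natural numbers, so that the basis \<open>x\<^sup>i y\<^sup>j\<close> of a symbol algebra can be
  enumerated as a single sequence of length \<open>p\<^sup>2\<close>.\<close>

definition lincomb :: "(nat \<Rightarrow> 'a) \<Rightarrow> nat \<Rightarrow> (nat \<Rightarrow> 'f) \<Rightarrow> 'a" where
  "lincomb u n c = (\<Oplus>k\<in>{..<n}. c k \<odot> u k)"

context
  fixes u :: "nat \<Rightarrow> 'a" assumes u [simp, intro]: "\<And>k. u k \<in> carrier A"
begin

lemma lincomb_0 [simp]: "lincomb u 0 c = \<zero>"
  by (simp add: lincomb_def)

lemma lincomb_closed [simp, intro]: "lincomb u n c \<in> carrier A"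
  by (simp add: lincomb_def)

lemma lincomb_Suc: "lincomb u (Suc n) c = c n \<odot> u n \<oplus> lincomb u n c"
  by (simp add: lincomb_def lessThan_Suc)

lemma lincomb_cong: "(\<And>k. k < n \<Longrightarrow> c k = d k) \<Longrightarrow> lincomb u n c = lincomb u n d"
  unfolding lincomb_def by (intro M.finsum_cong') auto

lemma Span_upt: "Span (scalars \<F> A) (rev (map u [0..<n])) = range (lincomb u n)"
proof (induction n)
  case 0
  then show ?case by auto
next
  case (Suc n)
  let ?K = "scalars \<F> A"
  have "Span ?K (rev (map u [0..<Suc n])) = line_extension ?K (u n) (range (lincomb u n))"
    using Suc by simp
  also have "\<dots> = range (lincomb u (Suc n))"
  proof (intro Set.set_eqI iffI)
    fix v assume "v \<in> line_extension ?K (u n) (range (lincomb u n))"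
    then obtain c d where v: "v = (c \<odot> \<one>) \<otimes> u n \<oplus> lincomb u n d"
      by (auto simp: line_extension_mem_iff scalars_eq)
    then have "v = lincomb u (Suc n) (d(n := c))"
      using lincomb_cong[of n "d(n := c)" d] by (simp add: lincomb_Suc smult_mult)
    then show "v \<in> range (lincomb u (Suc n))" by blast
  next
    fix v assume "v \<in> range (lincomb u (Suc n))"
    then obtain c where "v = (c n \<odot> \<one>) \<otimes> u n \<oplus> lincomb u n c"
      by (auto simp: lincomb_Suc smult_mult)
    then show "v \<in> line_extension ?K (u n) (range (lincomb u n))"
      unfolding line_extension_mem_iff scalars_eq by blast
  qed
  finally show ?case .
qed

lemma independent_upt:
  assumes indep: "\<And>c. lincomb u n c = \<zero> \<Longrightarrow> \<forall>k<n. c k = 0"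
  shows "independent (scalars \<F> A) (rev (map u [0..<n]))"
  using indep
proof (induction n)
  case 0
  then show ?case by simp
next
  case (Suc n)
  have "independent (scalars \<F> A) (rev (map u [0..<n]))"
  proof (rule Suc.IH)
    fix c assume "lincomb u n c = \<zero>"
    then have "lincomb u (Suc n) (c(n := 0)) = \<zero>"
      using lincomb_cong[of n "c(n := 0)" c] by (simp add: lincomb_Suc)
    then have "\<forall>k<Suc n. (c(n := 0)) k = 0" by (rule Suc.prems)
    then show "\<forall>k<n. c k = 0" by (metis fun_upd_other less_SucI less_irrefl)
  qed
  moreover have "u n \<notin> range (lincomb u n)"
  proof
    assume "u n \<in> range (lincomb u n)"
    then obtain c where c: "u n = lincomb u n c" by blast
    have "lincomb u (Suc n) (c(n := - 1)) = \<ominus> u n \<oplus> u n"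
      using lincomb_cong[of n "c(n := - 1)" c] c by (simp add: lincomb_Suc uminus_smult)
    then have "lincomb u (Suc n) (c(n := - 1)) = \<zero>" by (simp add: M.l_neg)
    then have "(c(n := - 1)) n = 0" using Suc.prems by blast
    then show False by simp
  qed
  ultimately show ?case using Span_upt[of n] by (simp add: li_Cons del: Span.simps)
qed

lemma dimensionI_lincomb:
  assumes indep: "\<And>c. lincomb u n c = \<zero> \<Longrightarrow> \<forall>k<n. c k = 0"
    and span: "\<And>v. v \<in> carrier A \<Longrightarrow> \<exists>c. v = lincomb u n c"
  shows "dimension n (scalars \<F> A) (carrier A)"
proof -
  have "range (lincomb u n) = carrier A" using span by auto
  then show ?thesis
    using dimension_independent[OF independent_upt[OF indep]] Span_upt[of n] by simp
qed

end

lemma ev_sum_monom: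
  assumes "w \<in> carrier A"
  shows "ev w (\<Sum>k<n. Polynomial.monom (c k) k) = lincomb (\<lambda>k. w [^] k) n c"
  using assms by (simp add: ev_sum ev_monom lincomb_def)

lemma ev_eq_lincomb:
  assumes "w \<in> carrier A" "degree P < n"
  shows "ev w P = lincomb (\<lambda>k. w [^] k) n (poly.coeff P)"
proof -
  have "P = (\<Sum>k<n. Polynomial.monom (poly.coeff P k) k)"
    using assms(2) by (intro poly_eqI) (auto simp: coeff_sum coeff_eq_0)
  then show ?thesis using ev_sum_monom[OF assms(1)] by metis
qed

lemma subfield_scalars:
  assumes "\<one> \<noteq> \<zero>"
  shows "subfield (scalars \<F> A) A"
proof -
  let ?K = "scalars \<F> A"
  have sub: "subring ?K A"
  proof (rule subringI)
    show "\<one> \<in> ?K" unfolding scalars_eq by (rule range_eqI[of _ _ 1]) simp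
  next
    fix h assume "h \<in> ?K"
    then obtain c where "h = c \<odot> \<one>" by (auto simp: scalars_eq)
    then have "\<ominus> h = (- c) \<odot> \<one>" by (simp add: uminus_smult)
    then show "\<ominus> h \<in> ?K" by (auto simp: scalars_eq)
  next
    fix h k assume "h \<in> ?K" "k \<in> ?K"
    then obtain c d where cd: "h = c \<odot> \<one>" "k = d \<odot> \<one>" by (auto simp: scalars_eq)
    have "h \<otimes> k = (c * d) \<odot> \<one>" by (simp add: cd smult_mult smult_smult)
    then show "h \<otimes> k \<in> ?K" by (auto simp: scalars_eq)
    have "h \<oplus> k = (c + d) \<odot> \<one>" by (simp add: cd add_smult)
    then show "h \<oplus> k \<in> ?K" by (auto simp: scalars_eq)
  qed (auto simp: scalars_eq)
  have mult: "(c \<odot> \<one>) \<otimes> (d \<odot> \<one>) = (c * d) \<odot> \<one>" for c d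
    by (simp add: smult_mult smult_smult)
  have zero: "c \<odot> \<one> = \<zero> \<longleftrightarrow> c = 0" for c
    using assms smult_cancel by auto
  have "subdomain ?K A"
    using sub assms by (intro subdomainI subcringI) (auto simp: scalars_eq mult zero mult.commute)
  moreover have "Units (A\<lparr>carrier := ?K\<rparr>) = ?K - {\<zero>}"
  proof (intro Set.set_eqI iffI)
    fix h assume "h \<in> Units (A\<lparr>carrier := ?K\<rparr>)"
    then obtain k where "h \<in> ?K" "k \<in> ?K" "k \<otimes> h = \<one>" by (auto simp: Units_def)
    moreover have "h \<noteq> \<zero>"
      using calculation assms by (auto simp: scalars_eq)
    ultimately show "h \<in> ?K - {\<zero>}" by simp
  next
    fix h assume "h \<in> ?K - {\<zero>}"
    then obtain c where "h = c \<odot> \<one>" "h \<noteq> \<zero>" by (auto simp: scalars_eq)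
    then have c: "h = c \<odot> \<one>" "c \<noteq> 0" using zero by auto
    have hK: "h \<in> ?K" using \<open>h \<in> ?K - {\<zero>}\<close> by (rule DiffD1)
    have iK: "inverse c \<odot> \<one> \<in> ?K" by (auto simp: scalars_eq)
    have "(inverse c \<odot> \<one>) \<otimes> h = \<one>" "h \<otimes> (inverse c \<odot> \<one>) = \<one>"
      using c by (simp_all add: mult)
    then show "h \<in> Units (A\<lparr>carrier := ?K\<rparr>)" by (rule Units_carrier_updI[OF hK iK])
  qed
  ultimately show ?thesis by (intro subfield.intro subfield_axioms.intro)
qed

end

lemma type_algebraI: "assoc_algebra \<F> A \<Longrightarrow> type_algebra A"
  by (simp add: type_algebra_def)

lemma algebra_hom_mem:
  fixes A :: "('f::Fields.field, 'a, 'm) module_scheme" and B :: "('f, 'b, 'n) module_scheme"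
  assumes h: "h \<in> algebra_hom \<F> A B"
  shows "u \<in> carrier A \<Longrightarrow> h u \<in> carrier B"
    and "u \<in> carrier A \<Longrightarrow> v \<in> carrier A \<Longrightarrow> h (u \<otimes>\<^bsub>A\<^esub> v) = h u \<otimes>\<^bsub>B\<^esub> h v"
    and "u \<in> carrier A \<Longrightarrow> v \<in> carrier A \<Longrightarrow> h (u \<oplus>\<^bsub>A\<^esub> v) = h u \<oplus>\<^bsub>B\<^esub> h v"
    and "u \<in> carrier A \<Longrightarrow> h (c \<odot>\<^bsub>A\<^esub> u) = c \<odot>\<^bsub>B\<^esub> h u"
    and "h \<one>\<^bsub>A\<^esub> = \<one>\<^bsub>B\<^esub>"
  using h by (auto simp: algebra_hom_def ring_of_type_algebra_def ring_hom_mult ring_hom_add ring_hom_one ring_hom_closed)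

lemma algebra_hom_ev:
  fixes A :: "('f::Fields.field, 'a, 'm) module_scheme" and B :: "('f, 'b, 'n) module_scheme"
  assumes A: "type_algebra A" and B: "type_algebra B"
    and h: "h \<in> algebra_hom \<F> A B" and w: "w \<in> carrier A"
  shows "h (type_algebra.ev A w P) = type_algebra.ev B (h w) P"
proof -
  interpret A: type_algebra A by fact
  interpret B: type_algebra B by fact
  note hh = algebra_hom_mem[OF h]
  show ?thesis
  proof (induction P)
    case 0
    have "h \<zero>\<^bsub>A\<^esub> = 0 \<odot>\<^bsub>B\<^esub> h \<zero>\<^bsub>A\<^esub>" using hh(4)[of "\<zero>\<^bsub>A\<^esub>" 0] by simp
    then show ?case using hh(1)[of "\<zero>\<^bsub>A\<^esub>"] by simp
  next
    case (pCons c P)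
    then show ?case using hh w by (simp add: A.ev_pCons B.ev_pCons)
  qed
qed

subsection \<open>Algebras generated by one element\<close>

text \<open>The algebra \<open>L\<close> is the quotient of the polynomial ring by \<open>f\<close>, with \<open>\<theta>\<close> the class of
  the variable.\<close>

definition presented_by :: "('f::Fields.field, 'l, 'm) module_scheme \<Rightarrow> 'l \<Rightarrow> 'f poly \<Rightarrow> bool" where
  "presented_by L \<theta> f \<longleftrightarrow> type_algebra L \<and> \<theta> \<in> carrier L \<and>
     (\<forall>u\<in>carrier L. \<exists>P. u = type_algebra.ev L \<theta> P) \<and>
     (\<forall>P. type_algebra.ev L \<theta> P = \<zero>\<^bsub>L\<^esub> \<longleftrightarrow> f dvd P)"

lemma presented_ev_eq_iff:
  assumes "presented_by L \<theta> f"
  shows "type_algebra.ev L \<theta> P = type_algebra.ev L \<theta> Q \<longleftrightarrow> f dvd P - Q"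
proof -
  interpret L: type_algebra L using assms by (simp add: presented_by_def)
  have \<theta>: "\<theta> \<in> carrier L" using assms by (simp add: presented_by_def)
  have "L.ev \<theta> P = L.ev \<theta> Q \<longleftrightarrow> L.ev \<theta> (P - Q) = \<zero>\<^bsub>L\<^esub>"
    using \<theta> by (simp add: L.ev_diff)
  then show ?thesis using assms by (simp add: presented_by_def)
qed

text \<open>The universal property of a quotient of the polynomial ring.\<close>

lemma presented_hom:
  fixes L :: "('f::Fields.field, 'l, 'm) module_scheme" and A :: "('f, 'a, 'n) module_scheme"
  assumes L: "presented_by L \<theta> f" and A: "type_algebra A"
    and w: "w \<in> carrier A" and fw: "type_algebra.ev A w f = \<zero>\<^bsub>A\<^esub>"
  obtains h where "h \<in> algebra_hom \<F> L A"
    and "\<And>P. h (type_algebra.ev L \<theta> P) = type_algebra.ev A w P"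
proof -
  interpret L: type_algebra L using L by (simp add: presented_by_def)
  interpret A: type_algebra A by fact
  have \<theta>: "\<theta> \<in> carrier L" and gen: "\<And>u. u \<in> carrier L \<Longrightarrow> \<exists>P. u = L.ev \<theta> P"
    using L by (auto simp: presented_by_def)
  define h where "h u = A.ev w (SOME P. u = L.ev \<theta> P)" for u
  have h: "h (L.ev \<theta> P) = A.ev w P" for P
  proof -
    define Q where "Q = (SOME Q. L.ev \<theta> P = L.ev \<theta> Q)"
    have "L.ev \<theta> P = L.ev \<theta> Q" unfolding Q_def by (rule someI) (rule refl)
    then obtain R where "P - Q = f * R" using presented_ev_eq_iff[OF L] by (auto simp: dvd_def)
    then have "A.ev w P \<ominus>\<^bsub>A\<^esub> A.ev w Q = \<zero>\<^bsub>A\<^esub>"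
      using w fw by (simp flip: A.ev_diff) (simp add: A.ev_mult)
    then show ?thesis using w by (simp add: h_def Q_def)
  qed
  have one: "\<one>\<^bsub>L\<^esub> = L.ev \<theta> 1" using \<theta> by (simp add: L.ev_one)
  have "h \<in> algebra_hom \<F> L A"
    unfolding algebra_hom_def
  proof (intro CollectI conjI ballI ring_hom_memI)
    fix u v assume "u \<in> carrier L" "v \<in> carrier L"
    then obtain P Q where PQ: "u = L.ev \<theta> P" "v = L.ev \<theta> Q" using gen by blast
    show "h u \<in> carrier A" unfolding PQ h using w by simp
    show "h (u \<otimes>\<^bsub>L\<^esub> v) = h u \<otimes>\<^bsub>A\<^esub> h v"
      unfolding PQ L.ev_mult[OF \<theta>, symmetric] h using w by (simp add: A.ev_mult)
    show "h (u \<oplus>\<^bsub>L\<^esub> v) = h u \<oplus>\<^bsub>A\<^esub> h v"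
      unfolding PQ L.ev_add[OF \<theta>, symmetric] h using w by (simp add: A.ev_add)
  next
    show "h \<one>\<^bsub>L\<^esub> = \<one>\<^bsub>A\<^esub>" unfolding one h using w by (simp add: A.ev_one)
  next
    fix c u assume "u \<in> carrier L"
    then obtain P where P: "u = L.ev \<theta> P" using gen by blast
    show "h (c \<odot>\<^bsub>L\<^esub> u) = c \<odot>\<^bsub>A\<^esub> h u"
      unfolding P L.ev_smult[OF \<theta>, symmetric] h using w by (simp add: A.ev_smult)
  qed
  then show ?thesis using that h by blast
qed

lemma algebra_hom_field_inj:
  fixes L :: "('f::Fields.field, 'l, 'm) module_scheme" and A :: "('f, 'a, 'n) module_scheme"
  assumes L: "field L" and A: "type_algebra A" and one: "\<one>\<^bsub>A\<^esub> \<noteq> \<zero>\<^bsub>A\<^esub>"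
    and h: "h \<in> algebra_hom \<F> L A"
  shows "inj_on h (carrier L)"
proof -
  interpret A: type_algebra A by fact
  interpret L: field L by fact
  have hr: "h \<in> ring_hom L A" using h by (simp add: algebra_hom_def)
  interpret ring_hom_ring L A h
    by (rule ring_hom_ringI2[OF L.ring_axioms A.ring_axioms hr])
  show ?thesis
    using non_trivial_field_hom_imp_inj[OF L] one L.one_closed hom_one
    by (metis imageI singletonD)
qed

lemma presented_embeds:
  fixes L :: "('f::Fields.field, 'l, 'm) module_scheme" and A :: "('f, 'a, 'n) module_scheme"
  assumes L: "presented_by L \<theta> f" "field L" and A: "type_algebra A" "\<one>\<^bsub>A\<^esub> \<noteq> \<zero>\<^bsub>A\<^esub>"
    and w: "w \<in> carrier A" "type_algebra.ev A w f = \<zero>\<^bsub>A\<^esub>"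
  shows "algebra_embeds \<F> L A"
  using presented_hom[OF L(1) A(1) w] algebra_hom_field_inj[OF L(2) A]
  unfolding algebra_embeds_def by metis

lemma (in type_algebra) powers_independent:
  assumes \<theta>: "\<theta> \<in> carrier A" and deg: "degree f > 0"
    and zero: "\<And>P. ev \<theta> P = \<zero> \<longleftrightarrow> f dvd P"
    and 0: "lincomb (\<lambda>k. \<theta> [^] k) (degree f) c = \<zero>"
  shows "\<forall>k<degree f. c k = 0"
proof -
  let ?n = "degree f"
  let ?P = "\<Sum>k<?n. Polynomial.monom (c k) k"
  have "f dvd ?P" using 0 ev_sum_monom[OF \<theta>] zero by metis
  moreover have "degree ?P < ?n"
    using deg by (intro degree_sum_less) (auto intro: le_less_trans[OF degree_monom_le])
  ultimately have "?P = 0" by (meson dvd_imp_degree_le not_less)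
  have "(if k < ?n then c k else 0) = 0" for k
    using arg_cong[OF \<open>?P = 0\<close>, of "\<lambda>P. poly.coeff P k"] by (simp add: coeff_sum)
  then show ?thesis by metis
qed

lemma presented_dimension:
  fixes L :: "('f::Fields.field, 'l, 'm) module_scheme"
  assumes L: "presented_by L \<theta> f" and deg: "degree f > 0"
  shows "ring.dimension L (degree f) (scalars \<F> L) (carrier L)"
proof -
  interpret L: type_algebra L using L by (simp add: presented_by_def)
  have \<theta>: "\<theta> \<in> carrier L" and gen: "\<And>u. u \<in> carrier L \<Longrightarrow> \<exists>P. u = L.ev \<theta> P"
    and zero: "\<And>P. L.ev \<theta> P = \<zero>\<^bsub>L\<^esub> \<longleftrightarrow> f dvd P"
    using L by (auto simp: presented_by_def)
  let ?n = "degree f"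
  show ?thesis
  proof (rule L.dimensionI_lincomb[of "\<lambda>k. \<theta> [^]\<^bsub>L\<^esub> k"])
    fix c assume 0: "L.lincomb (\<lambda>k. \<theta> [^]\<^bsub>L\<^esub> k) ?n c = \<zero>\<^bsub>L\<^esub>"
    show "\<forall>k<?n. c k = 0" by (rule L.powers_independent[OF \<theta> deg zero 0])
  next
    fix v assume "v \<in> carrier L"
    then obtain P where P: "v = L.ev \<theta> P" using gen by blast
    have "L.ev \<theta> P = L.ev \<theta> (P mod f)"
      unfolding presented_ev_eq_iff[OF L] by (simp add: minus_mod_eq_mult_div)
    moreover have "degree (P mod f) < ?n"
      using deg degree_mod_less[of f P] by (metis degree_0 not_less0)
    ultimately show "\<exists>c. v = L.lincomb (\<lambda>k. \<theta> [^]\<^bsub>L\<^esub> k) ?n c"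
      using L.ev_eq_lincomb[OF \<theta>] P by metis
  qed (use \<theta> in auto)
qed

section \<open>The free algebra and the symbol algebra\<close>

lemma ring_of_type_algebra_simps [simp]:
  "carrier \<F> = UNIV"
  "x \<otimes>\<^bsub>\<F>\<^esub> y = x * y" "x \<oplus>\<^bsub>\<F>\<^esub> y = x + y"
  "\<one>\<^bsub>\<F>\<^esub> = 1" "\<zero>\<^bsub>\<F>\<^esub> = 0"
  by (simp_all add: ring_of_type_algebra_def)

lemma finsum_ring_of_type_algebra:
  fixes h :: "'i \<Rightarrow> 'f::Fields.field"
  assumes "finite I"
  shows "finsum \<F> h I = sum h I"
proof -
  interpret cring "\<F> :: 'f ring" by (rule cring_from_type_algebra)
  show ?thesis using assms by (induction I rule: finite_induct) (simp_all add: Pi_def)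
qed

lemma assoc_algebra_algebra_of:
  fixes R :: "('r, 'm) ring_scheme" and \<iota> :: "'f::Fields.field \<Rightarrow> 'r"
  assumes R: "ring R" and \<iota>: "\<iota> \<in> ring_hom \<F> R"
    and central: "\<And>c u. u \<in> carrier R \<Longrightarrow> \<iota> c \<otimes>\<^bsub>R\<^esub> u = u \<otimes>\<^bsub>R\<^esub> \<iota> c"
  shows "type_algebra (algebra_of R \<iota>)"
proof -
  interpret R: ring R by fact
  have \<iota>_closed [simp]: "\<iota> c \<in> carrier R" for c using ring_hom_closed[OF \<iota>] by simp
  have \<iota>_mult: "\<iota> (c * d) = \<iota> c \<otimes>\<^bsub>R\<^esub> \<iota> d" for c d using ring_hom_mult[OF \<iota>, of c d] by simp
  have \<iota>_add: "\<iota> (c + d) = \<iota> c \<oplus>\<^bsub>R\<^esub> \<iota> d" for c d using ring_hom_add[OF \<iota>, of c d] by simp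
  have \<iota>_one: "\<iota> 1 = \<one>\<^bsub>R\<^esub>" using ring_hom_one[OF \<iota>] by simp
  have ab: "abelian_group (algebra_of R \<iota>)"
  proof (rule abelian_groupI)
    fix u v w
    assume "u \<in> carrier (algebra_of R \<iota>)" "v \<in> carrier (algebra_of R \<iota>)" "w \<in> carrier (algebra_of R \<iota>)"
    then show "u \<oplus>\<^bsub>algebra_of R \<iota>\<^esub> v \<oplus>\<^bsub>algebra_of R \<iota>\<^esub> w = u \<oplus>\<^bsub>algebra_of R \<iota>\<^esub> (v \<oplus>\<^bsub>algebra_of R \<iota>\<^esub> w)"
      by (simp add: algebra_of_def R.a_assoc)
  qed (auto simp: algebra_of_def R.a_comm intro: R.l_neg bexI[of _ "\<ominus>\<^bsub>R\<^esub> _"])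
  have mon: "Group.monoid (algebra_of R \<iota>)"
    by (rule monoidI) (auto simp: algebra_of_def R.m_assoc)
  have "ring (algebra_of R \<iota>)"
    by (rule ringI[OF ab mon]) (auto simp: algebra_of_def R.l_distr R.r_distr)
  moreover have "module \<F> (algebra_of R \<iota>)"
    by (rule moduleI[OF cring_from_type_algebra ab])
      (auto simp: algebra_of_def R.l_distr R.r_distr R.m_assoc \<iota>_mult \<iota>_add \<iota>_one)
  moreover have "assoc_algebra_axioms \<F> (algebra_of R \<iota>)"
  proof
    fix c u v assume "u \<in> carrier (algebra_of R \<iota>)" "v \<in> carrier (algebra_of R \<iota>)"
    then have uv: "u \<in> carrier R" "v \<in> carrier R" by (simp_all add: algebra_of_def)
    have "u \<otimes>\<^bsub>R\<^esub> (\<iota> c \<otimes>\<^bsub>R\<^esub> v) = \<iota> c \<otimes>\<^bsub>R\<^esub> (u \<otimes>\<^bsub>R\<^esub> v)"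
      using uv central[of u c] by (metis R.m_assoc \<iota>_closed)
    then show "u \<otimes>\<^bsub>algebra_of R \<iota>\<^esub> (c \<odot>\<^bsub>algebra_of R \<iota>\<^esub> v) = c \<odot>\<^bsub>algebra_of R \<iota>\<^esub> (u \<otimes>\<^bsub>algebra_of R \<iota>\<^esub> v)"
      by (simp add: algebra_of_def)
  qed (simp add: algebra_of_def R.m_assoc)
  ultimately show ?thesis by (intro type_algebraI assoc_algebra.intro)
qed

abbreviation free_alg :: "(symbol_gen list \<Rightarrow> 'f::Fields.field) ring" where
  "free_alg \<equiv> free_algebra \<F>"

abbreviation free_mult (infixl \<open>\<star>\<close> 70) where
  "f \<star> g \<equiv> f \<otimes>\<^bsub>free_alg\<^esub> g"

lemma free_alg_carrier: "f \<in> carrier free_alg \<longleftrightarrow> finite {w. f w \<noteq> (0::'f::Fields.field)}"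
  by (simp add: free_algebra_def)

lemma free_alg_mult:
  fixes f g :: "symbol_gen list \<Rightarrow> 'f::Fields.field"
  shows "(f \<star> g) w = (\<Sum>i\<le>length w. f (take i w) * g (drop i w))"
  by (simp add: free_algebra_def finsum_ring_of_type_algebra)

lemma free_alg_add: "(f \<oplus>\<^bsub>free_alg\<^esub> g) = (\<lambda>w. f w + g w :: 'f::Fields.field)"
  by (simp add: free_algebra_def)

lemma free_alg_zero: "\<zero>\<^bsub>free_alg\<^esub> = (\<lambda>w. 0 :: 'f::Fields.field)"
  by (simp add: free_algebra_def)

lemma free_alg_one: "\<one>\<^bsub>free_alg\<^esub> = (\<lambda>w. if w = [] then 1 else 0 :: 'f::Fields.field)"
  by (auto simp: free_algebra_def fun_eq_iff)

lemma free_alg_mult_closed: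
  fixes f g :: "symbol_gen list \<Rightarrow> 'f::Fields.field"
  assumes "f \<in> carrier free_alg" "g \<in> carrier free_alg"
  shows "f \<star> g \<in> carrier free_alg"
proof -
  have "{w. (f \<star> g) w \<noteq> 0} \<subseteq> (\<lambda>(u, v). u @ v) ` ({w. f w \<noteq> 0} \<times> {w. g w \<noteq> 0})"
  proof
    fix w assume "w \<in> {w. (f \<star> g) w \<noteq> 0}"
    then have "(\<Sum>i\<le>length w. f (take i w) * g (drop i w)) \<noteq> 0" by (simp add: free_alg_mult)
    then obtain i where "i \<in> {..length w}" "f (take i w) * g (drop i w) \<noteq> 0"
      by (rule sum.not_neutral_contains_not_neutral)
    then show "w \<in> (\<lambda>(u, v). u @ v) ` ({w. f w \<noteq> 0} \<times> {w. g w \<noteq> 0})"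
      by (intro image_eqI[of _ _ "(take i w, drop i w)"]) auto
  qed
  then show ?thesis using assms unfolding free_alg_carrier by (meson finite_SigmaI finite_imageI finite_subset)
qed

lemma free_alg_mult_assoc:
  fixes f g h :: "symbol_gen list \<Rightarrow> 'f::Fields.field"
  shows "(f \<star> g) \<star> h = f \<star> (g \<star> h)"
proof
  fix w :: "symbol_gen list"
  let ?n = "length w"
  have "((f \<star> g) \<star> h) w
      = (\<Sum>i\<le>?n. \<Sum>j\<le>i. f (take j w) * g (drop j (take i w)) * h (drop i w))"
    unfolding free_alg_mult by (intro sum.cong) (auto simp: sum_distrib_right min_def)
  also have "\<dots> = (\<Sum>(i, j)\<in>(SIGMA i:{..?n}. {..i}). f (take j w) * g (drop j (take i w)) * h (drop i w))"
    by (simp add: sum.Sigma)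
  also have "\<dots> = (\<Sum>(j, k)\<in>(SIGMA j:{..?n}. {..?n - j}). f (take j w) * (g (take k (drop j w)) * h (drop k (drop j w))))"
    by (rule sum.reindex_bij_witness[of _ "\<lambda>(j, k). (j + k, j)" "\<lambda>(i, j). (j, i - j)"])
      (auto simp: drop_take mult.assoc add.commute)
  also have "\<dots> = (\<Sum>j\<le>?n. \<Sum>k\<le>?n - j. f (take j w) * (g (take k (drop j w)) * h (drop k (drop j w))))"
    by (simp add: sum.Sigma)
  also have "\<dots> = (f \<star> (g \<star> h)) w"
    unfolding free_alg_mult by (simp add: sum_distrib_left)
  finally show "((f \<star> g) \<star> h) w = (f \<star> (g \<star> h)) w" .
qed

lemma free_const_closed: "free_const \<F> (c::'f::Fields.field) \<in> carrier free_alg"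
  by (auto simp: free_alg_carrier free_const_def intro: finite_subset[of _ "{[]}"])

lemma free_const_mult_left:
  fixes c :: "'f::Fields.field"
  shows "free_const \<F> c \<star> g = (\<lambda>w. c * g w)"
proof
  fix w :: "symbol_gen list"
  have "(free_const \<F> c \<star> g) w = (\<Sum>i\<le>length w. if i = 0 then c * g w else 0)"
    unfolding free_alg_mult by (intro sum.cong) (auto simp: free_const_def)
  then show "(free_const \<F> c \<star> g) w = c * g w" by (simp add: sum.delta)
qed

lemma free_const_mult_right:
  fixes c :: "'f::Fields.field"
  shows "g \<star> free_const \<F> c = (\<lambda>w. c * g w)"
proof
  fix w :: "symbol_gen list"
  have "(g \<star> free_const \<F> c) w = (\<Sum>i\<le>length w. if i = length w then c * g w else 0)"
    unfolding free_alg_mult by (intro sum.cong) (auto simp: free_const_def)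
  then show "(g \<star> free_const \<F> c) w = c * g w" by (simp add: sum.delta)
qed

lemma free_const_one: "free_const \<F> (1::'f::Fields.field) = \<one>\<^bsub>free_alg\<^esub>"
  by (auto simp: free_const_def free_alg_one fun_eq_iff)

lemma free_alg_add_closed:
  fixes f g :: "symbol_gen list \<Rightarrow> 'f::Fields.field"
  assumes "f \<in> carrier free_alg" "g \<in> carrier free_alg"
  shows "f \<oplus>\<^bsub>free_alg\<^esub> g \<in> carrier free_alg"
proof -
  have "{w. f w + g w \<noteq> 0} \<subseteq> {w. f w \<noteq> 0} \<union> {w. g w \<noteq> 0}" by auto
  then show ?thesis using assms unfolding free_alg_carrier free_alg_add by (meson finite_UnI finite_subset)
qed

lemma ring_free_alg: "ring (free_alg :: (symbol_gen list \<Rightarrow> 'f::Fields.field) ring)"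
proof (rule ringI)
  show "abelian_group (free_alg :: (symbol_gen list \<Rightarrow> 'f) ring)"
  proof (rule abelian_groupI)
    fix f :: "symbol_gen list \<Rightarrow> 'f" assume "f \<in> carrier free_alg"
    then show "\<exists>g\<in>carrier free_alg. g \<oplus>\<^bsub>free_alg\<^esub> f = \<zero>\<^bsub>free_alg\<^esub>"
      by (intro bexI[of _ "\<lambda>w. - f w"]) (auto simp: free_alg_add free_alg_zero free_alg_carrier)
  qed ((rule free_alg_add_closed; assumption) | auto simp: free_alg_zero free_alg_add free_alg_carrier algebra_simps)+
  show "Group.monoid (free_alg :: (symbol_gen list \<Rightarrow> 'f) ring)"
    by (rule monoidI)
      (simp_all add: free_alg_mult_closed free_alg_mult_assoc free_const_closed free_const_mult_left
        free_const_mult_right flip: free_const_one)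
qed (auto simp: fun_eq_iff free_alg_mult free_alg_add algebra_simps sum.distrib)

lemma free_gen_closed: "free_gen \<F> s \<in> carrier (free_alg :: (_ \<Rightarrow> 'f::Fields.field) ring)"
  by (auto simp: free_alg_carrier free_gen_def intro: finite_subset[of _ "{[s]}"])

lemma free_gen_mult:
  fixes g :: "symbol_gen list \<Rightarrow> 'f::Fields.field"
  shows "(free_gen \<F> s \<star> g) w =
    (case w of [] \<Rightarrow> 0 | s' # w' \<Rightarrow> if s' = s then g w' else 0)"
proof (cases w)
  case (Cons s' w')
  have "(free_gen \<F> s \<star> g) w
      = (\<Sum>i\<le>length w. if i = 1 then (if s' = s then g w' else 0) else 0)"
    unfolding free_alg_mult
  proof (intro sum.cong refl)
    fix i assume "i \<in> {..length w}"
    then show "free_gen \<F> s (take i w) * g (drop i w) =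
        (if i = 1 then (if s' = s then g w' else 0) else 0)"
      using Cons by (cases i; cases "i - 1"; cases w') (auto simp: free_gen_def)
  qed
  then show ?thesis using Cons by (cases w') (auto simp: sum.delta Suc_le_eq)
qed (simp add: free_alg_mult free_gen_def)

text \<open>The free algebra is generated by the scalars and the two variables, already under addition
  and multiplication by a variable from the left.\<close>

lemma free_alg_induct [consumes 1, case_names add const gen]:
  fixes f :: "symbol_gen list \<Rightarrow> 'f::Fields.field"
  assumes f: "f \<in> carrier free_alg"
    and add: "\<And>f g. f \<in> carrier free_alg \<Longrightarrow> g \<in> carrier free_alg \<Longrightarrow> P f \<Longrightarrow> P g \<Longrightarrow> P (f \<oplus>\<^bsub>free_alg\<^esub> g)"
    and const: "\<And>c. P (free_const \<F> c)"
    and gen: "\<And>s f. f \<in> carrier free_alg \<Longrightarrow> P f \<Longrightarrow> P (free_gen \<F> s \<star> f)"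
  shows "P f"
proof -
  let ?word = "\<lambda>w c w'. if w' = w then c else (0::'f)"
  have word_closed: "?word w c \<in> carrier free_alg" for w c
    by (auto simp: free_alg_carrier intro: finite_subset[of _ "{w}"])
  have word: "P (?word w c)" for w c
  proof (induction w)
    case Nil
    then show ?case using const[of c] by (simp add: free_const_def cong: if_cong)
  next
    case (Cons s w)
    have "?word (s # w) c = free_gen \<F> s \<star> ?word w c"
      by (auto simp: fun_eq_iff free_gen_mult split: list.split)
    then show ?case using gen[OF word_closed Cons, of s] by metis
  qed
  have "finite W \<Longrightarrow> {w. f w \<noteq> 0} = W \<Longrightarrow> P f" for W f
  proof (induction W arbitrary: f rule: finite_induct)
    case empty
    then have "f = free_const \<F> 0" by (auto simp: free_const_def)
    then show ?case using const by simp
  next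
    case (insert w W)
    let ?g = "f(w := 0)"
    have g: "{w. ?g w \<noteq> 0} = W" using insert by auto
    have "f = ?word w (f w) \<oplus>\<^bsub>free_alg\<^esub> ?g" by (auto simp: free_alg_add)
    moreover have "P (?word w (f w) \<oplus>\<^bsub>free_alg\<^esub> ?g)"
    proof (rule add[OF word_closed _ word insert.IH[OF g]])
      show "?g \<in> carrier free_alg" unfolding free_alg_carrier g by (rule insert.hyps(1))
    qed
    ultimately show ?case by metis
  qed
  then show ?thesis using f by (simp add: free_alg_carrier)
qed

subsection \<open>Generators and relations\<close>

text \<open>The properties of the symbol algebra that follow from its presentation. The assumption
  \<open>generated\<close> says that the algebra is spanned by the words in \<open>x\<close> and \<open>y\<close>; it asks for closure under
  multiplication from the left only, because every word arises in this way.\<close>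

locale symbol_gens = type_algebra A
  for A :: "('f::Fields.field, 'a, 'm) module_scheme" (structure) +
  fixes p :: nat and a b :: 'f and x y :: 'a
  assumes prime_p: "Factorial_Ring.prime p" and char_p: "CHAR('f) = p" and b: "b \<noteq> 0"
    and x [simp, intro]: "x \<in> carrier A" and y [simp, intro]: "y \<in> carrier A"
    and x_power: "x [^] p = x \<oplus> a \<odot> \<one>"
    and y_power: "y [^] p = b \<odot> \<one>"
    and yx: "y \<otimes> x = (x \<oplus> \<one>) \<otimes> y"
    and generated: "\<And>V. \<one> \<in> V \<Longrightarrow> (\<And>u v. u \<in> carrier A \<Longrightarrow> v \<in> carrier A \<Longrightarrow> u \<in> V \<Longrightarrow> v \<in> V \<Longrightarrow> u \<oplus> v \<in> V) \<Longrightarrow>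
      (\<And>c. c \<odot> \<one> \<in> V) \<Longrightarrow> (\<And>u. u \<in> carrier A \<Longrightarrow> u \<in> V \<Longrightarrow> x \<otimes> u \<in> V) \<Longrightarrow>
      (\<And>u. u \<in> carrier A \<Longrightarrow> u \<in> V \<Longrightarrow> y \<otimes> u \<in> V) \<Longrightarrow> carrier A \<subseteq> V"

context
  fixes p :: nat and a b :: "'f::Fields.field"
begin

definition symbol_proj :: "(symbol_gen list \<Rightarrow> 'f) \<Rightarrow> (symbol_gen list \<Rightarrow> 'f) set" where
  "symbol_proj f = symbol_ideal p \<F> a b +>\<^bsub>free_alg\<^esub> f"

abbreviation "symb \<equiv> symbol_algebra p \<F> a b"
abbreviation "symb_x \<equiv> symbol_proj (free_gen \<F> Gen_x)"
abbreviation "symb_y \<equiv> symbol_proj (free_gen \<F> Gen_y)"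

lemma symbol_relations_closed: "symbol_relations p \<F> a b \<subseteq> carrier free_alg"
proof -
  interpret FA: ring "free_alg :: (_ \<Rightarrow> 'f) ring" by (rule ring_free_alg)
  show ?thesis
    by (auto simp: symbol_relations_def Let_def free_gen_closed free_const_closed
        intro!: FA.minus_closed FA.nat_pow_closed FA.m_closed FA.a_closed)
qed

lemma ideal_symbol_ideal: "ideal (symbol_ideal p \<F> a b) free_alg"
  unfolding symbol_ideal_def
  by (rule ring.genideal_ideal[OF ring_free_alg symbol_relations_closed])

lemma symbol_proj_ring_hom: "symbol_proj \<in> ring_hom free_alg symb"
  using ideal.rcos_ring_hom[OF ideal_symbol_ideal]
  by (simp add: symbol_proj_def[abs_def] symbol_algebra_def algebra_of_def ring_hom_def)

lemma type_algebra_symb: "type_algebra symb"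
  unfolding symbol_algebra_def
proof (rule assoc_algebra_algebra_of)
  interpret FA: ring "free_alg :: (_ \<Rightarrow> 'f) ring" by (rule ring_free_alg)
  let ?I = "symbol_ideal p \<F> a b" and ?k = "free_const \<F>"
  note hom = ideal.rcos_ring_hom[OF ideal_symbol_ideal]
  show "ring (free_alg Quot ?I)" by (rule ideal.quotient_is_ring[OF ideal_symbol_ideal])
  have k: "?k \<in> ring_hom \<F> (free_alg :: (_ \<Rightarrow> 'f) ring)"
    by (auto simp: ring_hom_def free_const_closed free_const_mult_left free_const_one free_alg_add)
      (auto simp: free_const_def)
  show "(\<lambda>c. ?I +>\<^bsub>free_alg\<^esub> ?k c) \<in> ring_hom \<F> (free_alg Quot ?I)"
    using ring_hom_trans[OF k hom] by (simp add: comp_def)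
  fix c u assume "u \<in> carrier (free_alg Quot ?I)"
  then obtain f where f: "f \<in> carrier free_alg" "u = ?I +>\<^bsub>free_alg\<^esub> f"
    by (auto simp: FactRing_def A_RCOSETS_def')
  show "(?I +>\<^bsub>free_alg\<^esub> ?k c) \<otimes>\<^bsub>free_alg Quot ?I\<^esub> u = u \<otimes>\<^bsub>free_alg Quot ?I\<^esub> (?I +>\<^bsub>free_alg\<^esub> ?k c)"
    unfolding f ring_hom_mult[OF hom free_const_closed f(1), symmetric] ring_hom_mult[OF hom f(1) free_const_closed, symmetric]
    by (simp add: free_const_mult_left free_const_mult_right)
qed

lemma symbol_proj_surj:
  assumes "u \<in> carrier symb"
  obtains f where "f \<in> carrier free_alg" "u = symbol_proj f"
  using assms by (auto simp: symbol_algebra_def algebra_of_def symbol_proj_def FactRing_def A_RCOSETS_def')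

lemma symbol_proj_smult:
  "f \<in> carrier free_alg \<Longrightarrow> c \<odot>\<^bsub>symb\<^esub> symbol_proj f = symbol_proj (free_const \<F> c \<star> f)"
  using ring_hom_mult[OF symbol_proj_ring_hom free_const_closed, of f c]
  by (simp add: symbol_algebra_def algebra_of_def symbol_proj_def)

lemma symbol_proj_eq_zero_iff:
  assumes "f \<in> carrier free_alg"
  shows "symbol_proj f = \<zero>\<^bsub>symb\<^esub> \<longleftrightarrow> f \<in> symbol_ideal p \<F> a b"
proof -
  interpret I: ideal "symbol_ideal p \<F> a b" free_alg by (rule ideal_symbol_ideal)
  show ?thesis
    using assms I.a_rcos_const I.a_rcos_self
    by (auto simp: symbol_algebra_def algebra_of_def symbol_proj_def FactRing_def)
qed

lemma symbol_gens_symb: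
  assumes prime_p: "Factorial_Ring.prime p" and char_p: "CHAR('f) = p" and b: "b \<noteq> 0"
  shows "symbol_gens symb p a b symb_x symb_y"
proof -
  interpret FA: ring "free_alg :: (_ \<Rightarrow> 'f) ring" by (rule ring_free_alg)
  interpret A: type_algebra symb by (rule type_algebra_symb)
  interpret hom: ring_hom_ring free_alg symb symbol_proj
    by (rule ring_hom_ringI2[OF ring_free_alg A.ring_axioms symbol_proj_ring_hom])
  note [simp] = free_gen_closed free_const_closed
  have proj_const: "symbol_proj (free_const \<F> c) = c \<odot>\<^bsub>symb\<^esub> \<one>\<^bsub>symb\<^esub>" for c
    using symbol_proj_smult[of "\<one>\<^bsub>free_alg\<^esub>" c] by simp
  have rel: "symbol_proj r = \<zero>\<^bsub>symb\<^esub>" if "r \<in> symbol_relations p \<F> a b" for r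
    using that symbol_relations_closed symbol_proj_eq_zero_iff FA.genideal_self
    unfolding symbol_ideal_def by blast
  have minus: "symbol_proj (f \<ominus>\<^bsub>free_alg\<^esub> g) = symbol_proj f \<ominus>\<^bsub>symb\<^esub> symbol_proj g"
    if "f \<in> carrier free_alg" "g \<in> carrier free_alg" for f g
    using that by (simp add: FA.minus_eq A.minus_eq)
  have pow: "symbol_proj (f [^]\<^bsub>free_alg\<^esub> n) = symbol_proj f [^]\<^bsub>symb\<^esub> n"
    if "f \<in> carrier free_alg" for f and n :: nat
    using that by (induction n) simp_all
  let ?x = "free_gen \<F> Gen_x :: _ \<Rightarrow> 'f" and ?y = "free_gen \<F> Gen_y :: _ \<Rightarrow> 'f"
  let ?k = "free_const \<F> :: 'f \<Rightarrow> _"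
  have cl: "?x [^]\<^bsub>free_alg\<^esub> p \<in> carrier free_alg" "?y [^]\<^bsub>free_alg\<^esub> p \<in> carrier free_alg"
    "?y \<star> ?x \<in> carrier free_alg" "?x \<oplus>\<^bsub>free_alg\<^esub> \<one>\<^bsub>free_alg\<^esub> \<in> carrier free_alg"
    "(?x \<oplus>\<^bsub>free_alg\<^esub> \<one>\<^bsub>free_alg\<^esub>) \<star> ?y \<in> carrier free_alg"
    "?x [^]\<^bsub>free_alg\<^esub> p \<ominus>\<^bsub>free_alg\<^esub> ?x \<in> carrier free_alg"
    by simp_all
  have X: "symb_x \<in> carrier symb" and Y: "symb_y \<in> carrier symb" by simp_all
  have "symb_x [^]\<^bsub>symb\<^esub> p \<ominus>\<^bsub>symb\<^esub> symb_x \<ominus>\<^bsub>symb\<^esub> a \<odot>\<^bsub>symb\<^esub> \<one>\<^bsub>symb\<^esub>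
      = symbol_proj (?x [^]\<^bsub>free_alg\<^esub> p \<ominus>\<^bsub>free_alg\<^esub> ?x \<ominus>\<^bsub>free_alg\<^esub> ?k a)"
    by (simp only: minus[OF cl(6) free_const_closed] minus[OF cl(1) free_gen_closed] pow[OF free_gen_closed] proj_const)
  also have "\<dots> = \<zero>\<^bsub>symb\<^esub>" by (rule rel) (simp add: symbol_relations_def Let_def)
  finally have rx: "symb_x [^]\<^bsub>symb\<^esub> p \<ominus>\<^bsub>symb\<^esub> symb_x = a \<odot>\<^bsub>symb\<^esub> \<one>\<^bsub>symb\<^esub>"
    using X by (subst (asm) A.r_right_minus_eq) auto
  have "symb_y [^]\<^bsub>symb\<^esub> p \<ominus>\<^bsub>symb\<^esub> b \<odot>\<^bsub>symb\<^esub> \<one>\<^bsub>symb\<^esub>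
      = symbol_proj (?y [^]\<^bsub>free_alg\<^esub> p \<ominus>\<^bsub>free_alg\<^esub> ?k b)"
    by (simp only: minus[OF cl(2) free_const_closed] pow[OF free_gen_closed] proj_const)
  also have "\<dots> = \<zero>\<^bsub>symb\<^esub>" by (rule rel) (simp add: symbol_relations_def Let_def)
  finally have ry: "symb_y [^]\<^bsub>symb\<^esub> p = b \<odot>\<^bsub>symb\<^esub> \<one>\<^bsub>symb\<^esub>"
    using Y by (subst (asm) A.r_right_minus_eq) auto
  have "symb_y \<otimes>\<^bsub>symb\<^esub> symb_x \<ominus>\<^bsub>symb\<^esub> (symb_x \<oplus>\<^bsub>symb\<^esub> \<one>\<^bsub>symb\<^esub>) \<otimes>\<^bsub>symb\<^esub> symb_y
      = symbol_proj (?y \<star> ?x \<ominus>\<^bsub>free_alg\<^esub> (?x \<oplus>\<^bsub>free_alg\<^esub> \<one>\<^bsub>free_alg\<^esub>) \<star> ?y)"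
    by (simp only: minus[OF cl(3,5)] hom.hom_mult[OF cl(4) free_gen_closed] hom.hom_mult[OF free_gen_closed free_gen_closed]
        hom.hom_add[OF free_gen_closed FA.one_closed] hom.hom_one)
  also have "\<dots> = \<zero>\<^bsub>symb\<^esub>" by (rule rel) (simp add: symbol_relations_def Let_def)
  finally have ryx: "symb_y \<otimes>\<^bsub>symb\<^esub> symb_x = (symb_x \<oplus>\<^bsub>symb\<^esub> \<one>\<^bsub>symb\<^esub>) \<otimes>\<^bsub>symb\<^esub> symb_y"
    using X Y by (subst (asm) A.r_right_minus_eq) auto
  have "symb_x [^]\<^bsub>symb\<^esub> p \<ominus>\<^bsub>symb\<^esub> symb_x \<oplus>\<^bsub>symb\<^esub> symb_x = symb_x [^]\<^bsub>symb\<^esub> p"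
    using X by (simp add: A.minus_eq A.a_assoc A.l_neg)
  then have rx': "symb_x [^]\<^bsub>symb\<^esub> p = symb_x \<oplus>\<^bsub>symb\<^esub> a \<odot>\<^bsub>symb\<^esub> \<one>\<^bsub>symb\<^esub>"
    unfolding rx using A.a_comm[of "a \<odot>\<^bsub>symb\<^esub> \<one>\<^bsub>symb\<^esub>" symb_x] X by simp
  show ?thesis
  proof (unfold_locales)
    show "symb_x [^]\<^bsub>symb\<^esub> p = symb_x \<oplus>\<^bsub>symb\<^esub> a \<odot>\<^bsub>symb\<^esub> \<one>\<^bsub>symb\<^esub>" by (rule rx')
    show "symb_y [^]\<^bsub>symb\<^esub> p = b \<odot>\<^bsub>symb\<^esub> \<one>\<^bsub>symb\<^esub>" by (rule ry)
    show "symb_y \<otimes>\<^bsub>symb\<^esub> symb_x = (symb_x \<oplus>\<^bsub>symb\<^esub> \<one>\<^bsub>symb\<^esub>) \<otimes>\<^bsub>symb\<^esub> symb_y" by (rule ryx)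
  next
    fix V
    assume 1: "\<one>\<^bsub>symb\<^esub> \<in> V"
      and aV: "\<And>u v. u \<in> carrier symb \<Longrightarrow> v \<in> carrier symb \<Longrightarrow> u \<in> V \<Longrightarrow> v \<in> V \<Longrightarrow> u \<oplus>\<^bsub>symb\<^esub> v \<in> V"
      and c: "\<And>c. c \<odot>\<^bsub>symb\<^esub> \<one>\<^bsub>symb\<^esub> \<in> V"
      and xV: "\<And>u. u \<in> carrier symb \<Longrightarrow> u \<in> V \<Longrightarrow> symb_x \<otimes>\<^bsub>symb\<^esub> u \<in> V"
      and yV: "\<And>u. u \<in> carrier symb \<Longrightarrow> u \<in> V \<Longrightarrow> symb_y \<otimes>\<^bsub>symb\<^esub> u \<in> V"
    have "symbol_proj f \<in> V" if "f \<in> carrier free_alg" for f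
      using that
    proof (induction f rule: free_alg_induct)
      case (add f g)
      then show ?case using aV by simp
    next
      case (const d)
      show ?case unfolding proj_const by (rule c)
    next
      case (gen s f)
      then show ?case using xV yV by (cases s) simp_all
    qed
    then show "carrier symb \<subseteq> V" using symbol_proj_surj by (metis subsetI)
  qed (use assms in simp_all)
qed

end

section \<open>Normal forms and central simplicity\<close>

context symbol_gens
begin

lemma p_gt_1: "p > 1" using prime_p prime_gt_1_nat by blast

abbreviation "shift \<equiv> ([:1, 1:] :: 'f poly)"

lemma y_ev: "y \<otimes> ev x P = ev x (P \<circ>\<^sub>p shift) \<otimes> y"
proof (induction P)
  case (pCons c P)
  have "y \<otimes> ev x (pCons c P) = c \<odot> y \<oplus> (y \<otimes> x) \<otimes> ev x P"
    by (simp add: ev_pCons r_distr mult_smult m_assoc)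
  also have "\<dots> = c \<odot> y \<oplus> (x \<oplus> \<one>) \<otimes> (y \<otimes> ev x P)"
    unfolding yx by (simp add: m_assoc)
  also have "\<dots> = (c \<odot> \<one> \<oplus> (x \<oplus> \<one>) \<otimes> ev x (P \<circ>\<^sub>p shift)) \<otimes> y"
    unfolding pCons.IH by (simp add: l_distr smult_mult m_assoc)
  also have "x \<oplus> \<one> = ev x shift" by (simp add: ev_pCons M.a_comm)
  finally show ?case
    by (simp add: pcompose_pCons ev_add ev_mult ev_const del: mult_pCons_left)
qed simp

lemma y_power_ev: "y [^] j \<otimes> ev x P = ev x (P \<circ>\<^sub>p [:of_nat j, 1:]) \<otimes> y [^] j"
proof (induction j arbitrary: P)
  case (Suc j)
  have "y [^] Suc j \<otimes> ev x P = y [^] j \<otimes> (y \<otimes> ev x P)" by (simp add: m_assoc)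
  also have "\<dots> = (y [^] j \<otimes> ev x (P \<circ>\<^sub>p shift)) \<otimes> y" by (simp add: y_ev m_assoc)
  also have "\<dots> = ev x ((P \<circ>\<^sub>p shift) \<circ>\<^sub>p [:of_nat j, 1:]) \<otimes> y [^] Suc j"
    by (simp add: Suc m_assoc)
  also have "(P \<circ>\<^sub>p shift) \<circ>\<^sub>p [:of_nat j, 1:] = P \<circ>\<^sub>p [:of_nat (Suc j), 1:]"
    by (simp add: pcompose_pCons flip: pcompose_assoc)
  finally show ?case .
qed simp

text \<open>The candidate for the normal form, as a polynomial in \<open>y\<close> with coefficients in \<open>F[x]\<close> on the left.\<close>

definition ysum :: "(nat \<Rightarrow> 'f poly) \<Rightarrow> 'a" where
  "ysum P = (\<Oplus>j\<in>{..<p}. ev x (P j) \<otimes> y [^] j)"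

lemma ysum_closed [simp, intro]: "ysum P \<in> carrier A"
  by (simp add: ysum_def)

lemma ysum_cong: "(\<And>j. j < p \<Longrightarrow> ev x (P j) = ev x (Q j)) \<Longrightarrow> ysum P = ysum Q"
  unfolding ysum_def by (intro M.finsum_cong') auto

lemma ysum_add: "ysum P \<oplus> ysum Q = ysum (\<lambda>j. P j + Q j)"
  unfolding ysum_def by (subst M.finsum_addf[symmetric]) (auto simp: ev_add l_distr)

lemma ysum_smult: "c \<odot> ysum P = ysum (\<lambda>j. Polynomial.smult c (P j))"
proof -
  have "(c \<odot> \<one>) \<otimes> ysum P = (\<Oplus>j\<in>{..<p}. (c \<odot> \<one>) \<otimes> (ev x (P j) \<otimes> y [^] j))"
    unfolding ysum_def by (rule finsum_rdistr) auto
  then show ?thesis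
    unfolding ysum_def by (simp add: smult_mult ev_smult)
qed

lemma ysum_diff: "ysum P \<ominus> ysum Q = ysum (\<lambda>j. P j - Q j)"
proof -
  have "\<ominus> ysum Q = ysum (\<lambda>j. - Q j)" using ysum_smult[of "- 1" Q] uminus_smult[of "ysum Q" 1] by simp
  then show ?thesis by (simp add: M.minus_eq ysum_add)
qed

lemma x_ysum: "x \<otimes> ysum P = ysum (\<lambda>j. [:0, 1:] * P j)"
  unfolding ysum_def
  by (subst finsum_rdistr) (auto simp: ev_pCons m_assoc)

lemma ysum_x: "ysum P \<otimes> x = ysum (\<lambda>j. P j * [:of_nat j, 1:])"
proof -
  have "ev x (P j) \<otimes> y [^] j \<otimes> x = ev x (P j * [:of_nat j, 1:]) \<otimes> y [^] j" for j
  proof -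
    have "y [^] j \<otimes> x = ev x [:of_nat j, 1:] \<otimes> y [^] j"
      using y_power_ev[of j "[:0, 1:]"] ev_X[OF x] by (simp add: pcompose_pCons)
    then show ?thesis by (simp only: ev_mult[OF x] m_assoc ev_closed[OF x] nat_pow_closed y x)
  qed
  then show ?thesis
    unfolding ysum_def by (subst finsum_ldistr) auto
qed

lemma ysum_single:
  assumes "j < p" "\<And>i. i < p \<Longrightarrow> i \<noteq> j \<Longrightarrow> P i = 0"
  shows "ysum P = ev x (P j) \<otimes> y [^] j"
proof -
  have "ysum P = (\<Oplus>i\<in>{..<p}. if j = i then ev x (P i) \<otimes> y [^] i else \<zero>)"
    unfolding ysum_def using assms by (intro M.finsum_cong') auto
  then show ?thesis using M.finsum_singleton[of j "{..<p}" "\<lambda>i. ev x (P i) \<otimes> y [^] i"] assms by simp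
qed

lemma ev_eq_ysum: "ev x P = ysum (\<lambda>j. if j = 0 then P else 0)"
  using p_gt_1 by (subst ysum_single[of 0]) auto

text \<open>Multiplication by \<open>y\<close> raises the power of \<open>y\<close> by one and shifts \<open>x\<close> to \<open>x + 1\<close>; the top component
  wraps around to the bottom one with the factor \<open>y\<^sup>p = b\<close>.\<close>

lemma y_ysum: "y \<otimes> ysum P = ysum (\<lambda>j. if j = 0 then Polynomial.smult b (P (p - 1) \<circ>\<^sub>p shift) else P (j - 1) \<circ>\<^sub>p shift)"
proof -
  obtain q where q: "p = Suc q" using p_gt_1 by (cases p) auto
  let ?t = "\<lambda>j. ev x (P j \<circ>\<^sub>p shift) \<otimes> y [^] Suc j"
  let ?Q = "\<lambda>j. if j = 0 then Polynomial.smult b (P q \<circ>\<^sub>p shift) else P (j - 1) \<circ>\<^sub>p shift"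
  have "y \<otimes> (ev x (P j) \<otimes> y [^] j) = ?t j" for j
  proof -
    have "y \<otimes> (ev x (P j) \<otimes> y [^] j) = (y \<otimes> ev x (P j)) \<otimes> y [^] j" by (simp add: m_assoc)
    also have "\<dots> = ev x (P j \<circ>\<^sub>p shift) \<otimes> (y \<otimes> y [^] j)" by (simp add: y_ev m_assoc)
    finally show ?thesis by (metis nat_pow_Suc2 y)
  qed
  then have "y \<otimes> ysum P = (\<Oplus>j\<in>{..<p}. ?t j)"
    unfolding ysum_def by (subst finsum_rdistr) auto
  also have "\<dots> = ?t q \<oplus> (\<Oplus>j\<in>{..<q}. ?t j)"
    unfolding q lessThan_Suc by (subst M.finsum_insert) auto
  also have "?t q = ev x (?Q 0) \<otimes> y [^] (0::nat)"
    using y_power by (simp add: q ev_smult mult_smult)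
  also have "(\<Oplus>j\<in>{..<q}. ?t j) = (\<Oplus>j\<in>Suc ` {..<q}. ev x (?Q j) \<otimes> y [^] j)"
    by (subst M.finsum_reindex) auto
  also have "ev x (?Q 0) \<otimes> y [^] (0::nat) \<oplus> (\<Oplus>j\<in>Suc ` {..<q}. ev x (?Q j) \<otimes> y [^] j)
      = (\<Oplus>j\<in>insert 0 (Suc ` {..<q}). ev x (?Q j) \<otimes> y [^] j)"
    by (subst M.finsum_insert) auto
  also have "insert 0 (Suc ` {..<q}) = {..<p}"
    unfolding q by (rule lessThan_Suc_eq_insert_0[symmetric])
  finally have "y \<otimes> ysum P = ysum ?Q" by (simp only: ysum_def)
  moreover have "q = p - 1" using q by simp
  ultimately show ?thesis by (simp only:)
qed

text \<open>The elements in normal form contain the scalars and are closed under addition and under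
  multiplication by \<open>x\<close> and \<open>y\<close> from the left, so they exhaust the algebra.\<close>

lemma ysum_surj:
  assumes "u \<in> carrier A"
  shows "\<exists>P. u = ysum P"
proof -
  have c: "c \<odot> \<one> = ysum (\<lambda>j. if j = 0 then [:c:] else 0)" for c
    by (simp add: ev_const flip: ev_eq_ysum)
  have "carrier A \<subseteq> range ysum"
  proof (rule generated)
    show "\<one> \<in> range ysum" using c[of 1] by auto
    show "c \<odot> \<one> \<in> range ysum" for c using c by auto
  qed (auto simp: ysum_add x_ysum y_ysum simp del: mult_pCons_left)
  then show ?thesis using assms by auto
qed

lemma ev_AS_zero: "ev x (AS_poly p a) = \<zero>"
proof -
  have "x \<oplus> a \<odot> \<one> \<ominus> x \<ominus> a \<odot> \<one> = \<zero>"
    by (simp add: M.minus_eq M.a_ac M.r_neg)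
  then show ?thesis by (simp add: ev_AS_poly x_power)
qed

lemma ev_mod: "ev x (P mod AS_poly p a) = ev x P"
proof -
  have "ev x P = ev x (P div AS_poly p a * AS_poly p a + P mod AS_poly p a)" by (simp only: div_mult_mod_eq)
  also have "\<dots> = ev x (P mod AS_poly p a)"
    by (simp only: ev_add[OF x] ev_mult[OF x] ev_AS_zero) simp
  finally show ?thesis ..
qed

lemma normal_form:
  assumes "u \<in> carrier A"
  obtains P where "u = ysum P" "\<And>j. degree (P j) < p"
proof -
  obtain P where P: "u = ysum P" using ysum_surj assms by blast
  let ?f = "AS_poly p a"
  have deg: "degree ?f = p" using degree_AS_poly p_gt_1 by blast
  then have "?f \<noteq> 0" using p_gt_1 by (metis degree_0 not_less0)
  then have "degree (Q mod ?f) < p" for Q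
    using degree_mod_less[of ?f Q] deg p_gt_1 by (metis degree_0 less_trans zero_less_one)
  moreover have "u = ysum (\<lambda>j. P j mod ?f)" unfolding P by (rule ysum_cong) (simp only: ev_mod)
  ultimately show ?thesis using that by blast
qed

lemma cancel_y_power:
  assumes "u \<in> carrier A" "u \<otimes> y [^] j = \<zero>" "j \<le> p"
  shows "u = \<zero>"
proof -
  have "y [^] j \<otimes> y [^] (p - j) = b \<odot> \<one>" using assms(3) by (simp add: nat_pow_mult y_power)
  then have "(u \<otimes> y [^] j) \<otimes> y [^] (p - j) = b \<odot> u" using assms(1) by (simp add: m_assoc mult_smult)
  then have "b \<odot> u = \<zero>" using assms by simp
  then show ?thesis using smult_cancel assms(1) b by blast
qed

text \<open>Since \<open>y\<^sup>j x = (x + j) y\<^sup>j\<close>, the normal form decomposes the algebra into the eigenspaces of the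
  commutator with \<open>x\<close>.\<close>

lemma commutator_x: "x \<otimes> ysum P \<ominus> ysum P \<otimes> x = ysum (\<lambda>j. Polynomial.smult (- of_nat j) (P j))"
proof -
  have "[:0, 1:] * P j - P j * [:of_nat j, 1:] = Polynomial.smult (- of_nat j) (P j)" for j
    by (simp add: algebra_simps)
  then show ?thesis unfolding x_ysum ysum_x ysum_diff by simp
qed

end

text \<open>Uniqueness of the normal form says that the relations have no unexpected consequences. A
  representation establishes it below; center, simplicity and dimension follow from it.\<close>

locale symbol_indep = symbol_gens A p a b x y
  for A :: "('f::Fields.field, 'a, 'm) module_scheme" (structure) and p a b x y +
  assumes indep: "\<And>P. symbol_gens.ysum A p x y P = \<zero> \<Longrightarrow> (\<And>j. degree (P j) < p) \<Longrightarrow> \<forall>j<p. P j = 0"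
begin

lemma ev_eq_zeroD: "ev x P = \<zero> \<Longrightarrow> degree P < p \<Longrightarrow> P = 0"
proof -
  assume P: "ev x P = \<zero>" "degree P < p"
  have "\<forall>j<p. (if j = 0 then P else 0) = 0"
    by (rule indep) (use P p_gt_1 in \<open>simp_all flip: ev_eq_ysum\<close>)
  then show "P = 0" using p_gt_1 by (metis less_trans zero_less_one)
qed

lemma one_not_zero: "\<one> \<noteq> \<zero>"
  using ev_eq_zeroD[of 1] p_gt_1 by (auto simp: ev_one)

text \<open>Commuting with \<open>x\<close> leaves only the component at \<open>y\<^sup>0\<close>, and a polynomial in \<open>x\<close> that commutes
  with \<open>y\<close> is invariant under \<open>x \<mapsto> x + 1\<close>, hence constant.\<close>

lemma ring_center_eq: "ring_center A = scalars \<F> A"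
proof (intro Set.set_eqI iffI)
  fix u assume "u \<in> scalars \<F> A"
  then show "u \<in> ring_center A" by (auto simp: scalars_eq ring_center_def smult_mult mult_smult)
next
  fix u assume u: "u \<in> ring_center A"
  then have uA: "u \<in> carrier A" by (simp add: ring_center_def)
  obtain P where P: "u = ysum P" "\<And>j. degree (P j) < p" using normal_form[OF uA] by blast
  have "x \<otimes> u \<ominus> u \<otimes> x = \<zero>" using u uA by (simp add: ring_center_def)
  then have "ysum (\<lambda>j. Polynomial.smult (- of_nat j) (P j)) = \<zero>" unfolding P commutator_x .
  then have "\<forall>j<p. Polynomial.smult (- of_nat j) (P j) = 0"
    by (rule indep) (use P p_gt_1 in \<open>auto intro: le_less_trans[OF degree_smult_le]\<close>)
  moreover have "(of_nat j :: 'f) \<noteq> 0" if "0 < j" "j < p" for j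
    using that char_p of_nat_eq_0_iff_char_dvd[where 'a = 'f] by (metis nat_dvd_not_less)
  ultimately have "P j = 0" if "j < p" "j \<noteq> 0" for j using that by (metis gr0I neg_equal_0_iff_equal smult_eq_0_iff)
  then have u0: "u = ev x (P 0)" unfolding P using p_gt_1 by (subst ysum_single[of 0]) auto
  have "y \<otimes> u = u \<otimes> y" using u by (simp add: ring_center_def)
  then have "ev x (P 0 \<circ>\<^sub>p shift - P 0) \<otimes> y [^] (1::nat) = \<zero>"
    unfolding u0 by (simp add: y_ev ev_diff M.minus_eq l_distr l_minus M.r_neg)
  then have "ev x (P 0 \<circ>\<^sub>p shift - P 0) = \<zero>" using cancel_y_power[of _ 1] p_gt_1 by simp
  moreover have "degree (P 0 \<circ>\<^sub>p shift - P 0) < p"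
    using P(2)[of 0] by (intro degree_diff_less) (simp_all add: degree_pcompose)
  ultimately have "P 0 \<circ>\<^sub>p shift - P 0 = 0" by (rule ev_eq_zeroD)
  then have "P 0 \<circ>\<^sub>p shift = P 0" by simp
  then obtain c where "P 0 = [:c:]" using shift_invariant_imp_constant[OF char_p P(2)[of 0]] by blast
  then show "u \<in> scalars \<F> A" by (simp add: u0 ev_const scalars_eq)
qed

text \<open>The commutator with \<open>x\<close> acts on the component \<open>ev x (P j) y\<^sup>j\<close> as multiplication by
  \<open>- j\<close>, so a component can be removed without leaving the ideal. A single remaining component is
  \<open>ev x P\<close> up to the unit \<open>y\<^sup>j\<close>. Conjugation by \<open>y\<close> replaces \<open>P(X)\<close> by \<open>P(X + 1)\<close>, and the
  difference with \<open>P\<close> has smaller degree.\<close>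

lemma one_mem_ideal_of_ev:
  assumes I: "ideal I A" and mem: "ev x P \<in> I" and nz: "P \<noteq> 0" and deg: "degree P < p"
  shows "\<one> \<in> I"
  using mem nz deg
proof (induction "degree P" arbitrary: P rule: less_induct)
  case less
  interpret I: ideal I A by (rule I)
  show ?case
  proof (cases "degree P = 0")
    case True
    then obtain c where c: "P = [:c:]" using degree_eq_zeroE by blast
    then have "c \<noteq> 0" using less.prems by auto
    have "(inverse c \<odot> \<one>) \<otimes> ev x P = \<one>" using \<open>c \<noteq> 0\<close> by (simp add: c ev_const smult_mult smult_smult)
    then show ?thesis using I.I_l_closed[OF less.prems(1), of "inverse c \<odot> \<one>"] by simp
  next
    case False
    let ?Q = "P \<circ>\<^sub>p shift - P"
    have "P \<circ>\<^sub>p shift \<noteq> P" using shift_invariant_imp_constant[OF char_p less.prems(3)] False by (metis degree_pCons_0)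
    then have Q: "?Q \<noteq> 0" by simp
    have dQ: "degree ?Q < degree P" using degree_shift_diff_less False by blast
    have "y \<otimes> ev x P \<otimes> y [^] (p - 1) \<in> I"
      by (intro I.I_r_closed I.I_l_closed less.prems(1)) auto
    moreover have "y \<otimes> ev x P \<otimes> y [^] (p - 1) = b \<odot> ev x (P \<circ>\<^sub>p shift)"
    proof -
      have "y \<otimes> y [^] (p - 1) = b \<odot> \<one>" using y_power p_gt_1 by (metis Suc_pred' nat_pow_Suc2 less_trans zero_less_one y)
      then show ?thesis by (simp add: y_ev m_assoc mult_smult)
    qed
    ultimately have "(inverse b \<odot> \<one>) \<otimes> (b \<odot> ev x (P \<circ>\<^sub>p shift)) \<in> I" using I.I_l_closed by simp
    then have "ev x (P \<circ>\<^sub>p shift) \<in> I" using b by (simp add: smult_mult smult_smult)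
    then have "ev x ?Q \<in> I" using less.prems(1) by (simp add: ev_diff M.minus_eq)
    then show ?thesis using less.hyps[OF dQ _ Q] dQ less.prems(3) by simp
  qed
qed

lemma one_mem_ideal:
  assumes I: "ideal I A" and mem: "ysum P \<in> I" and nz: "i < p" "P i \<noteq> 0"
    and deg: "\<And>j. degree (P j) < p"
  shows "\<one> \<in> I"
  using mem nz deg
proof (induction "card {j. j < p \<and> P j \<noteq> 0}" arbitrary: P i rule: less_induct)
  case less
  interpret I: ideal I A by (rule I)
  show ?case
  proof (cases "\<exists>k<p. k \<noteq> i \<and> P k \<noteq> 0")
    case True
    then obtain k where k: "k < p" "k \<noteq> i" "P k \<noteq> 0" by blast
    \<comment> \<open>The commutator plus \<open>i\<close> times the element kills the component at \<open>i\<close> and keeps the one at \<open>k\<close>.\<close>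
    let ?Q = "\<lambda>j. Polynomial.smult (- of_nat j) (P j) + Polynomial.smult (of_nat i) (P j)"
    have Q: "?Q j = Polynomial.smult (of_nat i - of_nat j) (P j)" for j
      by (simp add: algebra_simps smult_diff_left)
    have "(of_nat i \<odot> \<one>) \<otimes> ysum P \<in> I" by (rule I.I_l_closed[OF less.prems(1)]) simp
    moreover have "(of_nat i \<odot> \<one>) \<otimes> ysum P = of_nat i \<odot> ysum P" by (simp add: smult_mult)
    moreover have "x \<otimes> ysum P \<ominus> ysum P \<otimes> x \<in> I"
      using I.I_l_closed[OF less.prems(1) x] I.I_r_closed[OF less.prems(1) x] by (simp add: M.minus_eq)
    ultimately have mQ: "ysum ?Q \<in> I" unfolding commutator_x ysum_smult ysum_add[symmetric] by simp
    have "(of_nat i :: 'f) \<noteq> of_nat k"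
      using of_nat_inj_below_char[OF char_p] less.prems(2) k by (auto simp: inj_on_def)
    then have nQ: "?Q k \<noteq> 0" unfolding Q using k by simp
    have "{j. j < p \<and> ?Q j \<noteq> 0} \<subset> {j. j < p \<and> P j \<noteq> 0}"
      unfolding Q using less.prems(2,3) by auto
    then have "card {j. j < p \<and> ?Q j \<noteq> 0} < card {j. j < p \<and> P j \<noteq> 0}" by (intro psubset_card_mono) auto
    moreover have "degree (?Q j) < p" for j
      unfolding Q using less.prems(4)[of j] le_less_trans[OF degree_smult_le] by blast
    ultimately show ?thesis using less.hyps[of ?Q k] mQ nQ k(1) by blast
  next
    case False
    then have ysum: "ysum P = ev x (P i) \<otimes> y [^] i" using less.prems(2) by (intro ysum_single) auto
    have "y [^] i \<otimes> y [^] (p - i) = b \<odot> \<one>" using less.prems(2) by (simp add: nat_pow_mult y_power)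
    then have "ysum P \<otimes> y [^] (p - i) = b \<odot> ev x (P i)" unfolding ysum by (simp add: m_assoc mult_smult)
    then have "b \<odot> ev x (P i) \<in> I" using I.I_r_closed[OF less.prems(1), of "y [^] (p - i)"] by simp
    then have "(inverse b \<odot> \<one>) \<otimes> (b \<odot> ev x (P i)) \<in> I" using I.I_l_closed by simp
    then have "ev x (P i) \<in> I" using b by (simp add: smult_mult smult_smult)
    then show ?thesis using one_mem_ideal_of_ev[OF I] less.prems by blast
  qed
qed

lemma simple: "simple_ring A"
  unfolding simple_ring_def
proof (intro conjI allI impI)
  fix I assume I: "ideal I A"
  then interpret I: ideal I A .
  show "I = {\<zero>} \<or> I = carrier A"
  proof (cases "I = {\<zero>}")
    case False
    then obtain u where u: "u \<in> I" "u \<noteq> \<zero>" using I.zero_closed by blast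
    obtain P where P: "u = ysum P" "\<And>j. degree (P j) < p" using normal_form I.Icarr u by blast
    have "\<exists>i<p. P i \<noteq> 0"
    proof (rule ccontr)
      assume "\<not> ?thesis"
      then have "ysum P = ysum (\<lambda>j. if j = 0 then 0 else 0)" by (intro ysum_cong) auto
      then show False using u P ev_eq_ysum[of 0] by simp
    qed
    then have "\<one> \<in> I" using one_mem_ideal[OF I, of P] u P by blast
    then show ?thesis using I.one_imp_carrier by blast
  qed simp
qed (simp_all add: one_not_zero ring_axioms)

text \<open>The sequence lists \<open>x\<^sup>i y\<^sup>j\<close> at position \<open>j p + i\<close>, so a block of length \<open>p\<close> is the component at \<open>y\<^sup>j\<close>.\<close>

lemma dimension_symbol: "dimension (p\<^sup>2) (scalars \<F> A) (carrier A)"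
proof -
  define u where "u n = x [^] (n mod p) \<otimes> y [^] (n div p)" for n
  have u [simp, intro]: "u n \<in> carrier A" for n by (simp add: u_def)
  let ?P = "\<lambda>c j. \<Sum>i<p. Polynomial.monom (c (j * p + i)) i :: 'f poly"
  have split: "lincomb u (m + n) c = lincomb u m c \<oplus> lincomb (\<lambda>i. u (m + i)) n (\<lambda>i. c (m + i))" for m n c
    by (induction n) (auto simp: lincomb_Suc M.a_lcomm)
  have block: "lincomb (\<lambda>i. u (j * p + i)) p (\<lambda>i. c (j * p + i)) = ev x (?P c j) \<otimes> y [^] j" for c j
  proof -
    have "lincomb (\<lambda>i. u (j * p + i)) p (\<lambda>i. c (j * p + i)) = (\<Oplus>i\<in>{..<p}. (c (j * p + i) \<odot> x [^] i) \<otimes> y [^] j)"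
      unfolding lincomb_def by (intro M.finsum_cong') (auto simp: u_def smult_mult)
    also have "\<dots> = ev x (?P c j) \<otimes> y [^] j"
      by (subst ev_sum_monom[OF x]) (auto simp: lincomb_def finsum_ldistr)
    finally show ?thesis .
  qed
  have "lincomb u (m * p) c = (\<Oplus>j\<in>{..<m}. ev x (?P c j) \<otimes> y [^] j)" for m c
  proof (induction m)
    case (Suc m)
    have "lincomb u (Suc m * p) c = lincomb u (m * p + p) c" by (simp add: add.commute)
    also have "\<dots> = ev x (?P c m) \<otimes> y [^] m \<oplus> (\<Oplus>j\<in>{..<m}. ev x (?P c j) \<otimes> y [^] j)"
      unfolding split block Suc by (rule M.a_comm) auto
    also have "\<dots> = (\<Oplus>j\<in>{..<Suc m}. ev x (?P c j) \<otimes> y [^] j)"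
      unfolding lessThan_Suc by (subst M.finsum_insert) auto
    finally show ?case .
  qed simp
  then have lin: "lincomb u (p\<^sup>2) c = ysum (?P c)" for c
    by (simp add: power2_eq_square ysum_def)
  have coeff: "poly.coeff (?P c j) i = c (j * p + i)" if "i < p" for c j i
    using that by (simp add: coeff_sum)
  have degP: "degree (?P c j) < p" for c j
    using p_gt_1 by (intro degree_sum_less) (auto intro: le_less_trans[OF degree_monom_le])
  show ?thesis
  proof (rule dimensionI_lincomb[of u])
    fix c assume "lincomb u (p\<^sup>2) c = \<zero>"
    then have 0: "\<forall>j<p. ?P c j = 0" unfolding lin by (rule indep) (rule degP)
    show "\<forall>k<p\<^sup>2. c k = 0"
    proof (intro allI impI)
      fix k assume "k < p\<^sup>2"
      then have "k div p < p" by (simp add: power2_eq_square less_mult_imp_div_less)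
      then have "poly.coeff (?P c (k div p)) (k mod p) = 0" using 0 by simp
      then show "c k = 0" using coeff[of "k mod p" c "k div p"] p_gt_1 by simp
    qed
  next
    fix v assume "v \<in> carrier A"
    then obtain P where P: "v = ysum P" "\<And>j. degree (P j) < p" using normal_form by blast
    let ?c = "\<lambda>k. poly.coeff (P (k div p)) (k mod p)"
    have "?P ?c j = P j" if "j < p" for j
    proof (rule poly_eqI)
      fix i
      show "poly.coeff (?P ?c j) i = poly.coeff (P j) i"
      proof (cases "i < p")
        case True
        then show ?thesis using coeff[OF True, of ?c j] by simp
      next
        case False
        then show ?thesis using degP[of ?c j] P(2)[of j] by (simp add: coeff_eq_0)
      qed
    qed
    then have "v = lincomb u (p\<^sup>2) ?c" unfolding lin P by (intro ysum_cong) simp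
    then show "\<exists>c. v = lincomb u (p\<^sup>2) c" by blast
  qed simp
qed

lemma p_algebra: "p_algebra_of_degree_p p \<F> A"
proof -
  have field: "field (\<F> :: 'f ring)" by (rule field_from_type_algebra)
  then interpret F: field "\<F> :: 'f ring" .
  have pow: "[n] \<cdot>\<^bsub>\<F>\<^esub> (1::'f) = of_nat n" for n :: nat
    by (induction n) (simp_all add: add_pow_def nat_pow_def)
  have csa: "central_simple_algebra \<F> A p"
    unfolding central_simple_algebra_def
    using field assoc_algebra_axioms simple ring_center_eq dimension_symbol by blast
  moreover have "field_of_char p (\<F> :: 'f ring)"
    unfolding field_of_char_def using prime_p field pow[of p] char_p of_nat_CHAR[where 'a = 'f] by simp
  ultimately show ?thesis
    unfolding p_algebra_of_degree_p_def p_algebra_def by (metis power_one_right)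
qed

end

section \<open>A representation of the symbol algebra\<close>

text \<open>The operators act on all functions from the field to itself, but the relations hold only for the
  values at the points of \<open>Z\<close>, the roots of \<open>X\<^sup>p - X = a\<close>. There \<open>z \<mapsto> z + 1\<close> is a permutation of order \<open>p\<close>
  because the characteristic is \<open>p\<close>, so that no separate index set of residues is needed.\<close>

locale symbol_rep = field_embedding \<iota>
  for \<iota> :: "'f::Fields.field \<Rightarrow> 's::Fields.field" +
  fixes p :: nat and a b :: 'f and \<eta> \<xi> :: 's
  assumes prime_p: "Factorial_Ring.prime p" and char_p: "CHAR('f) = p" and b: "b \<noteq> 0"
    and \<eta>: "\<eta> ^ p = \<iota> b" and \<xi>: "\<xi> ^ p - \<xi> = \<iota> a"
begin

definition Z :: "'s set" where "Z = {z. z ^ p - z = \<iota> a}"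

fun gact :: "symbol_gen \<Rightarrow> ('s \<Rightarrow> 's) \<Rightarrow> 's \<Rightarrow> 's" where
  "gact Gen_x v z = z * v z"
| "gact Gen_y v z = \<eta> * v (z + 1)"

primrec act :: "symbol_gen list \<Rightarrow> ('s \<Rightarrow> 's) \<Rightarrow> 's \<Rightarrow> 's" where
  "act [] v = v"
| "act (s # w) v = gact s (act w v)"

definition free_act :: "(symbol_gen list \<Rightarrow> 'f) \<Rightarrow> ('s \<Rightarrow> 's) \<Rightarrow> 's \<Rightarrow> 's" where
  "free_act f v z = (\<Sum>w | f w \<noteq> 0. \<iota> (f w) * act w v z)"

lemma char_S: "CHAR('s) = p" using char_emb char_p by simp

lemma Z_shift: "z \<in> Z \<Longrightarrow> z + 1 \<in> Z"
proof -
  assume "z \<in> Z"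
  moreover have "(z + 1) ^ p = z ^ p + 1 ^ p" using prime_p char_S by (intro freshmans_dream) auto
  ultimately show "z + 1 \<in> Z" by (simp add: Z_def)
qed

lemma Z_shift_nat: "z \<in> Z \<Longrightarrow> z + of_nat k \<in> Z"
proof (induction k)
  case (Suc k)
  then have "(z + of_nat k) + 1 \<in> Z" using Z_shift by blast
  then show ?case by (simp add: add_ac)
qed simp

lemma \<eta>_nz: "\<eta> \<noteq> 0" using \<eta> b emb_eq_0_iff prime_p by (metis power_eq_0_iff prime_gt_0_nat zero_power)

lemma free_act_superset:
  assumes "finite W" "{w. f w \<noteq> 0} \<subseteq> W"
  shows "free_act f v z = (\<Sum>w\<in>W. \<iota> (f w) * act w v z)"
  unfolding free_act_def using assms by (intro sum.mono_neutral_left) (auto simp: emb_0)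

lemma free_act_add:
  assumes "f \<in> carrier free_alg" "g \<in> carrier free_alg"
  shows "free_act (f \<oplus>\<^bsub>free_alg\<^esub> g) v z = free_act f v z + free_act g v z"
proof -
  let ?W = "{w. f w \<noteq> 0} \<union> {w. g w \<noteq> 0}"
  have fin: "finite ?W" using assms by (simp add: free_alg_carrier)
  have "free_act (f \<oplus>\<^bsub>free_alg\<^esub> g) v z = (\<Sum>w\<in>?W. \<iota> (f w + g w) * act w v z)"
    unfolding free_alg_add by (rule free_act_superset[OF fin]) auto
  also have "\<dots> = (\<Sum>w\<in>?W. \<iota> (f w) * act w v z) + (\<Sum>w\<in>?W. \<iota> (g w) * act w v z)"
    by (simp add: emb_add distrib_right sum.distrib)
  also have "\<dots> = free_act f v z + free_act g v z"
    using free_act_superset[OF fin, of f] free_act_superset[OF fin, of g] by simp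
  finally show ?thesis .
qed

lemma free_act_const_mult:
  "free_act (free_const \<F> c \<star> g) v z = \<iota> c * free_act g v z"
proof (cases "c = 0")
  case False
  then have "{w. c * g w \<noteq> 0} = {w. g w \<noteq> 0}" by auto
  then show ?thesis
    by (simp add: free_act_def free_const_mult_left emb_mult sum_distrib_left mult.assoc)
qed (simp add: free_act_def free_const_mult_left emb_0)

lemma free_act_const: "free_act (free_const \<F> c) v z = \<iota> c * v z"
proof -
  have "{w. free_const \<F> c w \<noteq> 0} \<subseteq> {[]}" by (auto simp: free_const_def)
  then show ?thesis
    using free_act_superset[of "{[]}" "free_const \<F> c"] by (simp add: free_const_def)
qed

lemma gact_sum: "gact s (\<lambda>z. \<Sum>i\<in>I. k i * h i z) z = (\<Sum>i\<in>I. k i * gact s (h i) z)"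
  by (cases s) (simp_all add: sum_distrib_left mult.left_commute)

lemma free_act_gen_mult:
  "free_act (free_gen \<F> s \<star> g) v z = gact s (free_act g v) z"
proof -
  have supp: "{w. (free_gen \<F> s \<star> g) w \<noteq> 0} = (#) s ` {w. g w \<noteq> 0}"
  proof (rule Set.set_eqI)
    fix w
    show "w \<in> {w. (free_gen \<F> s \<star> g) w \<noteq> 0} \<longleftrightarrow> w \<in> (#) s ` {w. g w \<noteq> 0}"
      by (cases w) (auto simp: free_gen_mult)
  qed
  have "free_act (free_gen \<F> s \<star> g) v z
      = (\<Sum>w | g w \<noteq> 0. \<iota> (g w) * gact s (act w v) z)"
    unfolding free_act_def supp by (subst sum.reindex) (auto simp: free_gen_mult)
  also have "\<dots> = gact s (free_act g v) z"
    unfolding free_act_def[abs_def] gact_sum ..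
  finally show ?thesis .
qed

lemma free_act_gen: "free_act (free_gen \<F> s) v z = gact s v z"
proof -
  interpret FA: ring "free_alg :: (_ \<Rightarrow> 'f) ring" by (rule ring_free_alg)
  have "free_act \<one>\<^bsub>free_alg\<^esub> v = v"
    using free_act_const[of 1] by (simp add: free_const_one emb_1 fun_eq_iff)
  then show ?thesis
    using free_act_gen_mult[of s "\<one>\<^bsub>free_alg\<^esub>" v z] by (simp add: free_gen_closed)
qed

lemma free_act_mult:
  assumes "f \<in> carrier free_alg" "g \<in> carrier free_alg"
  shows "free_act (f \<star> g) v z = free_act f (free_act g v) z"
  using assms(1)
proof (induction f arbitrary: z rule: free_alg_induct)
  case (add f h)
  interpret FA: ring "free_alg :: (_ \<Rightarrow> 'f) ring" by (rule ring_free_alg)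
  show ?case using add assms(2) by (simp add: FA.l_distr free_act_add)
next
  case (const c)
  then show ?case by (simp add: free_act_const_mult free_act_const)
next
  case (gen s f)
  then have "free_act (f \<star> g) v = free_act f (free_act g v)" by (simp add: fun_eq_iff)
  then show ?case by (simp add: free_alg_mult_assoc free_act_gen_mult)
qed

text \<open>The values on \<open>Z\<close> of the result depend only on the values on \<open>Z\<close> of the argument; this makes the
  annihilator below closed under multiplication from the left.\<close>

lemma free_act_vanishes:
  assumes "\<And>z. z \<in> Z \<Longrightarrow> v z = 0" "z \<in> Z"
  shows "free_act f v z = 0"
proof -
  have "act w v z = 0" if "z \<in> Z" for w z
    using that
  proof (induction w arbitrary: z)
    case (Cons s w)
    then show ?case using Z_shift by (cases s) simp_all
  qed (use assms in simp)
  then show ?thesis using assms(2) by (simp add: free_act_def)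
qed

lemma free_act_uminus:
  assumes "f \<in> carrier free_alg"
  shows "free_act (\<ominus>\<^bsub>free_alg\<^esub> f) v z = - free_act f v z"
proof -
  interpret FA: ring "free_alg :: (_ \<Rightarrow> 'f) ring" by (rule ring_free_alg)
  have "free_act (\<ominus>\<^bsub>free_alg\<^esub> f \<oplus>\<^bsub>free_alg\<^esub> f) v z = 0"
    using assms by (simp add: FA.l_neg) (simp add: free_act_def free_alg_zero)
  then have "free_act (\<ominus>\<^bsub>free_alg\<^esub> f) v z + free_act f v z = 0"
    using assms by (simp only: free_act_add[OF FA.a_inv_closed])
  then show ?thesis by (rule eq_neg_iff_add_eq_0[THEN iffD2])
qed

lemma free_act_minus:
  assumes "f \<in> carrier free_alg" "g \<in> carrier free_alg"
  shows "free_act (f \<ominus>\<^bsub>free_alg\<^esub> g) v z = free_act f v z - free_act g v z"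
proof -
  interpret FA: ring "free_alg :: (_ \<Rightarrow> 'f) ring" by (rule ring_free_alg)
  show ?thesis using assms by (simp add: FA.minus_eq free_act_add free_act_uminus)
qed

definition annihilator :: "(symbol_gen list \<Rightarrow> 'f) set" where
  "annihilator = {f \<in> carrier free_alg. \<forall>v. \<forall>z\<in>Z. free_act f v z = 0}"

lemma ideal_annihilator: "ideal annihilator free_alg"
proof (rule idealI[OF ring_free_alg])
  interpret FA: ring "free_alg :: (_ \<Rightarrow> 'f) ring" by (rule ring_free_alg)
  show "subgroup annihilator (add_monoid free_alg)"
  proof (rule FA.add.subgroupI)
    have "\<zero>\<^bsub>free_alg\<^esub> \<in> annihilator"
      by (simp add: annihilator_def) (simp add: free_act_def free_alg_zero)
    then show "annihilator \<noteq> {}" by blast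
  qed (auto simp: annihilator_def free_act_add free_act_uminus simp flip: a_inv_def)
qed (auto simp: annihilator_def free_act_mult free_alg_mult_closed intro: free_act_vanishes)

lemma free_act_power:
  assumes "f \<in> carrier free_alg"
  shows "free_act (f [^]\<^bsub>free_alg\<^esub> (n::nat)) v = (free_act f ^^ n) v"
proof (induction n arbitrary: v)
  interpret FA: ring "free_alg :: (_ \<Rightarrow> 'f) ring" by (rule ring_free_alg)
  {
    case 0
    show ?case using free_act_const[of 1 v] by (simp add: free_const_one emb_1 fun_eq_iff)
  next
    case (Suc n)
    have "free_act (f [^]\<^bsub>free_alg\<^esub> Suc n) v = free_act (f [^]\<^bsub>free_alg\<^esub> n) (free_act f v)"
      using assms by (intro ext) (simp add: free_act_mult)
    then show ?case by (simp add: Suc funpow_swap1)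
  }
qed

lemma symbol_ideal_annihilates: "symbol_ideal p \<F> a b \<subseteq> annihilator"
  unfolding symbol_ideal_def
proof (rule ring.genideal_minimal[OF ring_free_alg ideal_annihilator])
  interpret FA: ring "free_alg :: (_ \<Rightarrow> 'f) ring" by (rule ring_free_alg)
  note [simp] = free_gen_closed free_const_closed free_act_minus free_act_power free_act_mult free_act_add free_act_gen free_act_const
  let ?x = "free_gen \<F> Gen_x :: _ \<Rightarrow> 'f" and ?y = "free_gen \<F> Gen_y :: _ \<Rightarrow> 'f"
  have fx: "(free_act ?x ^^ n) v z = z ^ n * v z" for n v z
    by (induction n arbitrary: v z) (simp_all add: mult.assoc)
  have fy: "(free_act ?y ^^ n) v z = \<eta> ^ n * v (z + of_nat n)" for n v z
    by (induction n arbitrary: v z) (simp_all add: mult.assoc add_ac)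
  have one: "free_act \<one>\<^bsub>free_alg\<^esub> v z = v z" for v z
    using free_act_const[of 1 v z] by (simp add: free_const_one emb_1)
  have p0: "(of_nat p :: 's) = 0" using char_S of_nat_CHAR[where 'a = 's] by simp
  show "symbol_relations p \<F> a b \<subseteq> annihilator"
    using symbol_relations_closed
    by (auto simp: annihilator_def symbol_relations_def Let_def fx fy one p0 \<eta> Z_def algebra_simps)
qed

abbreviation "A \<equiv> symb p a b"
abbreviation "xA \<equiv> symb_x p a b"
abbreviation "yA \<equiv> symb_y p a b"

lemma symbol_gens_A: "symbol_gens A p a b xA yA"
  by (rule symbol_gens_symb[OF prime_p char_p b])

sublocale A: symbol_gens A p a b xA yA
  by (rule symbol_gens_A)

text \<open>The action of a coset through an arbitrary representative; it is independent of the choice only at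
  points of \<open>Z\<close>.\<close>

definition rep :: "(symbol_gen list \<Rightarrow> 'f) set \<Rightarrow> ('s \<Rightarrow> 's) \<Rightarrow> 's \<Rightarrow> 's" where
  "rep u = free_act (SOME f. f \<in> carrier free_alg \<and> u = symbol_proj p a b f)"

lemma rep_proj:
  assumes f: "f \<in> carrier free_alg" and z: "z \<in> Z"
  shows "rep (symbol_proj p a b f) v z = free_act f v z"
proof -
  interpret FA: ring "free_alg :: (_ \<Rightarrow> 'f) ring" by (rule ring_free_alg)
  interpret hom: ring_hom_ring free_alg A "symbol_proj p a b"
    by (rule ring_hom_ringI2[OF ring_free_alg A.ring_axioms symbol_proj_ring_hom])
  define g where g_def: "g = (SOME g. g \<in> carrier free_alg \<and> symbol_proj p a b f = symbol_proj p a b g)"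
  have g: "g \<in> carrier free_alg \<and> symbol_proj p a b f = symbol_proj p a b g"
    unfolding g_def by (rule someI[where P = "\<lambda>g. g \<in> carrier free_alg \<and> symbol_proj p a b f = symbol_proj p a b g", OF conjI[OF f refl]])
  then have gc: "g \<in> carrier free_alg" and gf: "symbol_proj p a b g = symbol_proj p a b f" by simp_all
  have "symbol_proj p a b (g \<ominus>\<^bsub>free_alg\<^esub> f) = symbol_proj p a b g \<oplus>\<^bsub>A\<^esub> symbol_proj p a b (\<ominus>\<^bsub>free_alg\<^esub> f)"
    unfolding FA.minus_eq by (rule hom.hom_add[OF gc FA.a_inv_closed[OF f]])
  also have "\<dots> = \<zero>\<^bsub>A\<^esub>"
    unfolding hom.hom_a_inv[OF f] gf by (rule A.r_neg[OF hom.hom_closed[OF f]])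
  finally have "g \<ominus>\<^bsub>free_alg\<^esub> f \<in> annihilator"
    using symbol_proj_eq_zero_iff[OF FA.minus_closed[OF gc f]] symbol_ideal_annihilates by blast
  then have "free_act g v z = free_act f v z"
    using free_act_minus[OF gc f, of v z] z by (simp add: annihilator_def)
  moreover have "rep (symbol_proj p a b f) = free_act g" by (simp only: rep_def g_def)
  ultimately show ?thesis by simp
qed

lemma rep_mult:
  assumes "u \<in> carrier A" "u' \<in> carrier A" "z \<in> Z"
  shows "rep (u \<otimes>\<^bsub>A\<^esub> u') v z = rep u (rep u' v) z"
proof -
  obtain f where f: "f \<in> carrier free_alg" "u = symbol_proj p a b f" by (rule symbol_proj_surj[OF assms(1)])
  obtain g where g: "g \<in> carrier free_alg" "u' = symbol_proj p a b g" by (rule symbol_proj_surj[OF assms(2)])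
  have "rep (u \<otimes>\<^bsub>A\<^esub> u') v z = free_act f (free_act g v) z"
    unfolding f g ring_hom_mult[OF symbol_proj_ring_hom f(1) g(1), symmetric]
    using rep_proj[OF free_alg_mult_closed[OF f(1) g(1)] assms(3)] free_act_mult[OF f(1) g(1)] by simp
  moreover have "free_act f (\<lambda>z. h z - h' z) z = free_act f h z - free_act f h' z" for h h'
  proof -
    have "act w (\<lambda>z. h z - h' z) z = act w h z - act w h' z" for w z
    proof (induction w arbitrary: z)
      case (Cons s w)
      then show ?case by (cases s) (simp_all add: right_diff_distrib)
    qed simp
    then show ?thesis by (simp add: free_act_def right_diff_distrib sum_subtractf)
  qed
  moreover have "free_act f (\<lambda>z. free_act g v z - rep u' v z) z = 0"
    using g rep_proj by (intro free_act_vanishes) (auto simp: assms)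
  ultimately show ?thesis using rep_proj[OF f(1) assms(3)] f by simp
qed

lemma rep_add:
  assumes "u \<in> carrier A" "u' \<in> carrier A" "z \<in> Z"
  shows "rep (u \<oplus>\<^bsub>A\<^esub> u') v z = rep u v z + rep u' v z"
proof -
  obtain f where f: "f \<in> carrier free_alg" "u = symbol_proj p a b f" by (rule symbol_proj_surj[OF assms(1)])
  obtain g where g: "g \<in> carrier free_alg" "u' = symbol_proj p a b g" by (rule symbol_proj_surj[OF assms(2)])
  show ?thesis
    unfolding f g ring_hom_add[OF symbol_proj_ring_hom f(1) g(1), symmetric]
    using f g assms(3) by (simp add: rep_proj free_alg_add_closed free_act_add)
qed

lemma rep_smult:
  assumes "u \<in> carrier A" "z \<in> Z"
  shows "rep (c \<odot>\<^bsub>A\<^esub> u) v z = \<iota> c * rep u v z"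
proof -
  obtain f where f: "f \<in> carrier free_alg" "u = symbol_proj p a b f" by (rule symbol_proj_surj[OF assms(1)])
  show ?thesis
    unfolding f symbol_proj_smult[OF f(1)]
    using f assms(2) by (simp add: rep_proj free_alg_mult_closed free_const_closed free_act_const_mult)
qed

lemma rep_one: "z \<in> Z \<Longrightarrow> rep \<one>\<^bsub>A\<^esub> v z = v z"
  using rep_proj[of "\<one>\<^bsub>free_alg\<^esub>" z v] free_act_const[of 1 v z] ring_hom_one[OF symbol_proj_ring_hom, of p a b]
  by (simp add: free_const_closed emb_1 flip: free_const_one)

lemma rep_zero: "z \<in> Z \<Longrightarrow> rep \<zero>\<^bsub>A\<^esub> v z = 0"
  using rep_smult[OF A.zero_closed, of z 0 v] by (simp add: emb_0)

lemma rep_x: "z \<in> Z \<Longrightarrow> rep xA v z = z * v z"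
  by (simp add: rep_proj free_gen_closed free_act_gen)

lemma rep_y: "z \<in> Z \<Longrightarrow> rep yA v z = \<eta> * v (z + 1)"
  by (simp add: rep_proj free_gen_closed free_act_gen)

lemma rep_ev: "z \<in> Z \<Longrightarrow> rep (A.ev xA P) v z = poly (map_poly \<iota> P) z * v z"
proof (induction P)
  case (pCons c P)
  then show ?case
    by (simp add: A.ev_pCons rep_add rep_smult rep_mult rep_one rep_x map_emb_pCons distrib_right mult.assoc)
qed (simp add: rep_zero)

lemma rep_y_power: "z \<in> Z \<Longrightarrow> rep (yA [^]\<^bsub>A\<^esub> j) v z = \<eta> ^ j * v (z + of_nat j)"
proof (induction j arbitrary: z)
  case (Suc j)
  have "rep (yA [^]\<^bsub>A\<^esub> Suc j) v z = rep yA (rep (yA [^]\<^bsub>A\<^esub> j) v) z"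
    using Suc.prems by (subst A.nat_pow_Suc2) (simp_all add: rep_mult)
  also have "\<dots> = \<eta> * (\<eta> ^ j * v (z + 1 + of_nat j))"
    using Suc.prems Suc.IH[OF Z_shift[OF Suc.prems]] by (simp add: rep_y)
  finally show ?case by (simp add: mult.assoc add.assoc)
qed (simp add: rep_one)

lemma rep_finsum:
  assumes "finite I" "\<And>i. i \<in> I \<Longrightarrow> h i \<in> carrier A" "z \<in> Z"
  shows "rep (\<Oplus>\<^bsub>A\<^esub>i\<in>I. h i) v z = (\<Sum>i\<in>I. rep (h i) v z)"
  using assms by (induction I rule: finite_induct) (simp_all add: rep_zero rep_add Pi_def)

lemma rep_ysum:
  assumes "z \<in> Z"
  shows "rep (A.ysum P) v z = (\<Sum>j<p. poly (map_poly \<iota> (P j)) z * (\<eta> ^ j * v (z + of_nat j)))"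
  unfolding A.ysum_def
  using assms by (subst rep_finsum) (simp_all add: rep_mult rep_ev rep_y_power)

text \<open>Applying a normal form to the indicator function of \<open>z + j\<close> isolates its component at \<open>y\<^sup>j\<close>, which
  therefore vanishes at all \<open>p\<close> roots in \<open>Z\<close>. Its degree is less than \<open>p\<close>.\<close>

lemma symbol_indep_A: "symbol_indep A p a b xA yA"
proof (intro symbol_indep.intro symbol_gens_A symbol_indep_axioms.intro allI impI)
  fix P :: "nat \<Rightarrow> 'f poly" and j
  assume 0: "A.ysum P = \<zero>\<^bsub>A\<^esub>" and deg: "\<And>j. degree (P j) < p" and j: "j < p"
  have inj: "inj_on (\<lambda>k. z + of_nat k :: 's) {..<p}" for z
    using of_nat_inj_below_char[OF char_S] by (auto simp: inj_on_def)
  have root: "poly (map_poly \<iota> (P j)) z = 0" if z: "z \<in> Z" for z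
  proof -
    let ?v = "\<lambda>w. if w = z + of_nat j then 1 else 0 :: 's"
    have "?v (z + of_nat i) = (if i = j then 1 else 0)" if "i < p" for i
      using inj[of z] that j by (auto simp: inj_on_def)
    then have "(\<Sum>i<p. poly (map_poly \<iota> (P i)) z * (\<eta> ^ i * ?v (z + of_nat i)))
        = (\<Sum>i<p. if i = j then poly (map_poly \<iota> (P j)) z * \<eta> ^ j else 0)"
      by (intro sum.cong) auto
    then have "poly (map_poly \<iota> (P j)) z * \<eta> ^ j = 0"
      using rep_ysum[OF z, of P ?v] rep_zero[OF z, of ?v] j unfolding 0 by simp
    then show ?thesis using \<eta>_nz by simp
  qed
  have \<xi>Z: "\<xi> \<in> Z" using \<xi> by (simp add: Z_def)
  have "map_poly \<iota> (P j) = 0"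
    using deg[of j] root Z_shift_nat[OF \<xi>Z] inj[of \<xi>]
    by (intro poly_eqI_degree[of "(\<lambda>k. \<xi> + of_nat k) ` {..<p}"]) (auto simp: card_image degree_map_emb)
  then show "P j = 0" by (simp add: map_emb_eq_0_iff)
qed

end

section \<open>Artin-Schreier extensions\<close>

text \<open>The ideal generated by \<open>P\<close> and \<open>f\<close> is generated by any of its nonzero elements \<open>R\<close> of least degree.
  Since \<open>R\<close> divides \<open>f\<close> and \<open>P\<close>, the irreducibility of \<open>f\<close> leaves only a constant \<open>R\<close>.\<close>

lemma irreducible_bezout:
  fixes f P :: "'f::Fields.field poly"
  assumes f: "degree f > 0"
    and irr: "\<And>R. R dvd f \<Longrightarrow> degree R = 0 \<or> degree R = degree f"
    and P: "\<not> f dvd P"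
  shows "\<exists>U V. U * P + V * f = 1"
proof -
  define I where "I = {U * P + V * f | U V. True}"
  have f_I: "f \<in> I" unfolding I_def by (rule CollectI, rule exI[of _ 0], rule exI[of _ 1]) simp
  have P_I: "P \<in> I" unfolding I_def by (rule CollectI, rule exI[of _ 1], rule exI[of _ 0]) simp
  have f0: "f \<noteq> 0" using f by auto
  let ?d = "\<lambda>n. \<exists>R\<in>I. R \<noteq> 0 \<and> degree R = n"
  have "?d (LEAST n. ?d n)" by (rule LeastI[of ?d "degree f"]) (use f_I f0 in blast)
  then obtain R where R: "R \<in> I" "R \<noteq> 0" "degree R = (LEAST n. ?d n)" by blast
  have R_dvd: "R dvd Q" if Q: "Q \<in> I" for Q
  proof -
    obtain U V U' V' where UV: "R = U * P + V * f" "Q = U' * P + V' * f"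
      using Q R(1) unfolding I_def by blast
    have "Q mod R = Q - Q div R * R" by (simp add: minus_div_mult_eq_mod)
    also have "\<dots> = (U' - Q div R * U) * P + (V' - Q div R * V) * f"
      by (subst (2) UV(1), subst (1) UV(2)) (simp add: algebra_simps)
    finally have "Q mod R \<in> I" unfolding I_def by blast
    moreover have "Q mod R = 0 \<or> degree (Q mod R) < degree R"
      using degree_mod_less R(2) by blast
    ultimately have "Q mod R = 0" using not_less_Least[of "degree (Q mod R)" ?d] R(3) by auto
    then show ?thesis by (simp add: mod_eq_0_iff_dvd)
  qed
  have "degree R \<noteq> degree f"
  proof
    assume eq: "degree R = degree f"
    obtain G where G: "f = R * G" using R_dvd[OF f_I] by (auto simp: dvd_def)
    then have "G \<noteq> 0" using f0 by auto
    then have "degree G = 0" using eq R(2) G by (simp add: degree_mult_eq)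
    then obtain c where c: "G = [:c:]" using degree_eq_zeroE by blast
    then have "c \<noteq> 0" using \<open>G \<noteq> 0\<close> by auto
    then have "f dvd R" using G c by (simp add: smult_dvd_iff)
    then show False using P R_dvd[OF P_I] dvd_trans by blast
  qed
  then obtain c where c: "R = [:c:]" using irr[OF R_dvd[OF f_I]] degree_eq_zeroE by blast
  obtain U V where "R = U * P + V * f" using R(1) unfolding I_def by blast
  then have "Polynomial.smult (inverse c) U * P + Polynomial.smult (inverse c) V * f = Polynomial.smult (inverse c) R"
    by (simp add: smult_add_right)
  also have "\<dots> = 1" using c R(2) by (simp add: one_pCons)
  finally show ?thesis by blast
qed

lemma field_embedding_to_ac: "field_embedding to_ac"
  by standard simp_all

text \<open>One of two factors of \<open>f\<close> vanishes at \<open>\<xi>\<close> and therefore has full degree.\<close>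

lemma (in field_embedding) irreducible_if_no_small_annihilator:
  assumes root: "poly (map_poly \<iota> f) \<xi> = 0" and f0: "f \<noteq> 0"
    and small: "\<And>R. poly (map_poly \<iota> R) \<xi> = 0 \<Longrightarrow> degree R < degree f \<Longrightarrow> R = 0"
    and R: "R dvd f"
  shows "degree R = 0 \<or> degree R = degree f"
proof -
  obtain G where G: "f = R * G" using R by (auto simp: dvd_def)
  then have nz: "R \<noteq> 0" "G \<noteq> 0" using f0 by auto
  then have sum: "degree R + degree G = degree f"
    using G by (simp add: degree_mult_eq)
  have "poly (map_poly \<iota> R) \<xi> = 0 \<or> poly (map_poly \<iota> G) \<xi> = 0"
    using root unfolding G by (simp add: map_emb_mult)
  then have "degree R \<ge> degree f \<or> degree G \<ge> degree f"
    using small nz by (meson not_less)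
  then show ?thesis using sum by linarith
qed

lemma AS_poly_irreducible:
  fixes a :: "'f::Fields.field"
  assumes p: "Factorial_Ring.prime p" and char: "CHAR('f) = p" and a: "\<nexists>c. c ^ p - c = a"
    and R: "R dvd AS_poly p a"
  shows "degree R = 0 \<or> degree R = degree (AS_poly p a)"
proof -
  interpret ac: field_embedding "to_ac :: 'f \<Rightarrow> _" by (rule field_embedding_to_ac)
  have p1: "p > 1" using p prime_gt_1_nat by blast
  have deg: "degree (AS_poly p a) = p" by (rule degree_AS_poly[OF p1])
  then have "degree (map_poly to_ac (AS_poly p a)) > 0" using p1 by (simp add: ac.degree_map_emb)
  then obtain \<xi> where root: "poly (map_poly to_ac (AS_poly p a)) \<xi> = 0"
    using alg_closed_imp_poly_has_root by blast
  then have "\<xi> ^ p - \<xi> = to_ac a"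
    by (simp add: ac.map_emb_diff ac.map_emb_monom ac.map_emb_pCons poly_monom algebra_simps)
  note small = ac.AS_no_annihilator[OF p char this a]
  show ?thesis
  proof (rule ac.irreducible_if_no_small_annihilator[OF root _ _ R])
    show "AS_poly p a \<noteq> 0" using deg p1 by (metis degree_0 not_less0)
  qed (use small deg in metis)
qed

lemma radical_poly_irreducible:
  fixes c :: "'f::Fields.field"
  assumes p: "Factorial_Ring.prime p" and char: "CHAR('f) = p" and c: "\<nexists>d. d ^ p = c"
    and R: "R dvd radical_poly p c"
  shows "degree R = 0 \<or> degree R = degree (radical_poly p c)"
proof -
  interpret ac: field_embedding "to_ac :: 'f \<Rightarrow> _" by (rule field_embedding_to_ac)
  have p1: "p > 1" using p prime_gt_1_nat by blast
  then have deg: "degree (radical_poly p c) = p" by (intro degree_radical_poly) simp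
  then have "degree (map_poly to_ac (radical_poly p c)) > 0" using p1 by (simp add: ac.degree_map_emb)
  then obtain \<xi> where root: "poly (map_poly to_ac (radical_poly p c)) \<xi> = 0"
    using alg_closed_imp_poly_has_root by blast
  then have "\<xi> ^ p = to_ac c"
    by (simp add: ac.map_emb_diff ac.map_emb_monom ac.map_emb_pCons poly_monom algebra_simps)
  note small = ac.radical_no_annihilator[OF p char this c]
  show ?thesis
  proof (rule ac.irreducible_if_no_small_annihilator[OF root _ _ R])
    show "radical_poly p c \<noteq> 0" using deg p1 by (metis degree_0 not_less0)
  qed (use small deg in metis)
qed

lemma (in type_algebra) ev_eq_zero_iff_dvd:
  assumes \<theta>: "\<theta> \<in> carrier A" and root: "ev \<theta> f = \<zero>" and one: "\<one> \<noteq> \<zero>"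
    and f: "degree f > 0"
    and irr: "\<And>R. R dvd f \<Longrightarrow> degree R = 0 \<or> degree R = degree f"
  shows "ev \<theta> P = \<zero> \<longleftrightarrow> f dvd P"
proof
  assume 0: "ev \<theta> P = \<zero>"
  show "f dvd P"
  proof (rule ccontr)
    assume "\<not> f dvd P"
    then obtain U V where "U * P + V * f = 1" using irreducible_bezout[OF f irr] by blast
    then have "ev \<theta> (U * P + V * f) = \<one>" using \<theta> by (simp add: ev_one)
    then show False using \<theta> root 0 one by (simp add: ev_add ev_mult)
  qed
next
  assume "f dvd P"
  then show "ev \<theta> P = \<zero>" using root \<theta> by (auto simp: dvd_def ev_mult)
qed

text \<open>For irreducible \<open>f\<close> a nonzero algebra generated by a root of \<open>f\<close> is presented by \<open>f\<close>: the kernel of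
  the evaluation is a proper ideal that contains \<open>f\<close>. Bezout coefficients provide inverses.\<close>

lemma presentedI:
  fixes L :: "('f::Fields.field, 'l, 'm) module_scheme"
  assumes L: "type_algebra L" and \<theta>: "\<theta> \<in> carrier L"
    and gen: "\<And>u. u \<in> carrier L \<Longrightarrow> \<exists>P. u = type_algebra.ev L \<theta> P"
    and root: "type_algebra.ev L \<theta> f = \<zero>\<^bsub>L\<^esub>" and one: "\<one>\<^bsub>L\<^esub> \<noteq> \<zero>\<^bsub>L\<^esub>"
    and f: "degree f > 0"
    and irr: "\<And>R. R dvd f \<Longrightarrow> degree R = 0 \<or> degree R = degree f"
  shows "presented_by L \<theta> f" and "field L"
proof -
  interpret L: type_algebra L by fact
  have inv: "\<exists>U. L.ev \<theta> U \<otimes>\<^bsub>L\<^esub> L.ev \<theta> P = \<one>\<^bsub>L\<^esub>" if P: "\<not> f dvd P" for P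
  proof -
    obtain U V where "U * P + V * f = 1" using irreducible_bezout[OF f irr P] by blast
    then have "L.ev \<theta> (U * P + V * f) = \<one>\<^bsub>L\<^esub>" using \<theta> by (simp add: L.ev_one)
    then show ?thesis using \<theta> root by (auto simp: L.ev_add L.ev_mult)
  qed
  have zero: "L.ev \<theta> P = \<zero>\<^bsub>L\<^esub> \<longleftrightarrow> f dvd P" for P
    by (rule L.ev_eq_zero_iff_dvd[OF \<theta> root one f irr])
  show "presented_by L \<theta> f" using L \<theta> gen zero by (simp add: presented_by_def)
  have "cring L"
    by (intro cring.intro L.ring_axioms comm_monoid.intro L.monoid_axioms comm_monoid_axioms.intro)
      (metis gen L.ev_commute[OF \<theta>])
  then interpret L: cring L .
  show "field L"
  proof (rule L.cring_fieldI2)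
    fix u assume "u \<in> carrier L" "u \<noteq> \<zero>\<^bsub>L\<^esub>"
    then obtain P where "u = L.ev \<theta> P" "\<not> f dvd P" using gen zero by metis
    then show "\<exists>v\<in>carrier L. u \<otimes>\<^bsub>L\<^esub> v = \<one>\<^bsub>L\<^esub>"
      using inv \<theta> L.ev_commute[OF \<theta>] L.ev_closed[OF \<theta>] by metis
  qed (use one in simp)
qed

text \<open>The ring of list polynomials is formed over the carrier of the base ring, which has to stay
  folded for its laws to apply.\<close>

declare ring_of_type_algebra_simps(1) [simp del]

lemma AS_algebra_presented:
  fixes a :: "'f::Fields.field"
  assumes p: "Factorial_Ring.prime p" and char: "CHAR('f) = p" and a: "\<nexists>c. c ^ p - c = a"
  obtains \<theta> where "presented_by (artin_schreier_algebra p \<F> a) \<theta> (AS_poly p a)"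
    and "field (artin_schreier_algebra p \<F> a)"
proof -
  let ?F = "\<F> :: 'f ring"
  interpret F: field ?F by (rule field_from_type_algebra)
  let ?K = "carrier ?F"
  have sub: "subring ?K ?F" by (rule F.carrier_is_subring)
  have subf: "subfield ?K ?F" by (rule F.carrier_is_subfield)
  let ?P = "univ_poly ?F ?K"
  interpret P: domain ?P by (rule F.univ_poly_is_domain[OF sub])
  let ?f = "artin_schreier_poly p ?F a"
  let ?L = "artin_schreier_algebra p ?F a"
  let ?X = "X\<^bsub>?F\<^esub>"
  have p1: "p > 1" using p prime_gt_1_nat by blast
  have X: "?X \<in> carrier ?P" by (rule F.var_closed(1)[OF sub])
  have const_hom: "F.poly_of_const \<in> ring_hom ?F ?P"
    using F.canonical_embedding_is_hom[OF sub] by (simp add: ring_of_type_algebra_def)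
  have const: "F.poly_of_const c \<in> carrier ?P" for c
    by (rule ring_hom_closed[OF const_hom]) (simp add: ring_of_type_algebra_simps(1))
  have f: "?f \<in> carrier ?P" unfolding artin_schreier_poly_def using X const by simp
  have deg: "Polynomials.degree ?f = p"
  proof -
    have 1: "Polynomials.degree (?X [^]\<^bsub>?P\<^esub> p) = p"
      unfolding F.unitary_monom_eq_var_pow[OF sub, symmetric] by (simp add: F.monom_def)
    have 2: "Polynomials.degree (\<ominus>\<^bsub>?P\<^esub> ?X) = 1"
      unfolding F.univ_poly_a_inv_degree[OF sub X] by (simp add: var_def)
    have 3: "Polynomials.degree (\<ominus>\<^bsub>?P\<^esub> F.poly_of_const a) = 0"
      unfolding F.univ_poly_a_inv_degree[OF sub const] by (simp add: F.poly_of_const_def)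
    have c12: "?X [^]\<^bsub>?P\<^esub> p \<in> carrier ?P" "\<ominus>\<^bsub>?P\<^esub> ?X \<in> carrier ?P" "\<ominus>\<^bsub>?P\<^esub> F.poly_of_const a \<in> carrier ?P"
      using X const by simp_all
    have 4: "Polynomials.degree (?X [^]\<^bsub>?P\<^esub> p \<oplus>\<^bsub>?P\<^esub> \<ominus>\<^bsub>?P\<^esub> ?X) = p"
      unfolding univ_poly_add using F.poly_add_degree_eq[OF sub, of "?X [^]\<^bsub>?P\<^esub> p" "\<ominus>\<^bsub>?P\<^esub> ?X"] c12 1 2 p1
      by (simp add: univ_poly_carrier)
    have "?X [^]\<^bsub>?P\<^esub> p \<oplus>\<^bsub>?P\<^esub> \<ominus>\<^bsub>?P\<^esub> ?X \<in> carrier ?P" using c12 by simp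
    then have "Polynomials.degree ((?X [^]\<^bsub>?P\<^esub> p \<oplus>\<^bsub>?P\<^esub> \<ominus>\<^bsub>?P\<^esub> ?X) \<oplus>\<^bsub>?P\<^esub> \<ominus>\<^bsub>?P\<^esub> F.poly_of_const a) = p"
      using F.poly_add_degree_eq[OF sub, of "?X [^]\<^bsub>?P\<^esub> p \<oplus>\<^bsub>?P\<^esub> \<ominus>\<^bsub>?P\<^esub> ?X" "\<ominus>\<^bsub>?P\<^esub> F.poly_of_const a"] c12 4 3 p1
      by (simp add: univ_poly_carrier univ_poly_add)
    then show ?thesis by (simp add: artin_schreier_poly_def P.minus_eq)
  qed
  define proj where "proj = F.rupture_surj ?K ?f"
  let ?R = "Rupt\<^bsub>?F\<^esub> ?K ?f"
  have hom: "proj \<in> ring_hom ?P ?R" "ring_hom_ring ?P ?R proj"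
    unfolding proj_def using F.rupture_surj_hom[OF sub f] by simp_all
  have surj: "\<exists>q\<in>carrier ?P. u = proj q" if "u \<in> carrier ?R" for u
    using that by (auto simp: rupture_def FactRing_def A_RCOSETS_def' proj_def)
  let ?\<iota> = "\<lambda>c. proj (F.poly_of_const c)"
  have L_def: "?L = algebra_of ?R ?\<iota>" by (simp add: artin_schreier_algebra_def proj_def)
  have \<iota>_hom: "?\<iota> \<in> ring_hom ?F ?R"
    using ring_hom_trans[OF const_hom hom(1)] by (simp add: comp_def)
  have talg: "type_algebra ?L"
    unfolding L_def
  proof (rule assoc_algebra_algebra_of[OF _ \<iota>_hom])
    fix c u assume "u \<in> carrier ?R"
    then obtain q where q: "q \<in> carrier ?P" "u = proj q" using surj by blast
    show "?\<iota> c \<otimes>\<^bsub>?R\<^esub> u = u \<otimes>\<^bsub>?R\<^esub> ?\<iota> c"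
      unfolding q(2) using q(1) const P.m_comm ring_hom_mult[OF hom(1)] by metis
  qed (rule ring_hom_ring.axioms(2)[OF hom(2)])
  interpret L: type_algebra ?L by (rule talg)
  have Lops: "carrier ?L = carrier ?R" "u \<otimes>\<^bsub>?L\<^esub> v = u \<otimes>\<^bsub>?R\<^esub> v" "u \<oplus>\<^bsub>?L\<^esub> v = u \<oplus>\<^bsub>?R\<^esub> v"
    "\<one>\<^bsub>?L\<^esub> = \<one>\<^bsub>?R\<^esub>" "\<zero>\<^bsub>?L\<^esub> = \<zero>\<^bsub>?R\<^esub>" "c \<odot>\<^bsub>?L\<^esub> u = ?\<iota> c \<otimes>\<^bsub>?R\<^esub> u" for u v c
    by (simp_all add: L_def algebra_of_def)
  have projL: "proj \<in> ring_hom ?P ?L"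
    using hom(1) by (simp add: ring_hom_def Lops)
  interpret homL: ring_hom_ring ?P ?L proj
    by (rule ring_hom_ringI2[OF P.ring_axioms L.ring_axioms projL])
  have proj_const: "proj (F.poly_of_const c) = c \<odot>\<^bsub>?L\<^esub> \<one>\<^bsub>?L\<^esub>" for c
    using ring_hom_mult[OF hom(1) const P.one_closed, of c] ring_hom_one[OF hom(1)] const[of c] by (simp add: Lops)
  let ?\<theta> = "proj ?X"
  have \<theta>: "?\<theta> \<in> carrier ?L" using X by simp
  have root: "L.ev ?\<theta> (AS_poly p a) = \<zero>\<^bsub>?L\<^esub>"
  proof -
    have pow: "proj (q [^]\<^bsub>?P\<^esub> n) = proj q [^]\<^bsub>?L\<^esub> n" if "q \<in> carrier ?P" for q and n :: nat
      using that by (induction n) simp_all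
    have c: "?X [^]\<^bsub>?P\<^esub> p \<ominus>\<^bsub>?P\<^esub> ?X \<in> carrier ?P" "?X [^]\<^bsub>?P\<^esub> p \<in> carrier ?P" using X by simp_all
    have minus: "proj (q \<ominus>\<^bsub>?P\<^esub> r) = proj q \<ominus>\<^bsub>?L\<^esub> proj r" if "q \<in> carrier ?P" "r \<in> carrier ?P" for q r
      using that by (simp add: P.minus_eq L.minus_eq)
    have "L.ev ?\<theta> (AS_poly p a) = proj ?f"
      unfolding artin_schreier_poly_def L.ev_AS_poly[OF \<theta>]
      by (simp only: minus[OF c(1) const] minus[OF c(2) X] pow[OF X] proj_const)
    also have "\<dots> = \<zero>\<^bsub>?R\<^esub>"
    proof -
      interpret I: ideal "PIdl\<^bsub>?P\<^esub> ?f" ?P by (rule P.cgenideal_ideal[OF f])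
      show ?thesis
        unfolding proj_def rupture_def FactRing_def
        using I.a_rcos_const[OF P.cgenideal_self[OF f]] by simp
    qed
    finally show ?thesis by (simp add: Lops)
  qed
  have gen: "\<exists>P. u = L.ev ?\<theta> P" if u: "u \<in> carrier ?L" for u
  proof -
    obtain q where q: "q \<in> carrier ?P" "u = proj q" using surj u by (auto simp: Lops)
    have "\<exists>P. proj (P.eval (map F.poly_of_const l) ?X) = L.ev ?\<theta> P \<and> P.eval (map F.poly_of_const l) ?X \<in> carrier ?P" for l
    proof (induction l)
      case Nil
      then show ?case by (intro exI[of _ 0]) simp
    next
      case (Cons c l)
      then obtain P where P: "proj (P.eval (map F.poly_of_const l) ?X) = L.ev ?\<theta> P"
        and cl: "P.eval (map F.poly_of_const l) ?X \<in> carrier ?P" by blast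
      have pow: "proj (?X [^]\<^bsub>?P\<^esub> n) = ?\<theta> [^]\<^bsub>?L\<^esub> n" for n :: nat
        using X by (induction n) simp_all
      have "proj (P.eval (map F.poly_of_const (c # l)) ?X)
          = (c \<odot>\<^bsub>?L\<^esub> \<one>\<^bsub>?L\<^esub>) \<otimes>\<^bsub>?L\<^esub> (?\<theta> [^]\<^bsub>?L\<^esub> length l) \<oplus>\<^bsub>?L\<^esub> L.ev ?\<theta> P"
        using const X cl P by (simp add: pow proj_const)
      also have "\<dots> = L.ev ?\<theta> (Polynomial.monom c (length l) + P)"
        using \<theta> by (simp add: L.ev_add L.ev_monom L.smult_mult)
      finally show ?case using const X cl by auto
    qed
    then show ?thesis using F.eval_rewrite[OF sub q(1)] q(2) by metis
  qed
  have one: "\<one>\<^bsub>?L\<^esub> \<noteq> \<zero>\<^bsub>?L\<^esub>"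
    unfolding Lops using F.rupture_one_not_zero[OF subf f] deg p1 by simp
  have degc: "degree (AS_poly p a) > 0" using degree_AS_poly[OF p1, of a] p1 by linarith
  show ?thesis
    using presentedI[OF talg \<theta> gen root one degc AS_poly_irreducible[OF p char a]] that by blast
qed

declare ring_of_type_algebra_simps(1) [simp]

lemma pcompose_monom_one: "Polynomial.monom 1 n \<circ>\<^sub>p R = (R :: 'f::Fields.field poly) ^ n"
  unfolding monom_altdef by (induction n) (simp_all add: pcompose_mult pcompose_pCons pcompose_1)

lemma AS_poly_shift:
  fixes a :: "'f::Fields.field"
  assumes p: "Factorial_Ring.prime p" and char: "CHAR('f) = p"
  shows "AS_poly p a \<circ>\<^sub>p [:1, 1:] = AS_poly p a"
proof -
  have "([:0, 1:] + 1 :: 'f poly) ^ p = [:0, 1:] ^ p + 1 ^ p"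
    using p char by (intro freshmans_dream) auto
  moreover have "[:0, 1:] + 1 = ([:1, 1:] :: 'f poly)" by (simp add: one_pCons)
  ultimately have "[:1, 1:] ^ p = Polynomial.monom 1 p + (1 :: 'f poly)" by (simp add: monom_altdef)
  then show ?thesis by (simp add: pcompose_diff pcompose_pCons pcompose_monom_one one_pCons)
qed

lemma restrict_algebra_hom:
  fixes L :: "('f::Fields.field, 'l, 'm) module_scheme"
  assumes "type_algebra L" "h \<in> algebra_hom \<F> L M"
  shows "restrict h (carrier L) \<in> algebra_hom \<F> L M"
proof -
  interpret L: type_algebra L by fact
  show ?thesis using assms(2) by (auto simp: algebra_hom_def ring_hom_def Pi_def)
qed

lemma galois_group_is_group:
  fixes L :: "('f::Fields.field, 'l, 'm) module_scheme"
  assumes L: "type_algebra L"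
  shows "group (galois_group \<F> L)"
proof -
  interpret L: type_algebra L by fact
  interpret B: group "BijGroup (carrier L)" by (rule group_BijGroup)
  let ?H = "Bij (carrier L) \<inter> algebra_hom \<F> L L"
  have "subgroup ?H (BijGroup (carrier L))"
  proof (rule subgroup.intro)
    show "?H \<subseteq> carrier (BijGroup (carrier L))" by (auto simp: BijGroup_def)
  next
    fix g h assume gh: "g \<in> ?H" "h \<in> ?H"
    then have "compose (carrier L) g h \<in> algebra_hom \<F> L L"
      by (auto simp: algebra_hom_def ring_hom_def compose_def Pi_def)
    then show "g \<otimes>\<^bsub>BijGroup (carrier L)\<^esub> h \<in> ?H" using gh by (simp add: BijGroup_def compose_Bij)
  next
    show "\<one>\<^bsub>BijGroup (carrier L)\<^esub> \<in> ?H"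
      by (auto simp: BijGroup_def id_Bij algebra_hom_def ring_hom_def)
  next
    fix h assume h: "h \<in> ?H"
    then have hB: "h \<in> Bij (carrier L)" and hh: "h \<in> algebra_hom \<F> L L" by auto
    note hom = algebra_hom_mem[OF hh]
    let ?g = "inv_into (carrier L) h"
    have inj: "inj_on h (carrier L)" and im: "h ` carrier L = carrier L"
      using hB by (auto simp: Bij_def bij_betw_def)
    have gc: "?g u \<in> carrier L" if "u \<in> carrier L" for u using Bij_inv_into_mem[OF hB that] .
    have hg: "h (?g u) = u" if "u \<in> carrier L" for u using that im by (simp add: f_inv_into_f)
    have gI: "?g v = u" if "u \<in> carrier L" "h u = v" for u v using inv_into_f_eq[OF inj that] .
    have "(\<lambda>u\<in>carrier L. ?g u) \<in> algebra_hom \<F> L L"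
      unfolding algebra_hom_def
    proof (intro CollectI conjI ballI ring_hom_memI)
      fix u v assume uv: "u \<in> carrier L" "v \<in> carrier L"
      show "restrict ?g (carrier L) (u \<otimes>\<^bsub>L\<^esub> v) = restrict ?g (carrier L) u \<otimes>\<^bsub>L\<^esub> restrict ?g (carrier L) v"
        using uv gc hg hom by (simp add: gI)
      show "restrict ?g (carrier L) (u \<oplus>\<^bsub>L\<^esub> v) = restrict ?g (carrier L) u \<oplus>\<^bsub>L\<^esub> restrict ?g (carrier L) v"
        using uv gc hg hom by (simp add: gI)
    next
      fix c u assume "u \<in> carrier L"
      then show "restrict ?g (carrier L) (c \<odot>\<^bsub>L\<^esub> u) = c \<odot>\<^bsub>L\<^esub> restrict ?g (carrier L) u"
        using gc hg hom by (simp add: gI)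
    qed (use gc hom gI in auto)
    then show "inv\<^bsub>BijGroup (carrier L)\<^esub> h \<in> ?H"
      using restrict_inv_into_Bij[OF hB] by (simp add: inv_BijGroup[OF hB])
  qed
  then show ?thesis unfolding galois_group_def by (rule subgroup.subgroup_is_group[OF _ B.group_axioms])
qed

text \<open>The automorphisms send \<open>\<theta>\<close> to a root of the same Artin-Schreier polynomial, that is, to
  \<open>\<theta> + k\<close> with \<open>k\<close> in the prime field, so they are the powers of \<open>\<theta> \<mapsto> \<theta> + 1\<close>.\<close>

lemma AS_cyclic:
  fixes L :: "('f::Fields.field, 'l, 'm) module_scheme"
  assumes p: "Factorial_Ring.prime p" and char: "CHAR('f) = p"
    and L: "presented_by L \<theta> (AS_poly p a)" "field L"
  shows "extension_of_degree \<F> L p"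
    and "cyclic_separable_extension \<F> L"
proof -
  let ?f = "AS_poly p a"
  have p1: "p > 1" using p prime_gt_1_nat by blast
  have deg: "degree ?f = p" by (rule degree_AS_poly[OF p1])
  interpret L: type_algebra L using L(1) by (simp add: presented_by_def)
  interpret LF: field L by (rule L(2))
  have \<theta>: "\<theta> \<in> carrier L" and gen: "\<And>u. u \<in> carrier L \<Longrightarrow> \<exists>P. u = L.ev \<theta> P"
    and zero: "\<And>P. L.ev \<theta> P = \<zero>\<^bsub>L\<^esub> \<longleftrightarrow> ?f dvd P"
    using L(1) by (auto simp: presented_by_def)
  have talg: "type_algebra L" by (rule L.type_algebra_axioms)
  show ext: "extension_of_degree \<F> L p"
    using presented_dimension[OF L(1)] deg p1 L(2) L.assoc_algebra_axioms field_from_type_algebra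
    by (auto simp: extension_of_degree_def field_extension_def)
  let ?G = "galois_group \<F> L"
  interpret G: group ?G by (rule galois_group_is_group[OF talg])
  have G_iff: "h \<in> carrier ?G \<longleftrightarrow> h \<in> Bij (carrier L) \<and> h \<in> algebra_hom \<F> L L" for h
    by (simp add: galois_group_def)
  have G_ev: "h (L.ev \<theta> P) = L.ev (h \<theta>) P" if "h \<in> carrier ?G" for h P
    using that algebra_hom_ev[OF talg talg _ \<theta>] G_iff by blast
  have G_closed: "h u \<in> carrier L" if "h \<in> carrier ?G" "u \<in> carrier L" for h u
    using that algebra_hom_mem(1)[of h L L u] G_iff by blast
  have G_mult: "(g \<otimes>\<^bsub>?G\<^esub> h) u = g (h u)" if "g \<in> carrier ?G" "h \<in> carrier ?G" "u \<in> carrier L" for g h u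
    using that by (simp add: galois_group_def BijGroup_def compose_def)
  have G_eq: "g = h" if "g \<in> carrier ?G" "h \<in> carrier ?G" "g \<theta> = h \<theta>" for g h
  proof (rule extensionalityI[of _ "carrier L"])
    show "g \<in> extensional (carrier L)" "h \<in> extensional (carrier L)"
      using that G_iff Bij_imp_extensional by blast+
    fix u assume "u \<in> carrier L"
    then show "g u = h u" using gen G_ev that by metis
  qed
  have shift: "L.ev (\<theta> \<oplus>\<^bsub>L\<^esub> \<one>\<^bsub>L\<^esub>) P = L.ev \<theta> (P \<circ>\<^sub>p [:1, 1:])" for P
  proof -
    have "L.ev \<theta> [:1, 1:] = \<theta> \<oplus>\<^bsub>L\<^esub> \<one>\<^bsub>L\<^esub>" using \<theta> by (simp add: L.ev_pCons L.M.a_comm)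
    then show ?thesis using L.ev_pcompose[OF \<theta>, of P "[:1, 1:]"] by simp
  qed
  have "L.ev (\<theta> \<oplus>\<^bsub>L\<^esub> \<one>\<^bsub>L\<^esub>) ?f = \<zero>\<^bsub>L\<^esub>"
    unfolding shift AS_poly_shift[OF p char] zero by simp
  then obtain s where s: "s \<in> algebra_hom \<F> L L"
    and s_ev: "\<And>P. s (L.ev \<theta> P) = L.ev (\<theta> \<oplus>\<^bsub>L\<^esub> \<one>\<^bsub>L\<^esub>) P"
    using presented_hom[OF L(1) talg] \<theta> by (metis L.M.a_closed L.one_closed)
  define \<sigma> where "\<sigma> = restrict s (carrier L)"
  have \<sigma>_hom: "\<sigma> \<in> algebra_hom \<F> L L"
    unfolding \<sigma>_def by (rule restrict_algebra_hom[OF talg s])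
  have \<sigma>_ev: "\<sigma> (L.ev \<theta> P) = L.ev \<theta> (P \<circ>\<^sub>p [:1, 1:])" for P
    using \<theta> s_ev shift by (simp add: \<sigma>_def)
  have \<sigma>: "\<sigma> \<in> carrier ?G"
  proof -
    have inj: "inj_on \<sigma> (carrier L)"
      by (rule algebra_hom_field_inj[OF L(2) talg _ \<sigma>_hom]) simp
    have "u \<in> \<sigma> ` carrier L" if "u \<in> carrier L" for u
    proof -
      obtain Q where Q: "u = L.ev \<theta> Q" using gen \<open>u \<in> carrier L\<close> by blast
      have "(Q \<circ>\<^sub>p [:- 1, 1:]) \<circ>\<^sub>p [:1, 1:] = Q"
        by (simp add: pcompose_pCons flip: pcompose_assoc)
      then have "u = \<sigma> (L.ev \<theta> (Q \<circ>\<^sub>p [:- 1, 1:]))" unfolding \<sigma>_ev Q by simp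
      then show ?thesis using \<theta> by blast
    qed
    then have "\<sigma> ` carrier L = carrier L" using algebra_hom_mem(1)[OF \<sigma>_hom] by blast
    then show ?thesis unfolding G_iff using inj \<sigma>_hom by (simp add: Bij_def bij_betw_def \<sigma>_def)
  qed
  have \<sigma>_\<theta>: "\<sigma> \<theta> = \<theta> \<oplus>\<^bsub>L\<^esub> \<one>\<^bsub>L\<^esub>"
    using \<sigma>_ev[of "[:0, 1:]"] shift[of "[:0, 1:]"] \<theta> by (simp add: L.ev_X)
  have \<sigma>_pow: "(\<sigma> [^]\<^bsub>?G\<^esub> k) \<theta> = \<theta> \<oplus>\<^bsub>L\<^esub> of_nat k \<odot>\<^bsub>L\<^esub> \<one>\<^bsub>L\<^esub>" for k :: nat
  proof (induction k)
    case 0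
    show ?case using \<theta> by (simp add: galois_group_def BijGroup_def)
  next
    case (Suc k)
    have sk: "\<sigma> [^]\<^bsub>?G\<^esub> k \<in> carrier ?G" using \<sigma> by simp
    have "(\<sigma> [^]\<^bsub>?G\<^esub> Suc k) \<theta> = (\<sigma> [^]\<^bsub>?G\<^esub> k) (\<theta> \<oplus>\<^bsub>L\<^esub> \<one>\<^bsub>L\<^esub>)"
      using G_mult[OF sk \<sigma> \<theta>] by (simp add: \<sigma>_\<theta>)
    also have "\<dots> = \<theta> \<oplus>\<^bsub>L\<^esub> of_nat k \<odot>\<^bsub>L\<^esub> \<one>\<^bsub>L\<^esub> \<oplus>\<^bsub>L\<^esub> \<one>\<^bsub>L\<^esub>"
      using algebra_hom_mem(3,5)[of "\<sigma> [^]\<^bsub>?G\<^esub> k" L L] sk G_iff \<theta> Suc by simp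
    also have "\<dots> = \<theta> \<oplus>\<^bsub>L\<^esub> of_nat (Suc k) \<odot>\<^bsub>L\<^esub> \<one>\<^bsub>L\<^esub>"
      using \<theta> by (simp add: L.add_smult L.M.a_ac)
    finally show ?case .
  qed
  have prod_zero: "\<exists>k\<in>B. L.ev \<theta> (h k) = \<zero>\<^bsub>L\<^esub>" if "finite B" "L.ev \<theta> (\<Prod>k\<in>B. h k) = \<zero>\<^bsub>L\<^esub>"
    for B and h :: "nat \<Rightarrow> 'f poly"
    using that
  proof (induction B rule: finite_induct)
    case empty
    then show ?case using \<theta> by (simp add: L.ev_one)
  next
    case (insert k B)
    then have "L.ev \<theta> (h k) \<otimes>\<^bsub>L\<^esub> L.ev \<theta> (\<Prod>k\<in>B. h k) = \<zero>\<^bsub>L\<^esub>" using \<theta> by (simp add: L.ev_mult)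
    then have "L.ev \<theta> (h k) = \<zero>\<^bsub>L\<^esub> \<or> L.ev \<theta> (\<Prod>k\<in>B. h k) = \<zero>\<^bsub>L\<^esub>"
      using LF.integral \<theta> by simp
    then show ?case using insert.IH by blast
  qed
  have conj: "\<exists>k::nat. \<tau> \<theta> = \<theta> \<oplus>\<^bsub>L\<^esub> of_nat k \<odot>\<^bsub>L\<^esub> \<one>\<^bsub>L\<^esub>" if \<tau>: "\<tau> \<in> carrier ?G" for \<tau>
  proof -
    obtain Q where Q: "\<tau> \<theta> = L.ev \<theta> Q" using gen G_closed[OF \<tau> \<theta>] by blast
    have "L.ev (\<tau> \<theta>) ?f = \<tau> \<zero>\<^bsub>L\<^esub>" using G_ev[OF \<tau>, of ?f] zero[of ?f] by simp
    also have "\<dots> = \<zero>\<^bsub>L\<^esub>" using G_ev[OF \<tau>, of 0] by simp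
    finally have f1: "L.ev \<theta> (?f \<circ>\<^sub>p Q) = \<zero>\<^bsub>L\<^esub>" unfolding Q L.ev_pcompose[OF \<theta>] .
    have f2: "L.ev \<theta> ?f = \<zero>\<^bsub>L\<^esub>" using zero by simp
    have ev0: "L.ev \<theta> (?f \<circ>\<^sub>p Q - ?f) = \<zero>\<^bsub>L\<^esub>"
      unfolding L.ev_diff[OF \<theta>, of "?f \<circ>\<^sub>p Q" ?f] f1 f2 by (simp add: L.minus_eq)
    \<comment> \<open>\<open>D\<close> represents \<open>\<tau> \<theta> - \<theta>\<close>, a root of \<open>X\<^sup>p - X\<close>, which splits over the prime field.\<close>
    define D where "D = Q - [:0, 1:]"
    have "(D + [:0, 1:]) ^ p = D ^ p + [:0, 1:] ^ p"
      using p char by (intro freshmans_dream) auto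
    then have "Q ^ p = D ^ p + Polynomial.monom 1 p" by (simp add: D_def monom_altdef)
    then have "?f \<circ>\<^sub>p Q - ?f = D ^ p - D"
      by (simp add: pcompose_diff pcompose_pCons pcompose_monom_one D_def)
    also have "\<dots> = AS_poly p 0 \<circ>\<^sub>p D" by (simp add: pcompose_diff pcompose_pCons pcompose_monom_one)
    also have "\<dots> = (\<Prod>k<p. D - [:of_nat k:])"
    proof -
      have "AS_poly p 0 = (\<Prod>k<p. [:- of_nat k, 1:] :: 'f poly)"
        using AS_poly_factorization[OF p char, of 0] p1 by (simp add: power_0_left)
      moreover have "[:- of_nat k, 1:] \<circ>\<^sub>p D = D - [:of_nat k:]" for k
        by (simp add: pcompose_pCons)
      ultimately show ?thesis by (simp only: pcompose_prod)
    qed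
    finally obtain k where k: "L.ev \<theta> (D - [:of_nat k:]) = \<zero>\<^bsub>L\<^esub>" using ev0 prod_zero[of "{..<p}"] by auto
    have "L.ev \<theta> Q = L.ev \<theta> ((D - [:of_nat k:]) + ([:0, 1:] + [:of_nat k:]))"
    proof -
      have "R = (R - u - v) + (u + v)" for R u v :: "'f poly" by simp
      then show ?thesis unfolding D_def by metis
    qed
    also have "\<dots> = \<theta> \<oplus>\<^bsub>L\<^esub> of_nat k \<odot>\<^bsub>L\<^esub> \<one>\<^bsub>L\<^esub>"
      using \<theta> k by (simp only: L.ev_add[OF \<theta>] L.ev_X[OF \<theta>] L.ev_const[OF \<theta>]) simp
    finally show ?thesis using Q by auto
  qed
  have cyc: "cyclic_group ?G"
    unfolding G.cyclic_group
  proof (rule bexI[OF _ \<sigma>], intro Set.set_eqI iffI)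
    fix \<tau> assume \<tau>: "\<tau> \<in> carrier ?G"
    then obtain k :: nat where "\<tau> \<theta> = (\<sigma> [^]\<^bsub>?G\<^esub> k) \<theta>" using conj \<sigma>_pow by metis
    then have "\<tau> = \<sigma> [^]\<^bsub>?G\<^esub> k" using G_eq \<tau> \<sigma> by simp
    then have "\<tau> = \<sigma> [^]\<^bsub>?G\<^esub> int k" by (simp add: int_pow_int)
    then show "\<tau> \<in> range (\<lambda>n::int. \<sigma> [^]\<^bsub>?G\<^esub> n)" by blast
  next
    fix \<tau> assume "\<tau> \<in> range (\<lambda>n::int. \<sigma> [^]\<^bsub>?G\<^esub> n)"
    then show "\<tau> \<in> carrier ?G" using \<sigma> by auto
  qed
  have "{u \<in> carrier L. \<forall>\<tau>\<in>carrier ?G. \<tau> u = u} = scalars \<F> L"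
  proof (intro Set.set_eqI iffI)
    fix u assume "u \<in> {u \<in> carrier L. \<forall>\<tau>\<in>carrier ?G. \<tau> u = u}"
    then have u: "u \<in> carrier L" and fixed: "\<sigma> u = u" using \<sigma> by auto
    obtain P0 where P0: "u = L.ev \<theta> P0" using gen u by blast
    define P where "P = P0 mod ?f"
    have f0: "?f \<noteq> 0" using deg p1 by (metis degree_0 not_less0)
    have P: "u = L.ev \<theta> P"
      unfolding P0 presented_ev_eq_iff[OF L(1)] P_def by (simp only: minus_mod_eq_mult_div dvd_triv_left)
    have dP: "degree P < p" using degree_mod_less[OF f0, of P0] deg p1 unfolding P_def by (metis degree_0 less_trans zero_less_one)
    have "?f dvd P \<circ>\<^sub>p [:1, 1:] - P"
      using fixed unfolding P \<sigma>_ev presented_ev_eq_iff[OF L(1)] .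
    moreover have "degree (P \<circ>\<^sub>p [:1, 1:] - P) < p"
      using dP by (intro degree_diff_less) (simp_all add: degree_pcompose)
    ultimately have "P \<circ>\<^sub>p [:1, 1:] - P = 0" using deg by (metis dvd_imp_degree_le not_less)
    then have "P \<circ>\<^sub>p [:1, 1:] = P" by simp
    then obtain c where "P = [:c:]" using shift_invariant_imp_constant[OF char dP] by blast
    then show "u \<in> scalars \<F> L" using \<theta> by (simp add: P L.ev_const L.scalars_eq)
  next
    fix u assume "u \<in> scalars \<F> L"
    then obtain c where c: "u = c \<odot>\<^bsub>L\<^esub> \<one>\<^bsub>L\<^esub>" by (auto simp: L.scalars_eq)
    have "\<tau> u = u" if "\<tau> \<in> carrier ?G" for \<tau>
      using that algebra_hom_mem(4,5)[of \<tau> L L] G_iff unfolding c by simp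
    then show "u \<in> {u \<in> carrier L. \<forall>\<tau>\<in>carrier ?G. \<tau> u = u}" using c by simp
  qed
  then show "cyclic_separable_extension \<F> L"
    unfolding cyclic_separable_extension_def galois_extension_def using ext cyc by blast
qed

section \<open>Purely inseparable extensions of degree p\<close>

text \<open>Let \<open>u\<close> be the last element outside \<open>F\<close> among \<open>v, v\<^sup>p, (v\<^sup>p)\<^sup>p, \<dots>\<close> for some \<open>v\<close> outside \<open>F\<close>.
  Then \<open>u\<^sup>p = c\<close> lies in \<open>F\<close> and is not a \<open>p\<close>-th power there, so \<open>X\<^sup>p - c\<close> is irreducible and the
  powers of \<open>u\<close> below \<open>p\<close> fill the \<open>p\<close>-dimensional extension.\<close>

lemma insep_radical_generator:
  fixes L :: "('f::Fields.field, 'l, 'm) module_scheme"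
  assumes p: "Factorial_Ring.prime p" and char: "CHAR('f) = p"
    and ext: "extension_of_degree \<F> L p"
    and insep: "purely_inseparable_extension p \<F> L"
  obtains u c where "presented_by L u (radical_poly p c)"
proof -
  have L: "field L" "type_algebra L"
    and dim: "ring.dimension L p (scalars \<F> L) (carrier L)"
    using ext by (auto simp: extension_of_degree_def field_extension_def intro: type_algebraI)
  interpret LF: field L by (rule L(1))
  interpret L: type_algebra L by (rule L(2))
  let ?K = "scalars \<F> L"
  have one: "\<one>\<^bsub>L\<^esub> \<noteq> \<zero>\<^bsub>L\<^esub>" by simp
  have sub: "subfield ?K L" by (rule L.subfield_scalars[OF one])
  have p1: "p > 1" using p prime_gt_1_nat by blast
  have "carrier L \<noteq> ?K"
  proof
    assume "carrier L = ?K"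
    then have "LF.dimension p ?K ?K" using dim by simp
    then have "p = 1" using LF.dimension_is_inj[OF sub] LF.dimension_one[OF sub] by blast
    then show False using p1 by simp
  qed
  then obtain v where v: "v \<in> carrier L" "v \<notin> ?K" by (auto simp: L.scalars_eq)
  let ?Q = "\<lambda>n. v [^]\<^bsub>L\<^esub> (p ^ n) \<in> ?K"
  obtain n where n: "?Q n" using insep v by (auto simp: purely_inseparable_extension_def)
  define m where "m = (LEAST n. ?Q n)"
  have m: "?Q m" unfolding m_def using n by (rule LeastI)
  have "m \<noteq> 0" using m v by (intro notI) simp
  then obtain k where k: "m = Suc k" using not0_implies_Suc by blast
  define u where "u = v [^]\<^bsub>L\<^esub> (p ^ k)"
  have u: "u \<in> carrier L" using v by (simp add: u_def)
  have uK: "u \<notin> ?K" using not_less_Least[of k ?Q] k unfolding u_def m_def by simp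
  have "u [^]\<^bsub>L\<^esub> p = v [^]\<^bsub>L\<^esub> (p ^ m)" using v by (simp add: u_def k LF.nat_pow_pow mult.commute)
  then obtain c where c: "u [^]\<^bsub>L\<^esub> p = c \<odot>\<^bsub>L\<^esub> \<one>\<^bsub>L\<^esub>" using m by (auto simp: L.scalars_eq)
  let ?f = "radical_poly p c"
  have deg: "degree ?f = p" using p1 by (intro degree_radical_poly) simp
  have root: "L.ev u ?f = \<zero>\<^bsub>L\<^esub>" using u c by (simp only: L.ev_radical_poly) simp
  have nopow: "\<nexists>d. d ^ p = c"
  proof
    assume "\<exists>d. d ^ p = c"
    then obtain d where d: "d ^ p = c" by blast
    then have "?f = [:- d, 1:] ^ p" using radical_poly_factorization[OF p char, of d] by simp
    then have pow: "L.ev u [:- d, 1:] [^]\<^bsub>L\<^esub> p = \<zero>\<^bsub>L\<^esub>" using root u by (simp only: L.ev_power)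
    have "w = \<zero>\<^bsub>L\<^esub>" if "w \<in> carrier L" "w [^]\<^bsub>L\<^esub> n = \<zero>\<^bsub>L\<^esub>" for w and n :: nat
      using that by (induction n) (auto simp: LF.integral_iff)
    then have 0: "L.ev u [:- d, 1:] = \<zero>\<^bsub>L\<^esub>" using pow u by blast
    have "u = L.ev u ([:- d, 1:] + [:d:])" using u by (simp add: L.ev_X)
    also have "\<dots> = d \<odot>\<^bsub>L\<^esub> \<one>\<^bsub>L\<^esub>" using 0 u by (simp only: L.ev_add L.ev_const) simp
    finally show False using uK by (auto simp: L.scalars_eq)
  qed
  have degf: "degree ?f > 0" using deg p1 by linarith
  note irr = radical_poly_irreducible[OF p char nopow]
  have gen: "\<exists>P. w = L.ev u P" if "w \<in> carrier L" for w
  proof -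
    let ?pows = "\<lambda>k::nat. u [^]\<^bsub>L\<^esub> k" and ?us = "rev (map (\<lambda>k::nat. u [^]\<^bsub>L\<^esub> k) [0..<p])"
    have "\<forall>k<p. e k = 0" if "L.lincomb ?pows p e = \<zero>\<^bsub>L\<^esub>" for e
      using L.powers_independent[OF u degf L.ev_eq_zero_iff_dvd[OF u root one degf irr]] that
      unfolding deg by blast
    then have "LF.independent ?K ?us" by (intro L.independent_upt) (use u in auto)
    moreover have "set ?us \<subseteq> carrier L" using u by auto
    moreover have "length ?us = p" by simp
    ultimately have "LF.Span ?K ?us = carrier L"
      using LF.independent_length_eq_dimension[OF sub dim] by blast
    moreover have "LF.Span ?K ?us = range (L.lincomb ?pows p)" by (intro L.Span_upt) (use u in auto)
    ultimately obtain e where "w = L.lincomb ?pows p e" using \<open>w \<in> carrier L\<close> by auto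
    then show ?thesis using L.ev_sum_monom[OF u] by metis
  qed
  show ?thesis
    using presentedI(1)[OF L(2) u gen root one degf irr] that by blast
qed

text \<open>If \<open>c = \<Sum>\<^sub>i d\<^sub>i\<^sup>p t\<^sup>i\<close>, then \<open>\<Sum>\<^sub>i d\<^sub>i w\<^sup>i\<close> is a \<open>p\<close>-th root of \<open>c\<close> as soon as
  \<open>w\<close> is one of \<open>t\<close>.\<close>

lemma insep_embeds:
  fixes L :: "('f::Fields.field, 'l, 'm) module_scheme" and A :: "('f, 'a, 'n) module_scheme"
  assumes p: "Factorial_Ring.prime p" and char: "CHAR('f) = p"
    and ext: "extension_of_degree \<F> L p"
    and insep: "purely_inseparable_extension p \<F> L"
    and basis: "\<And>c. \<exists>d. c = (\<Sum>i<p. d i ^ p * t ^ i)"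
    and A: "type_algebra A" "\<one>\<^bsub>A\<^esub> \<noteq> \<zero>\<^bsub>A\<^esub>"
    and w: "w \<in> carrier A" "w [^]\<^bsub>A\<^esub> p = t \<odot>\<^bsub>A\<^esub> \<one>\<^bsub>A\<^esub>"
  shows "algebra_embeds \<F> L A"
proof -
  interpret A: type_algebra A by (rule A(1))
  obtain u c where L: "presented_by L u (radical_poly p c)"
    using insep_radical_generator[OF p char ext insep] by blast
  obtain d where d: "c = (\<Sum>i<p. d i ^ p * t ^ i)" using basis by blast
  let ?G = "\<Sum>i<p. Polynomial.monom (d i) i"
  have "?G ^ p = (\<Sum>i<p. Polynomial.monom (d i) i ^ p)"
    using p char by (intro freshmans_dream_sum) auto
  also have "\<dots> = (\<Sum>i<p. Polynomial.monom (d i ^ p) (i * p))"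
    by (simp add: monom_power)
  finally have "A.ev w ?G [^]\<^bsub>A\<^esub> p = A.ev w (\<Sum>i<p. Polynomial.monom (d i ^ p) (i * p))"
    using w(1) by (metis A.ev_power)
  also have "\<dots> = (\<Oplus>\<^bsub>A\<^esub>i\<in>{..<p}. A.ev w [:d i ^ p * t ^ i:])"
  proof -
    have tpow: "(t \<odot>\<^bsub>A\<^esub> \<one>\<^bsub>A\<^esub>) [^]\<^bsub>A\<^esub> i = t ^ i \<odot>\<^bsub>A\<^esub> \<one>\<^bsub>A\<^esub>" for i :: nat
      by (induction i) (simp_all add: A.smult_mult A.mult_smult A.smult_smult mult.commute)
    have "w [^]\<^bsub>A\<^esub> (i * p) = t ^ i \<odot>\<^bsub>A\<^esub> \<one>\<^bsub>A\<^esub>" for i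
      using A.nat_pow_pow[OF w(1), of p i] w(2) tpow by (simp add: mult.commute)
    then have "A.ev w (Polynomial.monom (d i ^ p) (i * p)) = A.ev w [:d i ^ p * t ^ i:]" for i
      using w(1) by (simp add: A.ev_monom A.ev_const A.smult_smult)
    then show ?thesis using w(1) by (simp add: A.ev_sum)
  qed
  also have "\<dots> = A.ev w (\<Sum>i<p. [:d i ^ p * t ^ i:])" using w(1) by (simp add: A.ev_sum)
  also have "(\<Sum>i<p. [:d i ^ p * t ^ i:]) = [:c:]"
  proof -
    have "(\<Sum>i\<in>I. [:h i:]) = [:\<Sum>i\<in>I. h i:]" if "finite I" for I :: "nat set" and h :: "nat \<Rightarrow> 'f"
      using that by (induction I rule: finite_induct) simp_all
    then show ?thesis by (simp add: d)
  qed
  finally have "A.ev (A.ev w ?G) (radical_poly p c) = \<zero>\<^bsub>A\<^esub>"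
    using w(1) by (simp only: A.ev_radical_poly[OF A.ev_closed[OF w(1)]] A.ev_const) (simp add: A.minus_eq A.r_neg)
  moreover have "field L" using ext by (simp add: extension_of_degree_def field_extension_def)
  ultimately show ?thesis using presented_embeds[OF L _ A] w(1) by blast
qed

section \<open>The rational function field in Laurent series\<close>

unbundle fps_syntax

lemma to_fract_power: "to_fract (x ^ n) = to_fract x ^ n"
  by (induction n) simp_all

text \<open>The elements of this form are closed under addition, by Frobenius, and under multiplication
  by \<open>p\<close>-th powers. They contain the monomials because \<open>K\<close> is perfect, hence all polynomials. A
  fraction \<open>P / Q\<close> is the polynomial \<open>P Q\<^sup>p\<^sup>-\<^sup>1\<close> times the \<open>p\<close>-th power of \<open>1 / Q\<close>.\<close>

lemma rational_function_p_basis: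
  fixes c :: "'k::Fields.field poly fract"
  assumes p: "Factorial_Ring.prime p" and char: "CHAR('k poly fract) = p"
    and perfect: "\<And>e::'k. \<exists>d. d ^ p = e"
  shows "\<exists>d. c = (\<Sum>i<p. d i ^ p * to_fract [:0, 1:] ^ i)"
proof -
  let ?t = "to_fract [:0, 1:] :: 'k poly fract"
  have p0: "p > 0" using p prime_gt_0_nat by blast
  define G where "G = {c. \<exists>d. c = (\<Sum>i<p. d i ^ p * ?t ^ i)}"
  have GI: "(\<Sum>i<p. d i ^ p * ?t ^ i) \<in> G" for d
    unfolding G_def by (rule CollectI, rule exI[of _ d], rule refl)
  have add: "c + c' \<in> G" if "c \<in> G" "c' \<in> G" for c c'
  proof -
    obtain d d' where d: "c = (\<Sum>i<p. d i ^ p * ?t ^ i)" "c' = (\<Sum>i<p. d' i ^ p * ?t ^ i)"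
      using \<open>c \<in> G\<close> \<open>c' \<in> G\<close> by (auto simp: G_def)
    have "(d i + d' i) ^ p = d i ^ p + d' i ^ p" for i
      using p char by (intro freshmans_dream) auto
    then have "c + c' = (\<Sum>i<p. (d i + d' i) ^ p * ?t ^ i)"
      unfolding d by (simp add: distrib_right sum.distrib)
    then show ?thesis by (simp only: GI)
  qed
  have pow: "e ^ p * c \<in> G" if "c \<in> G" for c e
  proof -
    obtain d where d: "c = (\<Sum>i<p. d i ^ p * ?t ^ i)" using \<open>c \<in> G\<close> by (auto simp: G_def)
    have "e ^ p * c = (\<Sum>i<p. (e * d i) ^ p * ?t ^ i)"
      unfolding d by (simp add: sum_distrib_left power_mult_distrib mult.assoc)
    then show ?thesis by (simp only: GI)
  qed
  have t_pow: "?t ^ n \<in> G" if "n < p" for n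
  proof -
    have "(\<Sum>i<p. (if i = n then 1 else 0) ^ p * ?t ^ i) = (\<Sum>i<p. if i = n then ?t ^ i else 0)"
      using p0 by (intro sum.cong) (auto simp: power_0_left)
    then have "?t ^ n = (\<Sum>i<p. (if i = n then 1 else 0) ^ p * ?t ^ i)" using that by simp
    then show ?thesis by (simp only: GI)
  qed
  have t_pow': "?t ^ n \<in> G" for n
  proof -
    have "?t ^ n = (?t ^ (n div p)) ^ p * ?t ^ (n mod p)"
      by (simp flip: power_mult power_add)
    then show ?thesis using pow t_pow p0 by (metis mod_less_divisor)
  qed
  have sum_G: "(\<Sum>i\<in>I. h i) \<in> G" if "finite I" "\<And>i. i \<in> I \<Longrightarrow> h i \<in> G" for I :: "nat set" and h
    using that
  proof (induction I rule: finite_induct)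
    case empty
    show ?case using pow[OF t_pow[OF p0], of 0] p0 by (simp add: power_0_left)
  qed (simp add: add)
  have monom: "to_fract (Polynomial.monom e n) \<in> G" for e n
  proof -
    obtain d where d: "d ^ p = e" using perfect by blast
    have "Polynomial.monom e n = [:d:] ^ p * [:0, 1:] ^ n" by (simp add: monom_altdef poly_const_pow d)
    then have "to_fract (Polynomial.monom e n) = to_fract [:d:] ^ p * ?t ^ n" by (simp add: to_fract_power)
    then show ?thesis using pow t_pow' by simp
  qed
  have poly: "to_fract P \<in> G" for P
  proof -
    have fs: "to_fract (\<Sum>i\<in>I. h i) = (\<Sum>i\<in>I. to_fract (h i))" if "finite I" for I :: "nat set" and h :: "nat \<Rightarrow> 'k poly"
      using that by (induction I rule: finite_induct) simp_all
    have "to_fract P = (\<Sum>i\<le>degree P. to_fract (Polynomial.monom (poly.coeff P i) i))"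
      by (subst (1) poly_as_sum_of_monoms[of P, symmetric]) (simp add: fs)
    then show ?thesis using sum_G monom by simp
  qed
  obtain P Q where PQ: "c = Fract P Q" "Q \<noteq> 0" by (cases c)
  have "c = to_fract P / to_fract Q" by (simp add: PQ Fract_conv_to_fract)
  also have "\<dots> = inverse (to_fract Q) ^ p * to_fract (P * Q ^ (p - 1))"
  proof -
    have "to_fract Q ^ p = to_fract Q * to_fract Q ^ (p - 1)" using p0 by (metis power_eq_if not_gr0)
    then show ?thesis using PQ(2) by (simp add: to_fract_power field_simps)
  qed
  finally have "c \<in> G" using pow poly by metis
  then show ?thesis by (simp add: G_def)
qed

definition fract_extend :: "('a::idom \<Rightarrow> 'b::Fields.field) \<Rightarrow> 'a fract \<Rightarrow> 'b" where
  "fract_extend h q = (SOME y. \<exists>a b. b \<noteq> 0 \<and> q = Fract a b \<and> y = h a / h b)"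

context
  fixes h :: "'a::idom \<Rightarrow> 'b::Fields.field"
  assumes h_add: "\<And>x y. h (x + y) = h x + h y" and h_mult: "\<And>x y. h (x * y) = h x * h y"
    and h_1: "h 1 = 1" and h_nz: "\<And>x. x \<noteq> 0 \<Longrightarrow> h x \<noteq> 0"
begin

lemma fract_extend_Fract:
  assumes "b \<noteq> 0"
  shows "fract_extend h (Fract a b) = h a / h b"
  unfolding fract_extend_def
proof (rule some_equality)
  fix y assume "\<exists>a' b'. b' \<noteq> 0 \<and> Fract a b = Fract a' b' \<and> y = h a' / h b'"
  then obtain a' b' where *: "b' \<noteq> 0" "Fract a b = Fract a' b'" "y = h a' / h b'" by blast
  then have "h a * h b' = h a' * h b" using assms by (simp add: eq_fract flip: h_mult)
  then show "y = h a / h b" unfolding *(3) using *(1) assms h_nz by (simp add: frac_eq_eq)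
qed (use assms in blast)

lemma field_embedding_fract_extend: "field_embedding (fract_extend h)"
proof
  fix q r :: "'a fract"
  obtain a b c d where [simp]: "q = Fract a b" "b \<noteq> 0" "r = Fract c d" "d \<noteq> 0"
    by (metis Fract_cases)
  show "fract_extend h (q + r) = fract_extend h q + fract_extend h r"
    using h_nz by (simp add: fract_extend_Fract h_add h_mult field_simps)
  show "fract_extend h (q * r) = fract_extend h q * fract_extend h r"
    by (simp add: fract_extend_Fract h_mult)
next
  show "fract_extend h 1 = 1" by (simp add: One_fract_def fract_extend_Fract h_1)
qed

end

definition expand_at_0 :: "'k::Fields.field poly fract \<Rightarrow> 'k fls" where
  "expand_at_0 = fract_extend (\<lambda>P. fps_to_fls (fps_of_poly P))"

lemma fps_of_poly_hom:
  fixes P Q :: "'k::Fields.field poly"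
  shows "fps_to_fls (fps_of_poly (P + Q)) = fps_to_fls (fps_of_poly P) + fps_to_fls (fps_of_poly Q)"
    and "fps_to_fls (fps_of_poly (P * Q)) = fps_to_fls (fps_of_poly P) * fps_to_fls (fps_of_poly Q)"
    and "fps_to_fls (fps_of_poly (1 :: 'k poly)) = 1"
    and "P \<noteq> 0 \<Longrightarrow> fps_to_fls (fps_of_poly P) \<noteq> 0"
  by (simp_all add: fps_of_poly_add fps_of_poly_mult fls_times_fps_to_fls)

lemma field_embedding_expand_at_0: "field_embedding (expand_at_0 :: 'k::Fields.field poly fract \<Rightarrow> _)"
  unfolding expand_at_0_def by (rule field_embedding_fract_extend) (simp_all add: fps_of_poly_hom)

lemma expand_at_0_to_fract: "expand_at_0 (to_fract P) = fps_to_fls (fps_of_poly (P :: 'k::Fields.field poly))"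
  unfolding expand_at_0_def to_fract_def
  by (subst fract_extend_Fract) (simp_all add: fps_of_poly_hom)

lemma fls_times_nth_between:
  fixes f g :: "'k::Fields.field fls"
  assumes "\<And>i. i < A \<Longrightarrow> f $$ i = 0" "\<And>i. i < B \<Longrightarrow> g $$ i = 0"
  shows "(f * g) $$ n = (\<Sum>i=A..n - B. f $$ i * g $$ (n - i))"
proof -
  let ?df = "fls_subdegree f" and ?dg = "fls_subdegree g"
  let ?I = "{min ?df A..max (n - ?dg) (n - B)}"
  have "(f * g) $$ n = (\<Sum>i=?df..n - ?dg. f $$ i * g $$ (n - i))" by (rule fls_times_nth(2))
  also have "\<dots> = (\<Sum>i\<in>?I. f $$ i * g $$ (n - i))"
    by (intro sum.mono_neutral_left) (auto intro!: fls_eq0_below_subdegree)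
  also have "\<dots> = (\<Sum>i=A..n - B. f $$ i * g $$ (n - i))"
    using assms by (intro sum.mono_neutral_right) auto
  finally show ?thesis .
qed

text \<open>The exponents \<open>A\<close> and \<open>B\<close> are lower bounds rather than orders, so that leading terms can be followed
  without deciding whether their coefficients vanish.\<close>

lemma fls_times_lead:
  fixes f g :: "'k::Fields.field fls"
  assumes "\<And>i. i < A \<Longrightarrow> f $$ i = 0" "\<And>i. i < B \<Longrightarrow> g $$ i = 0"
  shows "n < A + B \<Longrightarrow> (f * g) $$ n = 0" and "(f * g) $$ (A + B) = f $$ A * g $$ B"
  using fls_times_nth_between[of A f B g, OF assms] by simp_all

lemma fls_power_lead:
  fixes f :: "'k::Fields.field fls"
  assumes f: "\<And>i. i < A \<Longrightarrow> f $$ i = 0"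
  shows "(\<forall>i<int n * A. (f ^ n) $$ i = 0) \<and> (f ^ n) $$ (int n * A) = (f $$ A) ^ n"
proof (induction n)
  case (Suc n)
  have "int (Suc n) * A = A + int n * A" by (simp add: algebra_simps)
  then show ?case
    using fls_times_lead[of A f "int n * A" "f ^ n", OF f] Suc by simp
qed simp

text \<open>The substitution \<open>t = s\<^sup>p\<close> in a Laurent series in \<open>t\<close>, together with the extension of the
  coefficient field.\<close>

definition laurent_embed :: "nat \<Rightarrow> 'k::Fields.field fls \<Rightarrow> 'k alg_closure fls" where
  "laurent_embed p f = Abs_fls (\<lambda>n. if int p dvd n then to_ac (f $$ (n div int p)) else 0)"

lemma laurent_embed_nth:
  assumes "p > 0"
  shows "laurent_embed p f $$ n = (if int p dvd n then to_ac (f $$ (n div int p)) else 0)"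
  unfolding laurent_embed_def
proof (rule nth_Abs_fls_lower_bound[of "int p * fls_subdegree f"], intro allI impI)
  fix n assume n: "n < int p * fls_subdegree f"
  have "n div int p < fls_subdegree f" if "int p dvd n"
    using n that assms by (auto simp: dvd_def)
  then show "(if int p dvd n then to_ac (f $$ (n div int p)) else 0) = 0" by auto
qed

lemma field_embedding_laurent_embed:
  assumes p: "p > 0"
  shows "field_embedding (laurent_embed p :: 'k::Fields.field fls \<Rightarrow> _)"
proof
  note nth = laurent_embed_nth[OF p]
  fix f g :: "'k fls"
  show "laurent_embed p (f + g) = laurent_embed p f + laurent_embed p g"
    by (intro fls_eqI) (simp add: nth)
  show "laurent_embed p (f * g) = laurent_embed p f * laurent_embed p g"
  proof (intro fls_eqI)
    fix n
    let ?A = "fls_subdegree f" and ?B = "fls_subdegree g" and ?p = "int p"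
    have below: "laurent_embed p h $$ i = 0" if i: "i < ?p * fls_subdegree h" for h :: "'k fls" and i
      using i p by (auto simp: nth dvd_def)
    have eq: "(laurent_embed p f * laurent_embed p g) $$ n =
        (\<Sum>i=?p * ?A..n - ?p * ?B. laurent_embed p f $$ i * laurent_embed p g $$ (n - i))"
      by (rule fls_times_nth_between) (simp_all add: below)
    show "laurent_embed p (f * g) $$ n = (laurent_embed p f * laurent_embed p g) $$ n"
    proof (cases "?p dvd n")
      case False
      then have "laurent_embed p f $$ i * laurent_embed p g $$ (n - i) = 0" for i
        using dvd_diff_right_iff[of ?p i n] by (auto simp: nth dvd_diff_left_iff)
      then have "(laurent_embed p f * laurent_embed p g) $$ n = 0"
        unfolding eq by (intro sum.neutral ballI)
      then show ?thesis using False by (simp add: nth)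
    next
      case True
      then obtain m where m: "n = ?p * m" by (auto simp: dvd_def)
      have le: "?p * i \<le> ?p * m - ?p * ?B \<longleftrightarrow> i \<le> m - ?B" for i
        using p by (simp flip: right_diff_distrib)
      have "(laurent_embed p f * laurent_embed p g) $$ n =
          (\<Sum>i\<in>(*) ?p ` {?A..m - ?B}. laurent_embed p f $$ i * laurent_embed p g $$ (n - i))"
        unfolding eq
      proof (intro sum.mono_neutral_right ballI)
        show "(*) ?p ` {?A..m - ?B} \<subseteq> {?p * ?A..n - ?p * ?B}" using p le by (auto simp: m)
        fix i assume i: "i \<in> {?p * ?A..n - ?p * ?B} - (*) ?p ` {?A..m - ?B}"
        have "\<not> ?p dvd i"
        proof
          assume "?p dvd i"
          then obtain j where j: "i = ?p * j" by (auto simp: dvd_def)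
          then have "j \<in> {?A..m - ?B}" using i p le by (auto simp: m)
          then show False using i j by blast
        qed
        then show "laurent_embed p f $$ i * laurent_embed p g $$ (n - i) = 0" by (simp add: nth)
      qed simp
      also have "\<dots> = (\<Sum>j=?A..m - ?B. to_ac (f $$ j) * to_ac (g $$ (m - j)))"
        using p by (subst sum.reindex) (auto simp: inj_on_def nth m simp flip: right_diff_distrib)
      also have "\<dots> = to_ac ((f * g) $$ m)"
        by (subst fls_times_nth(2)) (simp add: to_ac_sum)
      finally show ?thesis using p by (simp add: nth m)
    qed
  qed
next
  show "laurent_embed p (1 :: 'k fls) = 1"
    using p by (intro fls_eqI) (auto simp: laurent_embed_nth[OF p] dvd_def)
qed

lemma fls_const_hom:
  fixes x y :: "'b::Fields.field"
  shows "fls_const (x + y) = fls_const x + fls_const y" "fls_const (x - y) = fls_const x - fls_const y"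
  by (rule fls_eqI, simp)+

definition ratfun_embed :: "nat \<Rightarrow> 'k::Fields.field poly fract \<Rightarrow> 'k alg_closure fls" where
  "ratfun_embed p c = laurent_embed p (expand_at_0 c)"

lemma field_embedding_ratfun_embed:
  assumes "p > 0"
  shows "field_embedding (ratfun_embed p :: 'k::Fields.field poly fract \<Rightarrow> _)"
proof -
  interpret e: field_embedding "expand_at_0 :: 'k poly fract \<Rightarrow> _" by (rule field_embedding_expand_at_0)
  interpret l: field_embedding "laurent_embed p :: 'k fls \<Rightarrow> _" by (rule field_embedding_laurent_embed[OF assms])
  show ?thesis
    by standard (simp_all add: ratfun_embed_def e.emb_add e.emb_mult e.emb_1 l.emb_add l.emb_mult l.emb_1)
qed

lemma expand_at_0_const: "expand_at_0 (to_fract [:c:]) = fls_const (c :: 'k::Fields.field)"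
  by (simp add: expand_at_0_to_fract fps_of_poly_const fps_const_to_fls)

lemma ratfun_embed_const:
  assumes "p > 0"
  shows "ratfun_embed p (to_fract [:c:]) = fls_const (to_ac (c :: 'k::Fields.field))"
  using assms by (intro fls_eqI) (auto simp: ratfun_embed_def expand_at_0_const laurent_embed_nth)

lemma ratfun_embed_t:
  assumes "p > 0"
  shows "ratfun_embed p (to_fract [:0, 1 :: 'k::Fields.field:]) = fls_X ^ p"
proof (intro fls_eqI)
  fix n
  have t: "expand_at_0 (to_fract [:0, 1 :: 'k:]) = fls_X"
    by (simp add: expand_at_0_to_fract fps_of_poly_pCons)
  show "ratfun_embed p (to_fract [:0, 1 :: 'k:]) $$ n = (fls_X ^ p) $$ n"
    using assms by (auto simp: ratfun_embed_def t laurent_embed_nth)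
qed

text \<open>A solution of \<open>X\<^sup>p - X = c\<close> has no pole at \<open>0\<close>, and its value there is a solution in the
  field of constants.\<close>

lemma AS_root_const:
  fixes c :: "'k::Fields.field poly fract"
  assumes p: "p > 1" and c: "c ^ p - c = to_fract [:a:]"
  shows "\<exists>e. e ^ p - e = a"
proof -
  interpret e: field_embedding "expand_at_0 :: 'k poly fract \<Rightarrow> _" by (rule field_embedding_expand_at_0)
  define g where "g = expand_at_0 c"
  have g: "g ^ p - g = fls_const a"
    using arg_cong[OF c, of expand_at_0] by (simp add: e.emb_diff e.emb_power g_def expand_at_0_const)
  have no_pole: "g $$ i = 0" if "i < 0" for i
  proof (cases "g = 0")
    case False
    let ?d = "fls_subdegree g"
    have "?d \<ge> 0"
    proof (rule ccontr)
      assume "\<not> ?d \<ge> 0"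
      define m where "m = int p * ?d"
      have d: "m < ?d" "m < 0"
        using \<open>\<not> ?d \<ge> 0\<close> p by (auto simp: m_def mult_less_cancel_right2 mult_pos_neg)
      have "(g ^ p) $$ m = (g $$ ?d) ^ p" using fls_power_lead[of ?d g p] by (simp add: m_def)
      moreover have "(g ^ p - g) $$ m = 0" unfolding g using d by simp
      ultimately show False using d False by (simp add: nth_fls_subdegree_zero_iff)
    qed
    then show ?thesis using that by simp
  qed simp
  have "(g ^ p) $$ 0 = (g $$ 0) ^ p" using fls_power_lead[of 0 g p] no_pole by simp
  then have "(g $$ 0) ^ p - g $$ 0 = a" using arg_cong[OF g, of "\<lambda>h. h $$ 0"] by simp
  then show ?thesis by blast
qed

section \<open>An Artin-Schreier root in a symbol algebra with ramified second slot\<close>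

text \<open>Inside the skew Laurent series over \<open>K(\<xi>)\<close> in \<open>y\<close>, with \<open>y\<^sup>p = t\<close>, an element \<open>z\<close> with
  \<open>z\<^sup>p - z\<close> a constant has no pole, and its constant term is an element of \<open>K(\<xi>)\<close> with the same
  property. The series are replaced by the action on functions on the \<open>p\<close> conjugates of \<open>\<xi>\<close> with
  values in Laurent series.\<close>

locale constant_symbol =
  fixes p :: nat and b0 :: "'k::Fields.field" and \<xi>0 :: "'k alg_closure"
  assumes prime_p: "Factorial_Ring.prime p" and char_k: "CHAR('k) = p" and char_F: "CHAR('k poly fract) = p"
    and \<xi>0: "\<xi>0 ^ p - \<xi>0 = to_ac b0"
begin

lemma p1: "p > 1" using prime_p prime_gt_1_nat by blast

lemma p0: "p > 0" using p1 by simp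

sublocale symbol_rep "ratfun_embed p :: 'k poly fract \<Rightarrow> _" p "to_fract [:b0:]" "to_fract [:0, 1:]" fls_X "fls_const \<xi>0"
proof -
  interpret f: field_embedding "ratfun_embed p :: 'k poly fract \<Rightarrow> _" by (rule field_embedding_ratfun_embed[OF p0])
  have "fls_const \<xi>0 ^ p = fls_const (\<xi>0 ^ p)" by (induction p) simp_all
  then show "symbol_rep (ratfun_embed p :: 'k poly fract \<Rightarrow> _) p (to_fract [:b0:]) (to_fract [:0, 1:]) fls_X (fls_const \<xi>0)"
    using prime_p char_F \<xi>0
    by unfold_locales (simp_all add: ratfun_embed_const[OF p0] ratfun_embed_t[OF p0] flip: fls_const_hom)
qed

sublocale ac: field_embedding "to_ac :: 'k \<Rightarrow> _" by (rule field_embedding_to_ac)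

text \<open>The conjugates \<open>\<xi> + k\<close> of \<open>\<xi>\<close> as constant Laurent series; these are the points of \<open>Z\<close>.\<close>

definition conjugate :: "nat \<Rightarrow> 'k alg_closure fls" where
  "conjugate k = fls_const (\<xi>0 + of_nat k)"

lemma conjugate_Z: "conjugate k \<in> Z"
proof -
  have "conjugate k = fls_const \<xi>0 + of_nat k" by (simp add: conjugate_def fls_of_nat fls_const_hom)
  moreover have "fls_const \<xi>0 \<in> Z" using \<xi> by (simp add: Z_def)
  ultimately show ?thesis using Z_shift_nat by simp
qed

lemma conjugate_add: "conjugate k + of_nat j = conjugate (k + j)"
  by (simp add: conjugate_def fls_of_nat fls_const_hom add.assoc)

text \<open>The coefficient of \<open>y\<^sup>n\<close> in the skew Laurent series of a normal form, as a polynomial in \<open>\<xi>\<close>. Since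
  \<open>t = y\<^sup>p\<close>, only the component at \<open>y\<^sup>j\<close> with \<open>j = n mod p\<close> contributes, with its coefficient of \<open>t\<^sup>m\<close> for
  \<open>m = n div p\<close>.\<close>

definition coeff_poly :: "(nat \<Rightarrow> 'k poly fract poly) \<Rightarrow> int \<Rightarrow> 'k poly" where
  "coeff_poly P n = map_poly (\<lambda>c. expand_at_0 c $$ (n div int p)) (P (nat (n mod int p)))"

lemma expand_at_0_0: "expand_at_0 0 = (0 :: 'k fls)"
  by (rule field_embedding.emb_0[OF field_embedding_expand_at_0])

lemma ratfun_embed_nth:
  "ratfun_embed p c $$ m = (if int p dvd m then to_ac (expand_at_0 c $$ (m div int p)) else 0)"
  by (simp add: ratfun_embed_def laurent_embed_nth[OF p0])

lemma poly_ratfun_embed_nth: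
  fixes Q :: "'k poly fract poly"
  shows "poly (map_poly (ratfun_embed p) Q) (fls_const z) $$ m =
    (if int p dvd m then poly (map_poly to_ac (map_poly (\<lambda>c. expand_at_0 c $$ (m div int p)) Q)) z else 0)"
  by (induction Q)
    (simp_all add: map_emb_pCons map_poly_pCons expand_at_0_0 ratfun_embed_nth)

text \<open>Leading terms under the action: the argument starts at exponent \<open>r\<close>, the skew series at \<open>N\<close>, and the
  coefficient at \<open>N + r\<close> of the result is the product of the leading coefficients, with the second one
  taken at the conjugate shifted by \<open>N\<close>.\<close>

lemma rep_ysum_nth:
  assumes low: "\<And>m. m < N \<Longrightarrow> coeff_poly P m = 0"
    and v: "\<And>k i. i < r \<Longrightarrow> v (conjugate k) $$ i = 0"
  shows "i < N + r \<Longrightarrow> rep (A.ysum P) v (conjugate k) $$ i = 0"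
    and "rep (A.ysum P) v (conjugate k) $$ (N + r) =
      poly (map_poly to_ac (coeff_poly P N)) (\<xi>0 + of_nat k) * v (conjugate (k + nat (N mod int p))) $$ r"
proof -
  let ?B = "\<lambda>j. poly (map_poly (ratfun_embed p) (P j)) (conjugate k) * fls_X ^ j"
  have B: "?B j $$ n = (if n mod int p = int j then poly (map_poly to_ac (coeff_poly P n)) (\<xi>0 + of_nat k) else 0)"
    if j: "j < p" for j n
  proof -
    have 1: "?B j $$ n = poly (map_poly (ratfun_embed p) (P j)) (conjugate k) $$ (n - int j)"
      by (simp add: fls_X_power_times_conv_shift)
    have 2: "int p dvd n - int j \<longleftrightarrow> n mod int p = int j"
      using j mod_eq_dvd_iff[of n "int p" "int j"] by simp
    have 3: "(n - int j) div int p = n div int p" if "n mod int p = int j"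
    proof -
      have "n - int j = int p * (n div int p)" using that minus_mod_eq_mult_div[of n "int p"] by simp
      then show ?thesis using p0 by simp
    qed
    show ?thesis
      unfolding 1 using 2 3 by (auto simp: conjugate_def poly_ratfun_embed_nth coeff_poly_def)
  qed
  have rep: "rep (A.ysum P) v (conjugate k) = (\<Sum>j<p. ?B j * v (conjugate (k + j)))"
    by (simp add: rep_ysum[OF conjugate_Z] conjugate_add mult.assoc)
  have B0: "?B j $$ n = 0" if "j < p" "n < N" for j n
    using B that low by simp
  show "rep (A.ysum P) v (conjugate k) $$ i = 0" if i: "i < N + r"
  proof -
    have "(?B j * v (conjugate (k + j))) $$ i = 0" if "j < p" for j
      by (rule fls_times_lead(1)[of N "?B j" r "v (conjugate (k + j))", OF B0[OF that] v i])
    then show ?thesis unfolding rep fls_nth_sum by (intro sum.neutral) simp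
  qed
  have "rep (A.ysum P) v (conjugate k) $$ (N + r) = (\<Sum>j<p. ?B j $$ N * v (conjugate (k + j)) $$ r)"
    unfolding rep fls_nth_sum using B0 v by (intro sum.cong refl fls_times_lead(2)) auto
  also have "\<dots> = (\<Sum>j<p. if j = nat (N mod int p) then
      poly (map_poly to_ac (coeff_poly P N)) (\<xi>0 + of_nat k) * v (conjugate (k + j)) $$ r else 0)"
    using p0 by (intro sum.cong) (auto simp: B)
  also have "\<dots> = poly (map_poly to_ac (coeff_poly P N)) (\<xi>0 + of_nat k) * v (conjugate (k + nat (N mod int p))) $$ r"
  proof -
    have "nat (N mod int p) < p" using p0 by (simp add: nat_less_iff)
    then show ?thesis by simp
  qed
  finally show "rep (A.ysum P) v (conjugate k) $$ (N + r) =
      poly (map_poly to_ac (coeff_poly P N)) (\<xi>0 + of_nat k) * v (conjugate (k + nat (N mod int p))) $$ r" .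
qed

text \<open>The element \<open>z\<close> is applied \<open>p\<close> times to the constant function \<open>1\<close>. If the series of \<open>z\<close> started at
  \<open>N < 0\<close>, the result would start exactly at \<open>p N\<close>, because a nonzero polynomial of degree less than \<open>p\<close>
  vanishes at no conjugate of \<open>\<xi>\<close>; but \<open>z + \<alpha>\<close> has no term below \<open>N\<close>. So \<open>N \<ge> 0\<close>, and the
  coefficients at exponent \<open>0\<close> multiply.\<close>

lemma AS_root_constant_term:
  assumes b0: "\<nexists>e. e ^ p - e = b0"
    and z: "z \<in> carrier A" "z [^]\<^bsub>A\<^esub> p = z \<oplus>\<^bsub>A\<^esub> to_fract [:a0:] \<odot>\<^bsub>A\<^esub> \<one>\<^bsub>A\<^esub>"
  obtains c where "degree c < p"
    and "\<And>k. poly (map_poly to_ac c) (\<xi>0 + of_nat k) ^ p - poly (map_poly to_ac c) (\<xi>0 + of_nat k) = to_ac a0"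
proof -
  obtain P where P: "z = A.ysum P" "\<And>j. degree (P j) < p" using A.normal_form[OF z(1)] by blast
  have degc: "degree (coeff_poly P n) < p" for n
    unfolding coeff_poly_def using map_poly_degree_leq P(2) le_less_trans by blast
  define v where "v i = (rep z ^^ i) (\<lambda>_. 1 :: 'k alg_closure fls)" for i
  have rep_pow: "rep (z [^]\<^bsub>A\<^esub> i) (\<lambda>_. 1) w = v i w" if "w \<in> Z" for i w
    using that
  proof (induction i arbitrary: w)
    case 0
    then show ?case by (simp add: rep_one v_def)
  next
    case (Suc i)
    have *: "rep (z [^]\<^bsub>A\<^esub> Suc i) (\<lambda>_. 1) w = rep z (rep (z [^]\<^bsub>A\<^esub> i) (\<lambda>_. 1)) w"
      using Suc.prems z(1) by (subst A.nat_pow_Suc2) (simp_all add: rep_mult)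
    have cong: "rep z h w = rep z h' w" if "\<And>w. w \<in> Z \<Longrightarrow> h w = h' w" for h h'
      unfolding P rep_ysum[OF Suc.prems] using that Z_shift_nat[OF Suc.prems] by (intro sum.cong) auto
    have "rep z (rep (z [^]\<^bsub>A\<^esub> i) (\<lambda>_. 1)) w = rep z (v i) w" by (rule cong) (rule Suc.IH)
    then show ?case unfolding * by (simp add: v_def)
  qed
  have eq: "v p (conjugate k) = v 1 (conjugate k) + fls_const (to_ac a0)" for k
  proof -
    have "v p (conjugate k) = rep (z \<oplus>\<^bsub>A\<^esub> to_fract [:a0:] \<odot>\<^bsub>A\<^esub> \<one>\<^bsub>A\<^esub>) (\<lambda>_. 1) (conjugate k)"
      using rep_pow[OF conjugate_Z, of p k] z(2) by simp
    also have "\<dots> = v 1 (conjugate k) + fls_const (to_ac a0)"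
      using z(1) conjugate_Z by (simp add: rep_add rep_smult rep_one v_def ratfun_embed_const[OF p0])
    finally show ?thesis .
  qed
  have vs: "v (Suc m) = rep (A.ysum P) (v m)" for m by (simp add: v_def P)
  have step: "(\<forall>k. \<forall>i<N * int n. v n (conjugate k) $$ i = 0) \<and>
      (\<forall>k. v (Suc n) (conjugate k) $$ (N * int (Suc n)) =
        poly (map_poly to_ac (coeff_poly P N)) (\<xi>0 + of_nat k) * v n (conjugate (k + nat (N mod int p))) $$ (N * int n))"
    if low: "\<And>m. m < N \<Longrightarrow> coeff_poly P m = 0" for N n
  proof (induction n)
    case 0
    have l: "v 0 (conjugate k) $$ i = 0" if "i < 0" for k i using that by (simp add: v_def)
    have "v (Suc 0) (conjugate k) $$ (N + 0) = poly (map_poly to_ac (coeff_poly P N)) (\<xi>0 + of_nat k) * v 0 (conjugate (k + nat (N mod int p))) $$ 0" for k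
      unfolding vs by (rule rep_ysum_nth(2)[where N = N and P = P and r = 0 and v = "v 0", OF low l])
    then show ?case using l by simp
  next
    case (Suc n)
    then have IH: "v n (conjugate k) $$ i = 0" if "i < N * int n" for k i using that by blast
    have low': "v (Suc n) (conjugate k) $$ i = 0" if i: "i < N * int (Suc n)" for k i
    proof -
      have "i < N + N * int n" using i by (simp add: algebra_simps)
      then have "rep (A.ysum P) (v n) (conjugate k) $$ i = 0"
        using rep_ysum_nth(1)[where N = N and P = P and r = "N * int n" and v = "v n" and i = i and k = k] low IH by blast
      then show ?thesis by (simp only: vs)
    qed
    moreover have "v (Suc (Suc n)) (conjugate k) $$ (N + N * int (Suc n)) =
        poly (map_poly to_ac (coeff_poly P N)) (\<xi>0 + of_nat k) * v (Suc n) (conjugate (k + nat (N mod int p))) $$ (N * int (Suc n))" for k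
      unfolding vs[of "Suc n"] by (rule rep_ysum_nth(2)[where N = N and P = P and r = "N * int (Suc n)" and v = "v (Suc n)", OF low low'])
    moreover have "N + N * int (Suc n) = N * int (Suc (Suc n))" by (simp add: algebra_simps)
    ultimately show ?case by metis
  qed
  have no_pole: "coeff_poly P n = 0" if n: "n < 0" for n
  proof (rule ccontr)
    assume nz: "coeff_poly P n \<noteq> 0"
    \<comment> \<open>All coefficients of the normal form have bounded pole order, so a least exponent exists.\<close>
    define D where "D = Min (insert 0 ((\<lambda>(j, i). fls_subdegree (expand_at_0 (poly.coeff (P j) i))) ` ({..<p} \<times> {..<p})))"
    have D: "D \<le> fls_subdegree (expand_at_0 (poly.coeff (P j) i))" if "j < p" "i < p" for j i
      unfolding D_def using that by (intro Min_le) auto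
    have below: "coeff_poly P m = 0" if "m < int p * D" for m
    proof (rule poly_eqI)
      fix i
      have md: "m div int p < D"
      proof (rule ccontr)
        assume "\<not> ?thesis"
        then have "int p * D \<le> int p * (m div int p)" using p0 by simp
        also have "\<dots> = m - m mod int p" by (simp add: minus_mod_eq_mult_div)
        also have "\<dots> \<le> m" using p0 by simp
        finally show False using that by simp
      qed
      have "nat (m mod int p) < p" using p0 by (simp add: nat_less_iff)
      then have "expand_at_0 (poly.coeff (P (nat (m mod int p))) i) $$ (m div int p) = 0"
        using D[of "nat (m mod int p)" i] md P(2)[of "nat (m mod int p)"]
        by (cases "i < p") (auto simp: coeff_eq_0 expand_at_0_0 intro!: fls_eq0_below_subdegree)
      then show "poly.coeff (coeff_poly P m) i = poly.coeff 0 i"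
        by (simp add: coeff_poly_def coeff_map_poly expand_at_0_0)
    qed
    let ?S = "\<lambda>m. coeff_poly P (int p * D + int m) \<noteq> 0"
    have nD: "int p * D \<le> n" using below nz by (meson not_less)
    then have Sn: "?S (nat (n - int p * D))" using nz by simp
    define N where "N = int p * D + int (LEAST m. ?S m)"
    have N: "coeff_poly P N \<noteq> 0" unfolding N_def by (rule LeastI[of ?S, OF Sn])
    have "(LEAST m. ?S m) \<le> nat (n - int p * D)" by (rule Least_le) (rule Sn)
    then have Nneg: "N < 0" using n nD by (simp add: N_def)
    have low: "coeff_poly P m = 0" if "m < N" for m
    proof (cases "m < int p * D")
      case False
      then have "nat (m - int p * D) < (LEAST m. ?S m)" using that by (simp add: N_def)
      then have "\<not> ?S (nat (m - int p * D))" by (rule not_less_Least)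
      then show ?thesis using False by simp
    qed (rule below)
    have nonzero: "poly (map_poly to_ac (coeff_poly P N)) (\<xi>0 + of_nat k) \<noteq> 0" for k
    proof
      assume *: "poly (map_poly to_ac (coeff_poly P N)) (\<xi>0 + of_nat k) = 0"
      have charac: "CHAR('k alg_closure) = p" using ac.char_emb char_k by simp
      have "(\<xi>0 + of_nat k) ^ p = \<xi>0 ^ p + of_nat k ^ p"
        using prime_p charac by (intro freshmans_dream) auto
      then have "(\<xi>0 + of_nat k) ^ p - (\<xi>0 + of_nat k) = to_ac b0"
        using of_nat_power_char[OF prime_p charac, of k] \<xi>0 by simp
      then show False using ac.AS_no_annihilator[OF prime_p char_k _ b0 * degc] N by blast
    qed
    have lead: "v n (conjugate k) $$ (N * int n) \<noteq> 0" for n k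
    proof (induction n arbitrary: k)
      case 0
      then show ?case by (simp add: v_def)
    next
      case (Suc n)
      then show ?case using step[of N n, OF low] nonzero by simp
    qed
    define M where "M = N * int p"
    have M: "M < N * int 1" "M < 0" using Nneg p1 by (simp_all add: M_def mult_less_cancel_left1 mult_less_0_iff)
    have "v 1 (conjugate 0) $$ M = 0" using step[of N 1, OF low] M(1) by blast
    moreover have "fls_const (to_ac a0) $$ M = 0" using M(2) by simp
    moreover have "v p (conjugate 0) $$ M \<noteq> 0" unfolding M_def by (rule lead)
    ultimately show False using eq[of 0] by simp
  qed
  let ?c = "coeff_poly P 0"
  have val: "v n (conjugate k) $$ 0 = poly (map_poly to_ac ?c) (\<xi>0 + of_nat k) ^ n" for n k
  proof (induction n)
    case 0
    then show ?case by (simp add: v_def)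
  next
    case (Suc n)
    then show ?case using step[of 0 n, OF no_pole] by simp
  qed
  have "poly (map_poly to_ac ?c) (\<xi>0 + of_nat k) ^ p - poly (map_poly to_ac ?c) (\<xi>0 + of_nat k) = to_ac a0" for k
    using arg_cong[OF eq[of k], of "\<lambda>g. g $$ 0"] val[of p k] val[of 1 k] by simp
  then show ?thesis using that degc by blast
qed

text \<open>Comparing the constant term at \<open>\<xi>\<close> and \<open>\<xi> + 1\<close> shows that it is \<open>e + k \<xi>\<close>.\<close>

lemma AS_root_imp:
  assumes b0: "\<nexists>e. e ^ p - e = b0"
    and z: "z \<in> carrier A" "z [^]\<^bsub>A\<^esub> p = z \<oplus>\<^bsub>A\<^esub> to_fract [:a0:] \<odot>\<^bsub>A\<^esub> \<one>\<^bsub>A\<^esub>"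
  shows "\<exists>e k. e ^ p - e = a0 - of_nat k * b0"
proof -
  obtain c where degc: "degree c < p"
    and c: "\<And>k. poly (map_poly to_ac c) (\<xi>0 + of_nat k) ^ p - poly (map_poly to_ac c) (\<xi>0 + of_nat k) = to_ac a0"
    using AS_root_constant_term[OF assms] by blast
  have charac: "CHAR('k alg_closure) = p" using ac.char_emb char_k by simp
  let ?c0 = "poly (map_poly to_ac c) \<xi>0" and ?c1 = "poly (map_poly to_ac c) (\<xi>0 + 1)"
  have c0: "?c0 ^ p - ?c0 = to_ac a0" and c1: "?c1 ^ p - ?c1 = to_ac a0" using c[of 0] c[of 1] by simp_all
  have "(?c1 - ?c0) ^ p = ?c1 ^ p - ?c0 ^ p" by (rule power_char_diff[OF prime_p charac])
  also have "\<dots> = ?c1 - ?c0" using c0 c1 by (simp add: algebra_simps)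
  finally obtain k where k: "?c1 - ?c0 = of_nat k" using fixed_by_frobenius[OF prime_p charac] by blast
  let ?q = "c \<circ>\<^sub>p [:1, 1:] - c - [:of_nat k:]"
  have map_shift: "poly (map_poly to_ac (Q \<circ>\<^sub>p [:1, 1:])) w = poly (map_poly to_ac Q) (w + 1)" for Q :: "'k poly" and w
    by (induction Q) (simp_all add: pcompose_pCons ac.map_emb_add ac.map_emb_mult ac.map_emb_pCons algebra_simps)
  have "poly (map_poly to_ac ?q) \<xi>0 = 0"
    using k by (simp add: ac.map_emb_diff map_shift ac.map_emb_pCons)
  moreover have "degree ?q < p"
    using degc p1 by (intro degree_diff_less) (simp_all add: degree_pcompose)
  ultimately have q0: "?q = 0" using ac.AS_no_annihilator[OF prime_p char_k \<xi>0 b0] by blast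
  let ?e = "c - [:0, of_nat k:]"
  have "?e \<circ>\<^sub>p [:1, 1:] = c \<circ>\<^sub>p [:1, 1:] - [:of_nat k:] - [:0, of_nat k:]"
    by (simp add: pcompose_diff pcompose_pCons)
  also have "\<dots> = ?e" using q0 by (simp add: algebra_simps)
  finally have inv: "?e \<circ>\<^sub>p [:1, 1:] = ?e" .
  have "degree ?e < p"
  proof (rule degree_diff_less[OF degc])
    have "degree [:0, of_nat k :: 'k:] \<le> 1" by (simp add: degree_pCons_le)
    then show "degree [:0, of_nat k :: 'k:] < p" using p1 by linarith
  qed
  then obtain e where e: "?e = [:e:]" using shift_invariant_imp_constant[OF char_k _ inv] by blast
  then have "c = [:e:] + [:0, of_nat k:]" by (metis diff_eq_eq)
  then have "?c0 = to_ac e + of_nat k * \<xi>0" by (simp add: ac.map_emb_pCons mult.commute)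
  moreover have "(to_ac e + of_nat k * \<xi>0) ^ p = to_ac e ^ p + of_nat k * \<xi>0 ^ p"
  proof -
    have "(to_ac e + of_nat k * \<xi>0) ^ p = to_ac e ^ p + (of_nat k * \<xi>0) ^ p"
      using prime_p charac by (intro freshmans_dream) auto
    then show ?thesis by (simp only: power_mult_distrib of_nat_power_char[OF prime_p charac])
  qed
  moreover have "\<xi>0 ^ p = \<xi>0 + to_ac b0" using \<xi>0 by (simp add: algebra_simps)
  ultimately have "to_ac (e ^ p - e + of_nat k * b0) = to_ac a0"
    using c0 by (simp add: algebra_simps)
  then have "e ^ p - e = a0 - of_nat k * b0" unfolding to_ac_eq_iff by (simp add: algebra_simps)
  then show ?thesis by blast
qed

end

section \<open>Artin-Schreier equations over the perfect closure\<close>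

lemma char_fract: "CHAR('a::idom fract) = CHAR('a)"
proof (rule CHAR_eqI)
  have hom: "of_nat n = to_fract (of_nat n :: 'a)" for n by (induction n) simp_all
  show "of_nat CHAR('a) = (0 :: 'a fract)" by (simp add: hom)
  show "CHAR('a) dvd n" if "of_nat n = (0 :: 'a fract)" for n
    using that by (simp add: hom of_nat_eq_0_iff_char_dvd)
qed

lemma field_embedding_to_perf: "field_embedding to_perf"
  by standard simp_all

text \<open>With \<open>r = u / v\<close>, the polynomial below is the numerator of \<open>r\<^sup>p - r\<close> over the denominator
  \<open>v\<^sup>p\<close>. Its degree shows that \<open>r\<^sup>p - r\<close> has degree \<open>p deg r\<close> if \<open>deg r > 0\<close> and at most \<open>0\<close> otherwise.
  No factorization enters, so the coefficients may come from any integral domain, in particular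
  from another polynomial ring.\<close>

lemma degree_AS_numerator:
  fixes u v :: "'d::idom poly"
  assumes p: "p > 1"
  shows "degree v < degree u \<Longrightarrow>
      degree (u ^ p - u * v ^ (p - 1)) = p * degree u"
    and "degree u \<le> degree v \<Longrightarrow>
      degree (u ^ p - u * v ^ (p - 1)) \<le> p * degree v"
proof -
  let ?m = "degree u" and ?n = "degree v"
  have uv: "degree (u * v ^ (p - 1)) \<le> ?m + (p - 1) * ?n"
    using degree_mult_le[of u "v ^ (p - 1)"] degree_power_le[of v "p - 1"] by (simp add: mult.commute)
  have split: "(p - 1) * k + k = p * k" for k using p by (simp add: algebra_simps diff_mult_distrib)
  show "degree (u ^ p - u * v ^ (p - 1)) = p * ?m" if lt: "?n < ?m"
  proof -
    have u0: "u \<noteq> 0" using lt by auto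
    have "(p - 1) * ?n < (p - 1) * ?m" using lt p by simp
    then have "degree (u * v ^ (p - 1)) < degree (u ^ p)"
      using uv split[of ?m] u0 by (subst degree_power_eq) linarith+
    then show ?thesis
      using u0 by (simp add: degree_power_eq diff_conv_add_uminus degree_add_eq_left del: add_uminus_conv_diff)
  qed
  show "degree (u ^ p - u * v ^ (p - 1)) \<le> p * ?n" if le: "?m \<le> ?n"
  proof (rule degree_diff_le)
    show "degree (u ^ p) \<le> p * ?n"
      using degree_power_le[of u p] le by (metis le_trans mult.commute mult_le_mono2)
    show "degree (u * v ^ (p - 1)) \<le> p * ?n" using uv le split[of ?n] by linarith
  qed
qed

lemma no_AS_root_degree_1:
  fixes u v q :: "'d::idom poly"
  assumes p: "p > 1" and v: "v \<noteq> 0" and eq: "u ^ p - u * v ^ (p - 1) = q * v ^ p"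
    and q: "degree q = 1"
  shows False
proof -
  have "q \<noteq> 0" using q by auto
  then have rhs: "degree (q * v ^ p) = p * degree v + 1"
    using v q by (simp add: degree_mult_eq degree_power_eq)
  show False
  proof (cases "degree v < degree u")
    case True
    then have "p * degree u = p * degree v + 1"
      using degree_AS_numerator(1)[OF p] eq rhs by metis
    then have "p dvd 1" by (metis dvd_add_right_iff dvd_triv_left)
    then show False using p by simp
  next
    case False
    then have "degree (q * v ^ p) \<le> p * degree v"
      using degree_AS_numerator(2)[OF p, of u v] eq by simp
    then show False unfolding rhs by simp
  qed
qed

text \<open>When \<open>r\<^sup>p - r\<close> is a nonzero constant, \<open>r\<close> has degree \<open>0\<close>, and the quotient of the leading
  coefficients of \<open>u\<close> and \<open>v\<close> solves the same equation over the coefficients.\<close>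

lemma AS_root_leading_coeff:
  fixes u v :: "'d::idom poly"
  assumes p: "p > 1" and v: "v \<noteq> 0" and eq: "u ^ p - u * v ^ (p - 1) = [:c:] * v ^ p" and c: "c \<noteq> 0"
  shows "\<exists>u0 v0. v0 \<noteq> 0 \<and> u0 ^ p - u0 * v0 ^ (p - 1) = c * v0 ^ p"
proof -
  let ?n = "degree v"
  let ?v0 = "poly.coeff v ?n" and ?u0 = "poly.coeff u ?n"
  have pn: "(p - 1) * ?n + ?n = p * ?n" using p by (simp add: algebra_simps diff_mult_distrib)
  have rhs: "degree ([:c:] * v ^ p) = p * ?n"
    using c v by (simp add: degree_mult_eq degree_power_eq)
  have le: "degree u \<le> ?n"
  proof (rule ccontr)
    assume m: "\<not> ?thesis"
    then have "p * degree u = p * ?n"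
      using degree_AS_numerator(1)[OF p] eq rhs by (metis not_less)
    then show False using m p by simp
  qed
  have cm: "poly.coeff (f * g) (i + j) = poly.coeff f i * poly.coeff g j"
    if "degree f \<le> i" "degree g \<le> j" for f g :: "'d poly" and i j
  proof (cases "degree f = i \<and> degree g = j")
    case True
    then show ?thesis using coeff_mult_degree_sum[of f g] by simp
  next
    case False
    then have "degree (f * g) < i + j" using degree_mult_le[of f g] that by linarith
    moreover have "poly.coeff f i = 0 \<or> poly.coeff g j = 0" using False that by (meson coeff_eq_0 le_neq_implies_less)
    ultimately show ?thesis by (auto simp: coeff_eq_0)
  qed
  have cp: "degree (f ^ k) \<le> k * i \<and> poly.coeff (f ^ k) (k * i) = poly.coeff f i ^ k"
    if "degree f \<le> i" for f :: "'d poly" and i k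
  proof (induction k)
    case (Suc k)
    have "degree (f * f ^ k) \<le> i + k * i" using degree_mult_le[of f "f ^ k"] Suc that by linarith
    then show ?case using cm[OF that conjunct1[OF Suc]] Suc by simp
  qed simp
  have "poly.coeff (u ^ p - u * v ^ (p - 1)) (p * ?n) = ?u0 ^ p - ?u0 * ?v0 ^ (p - 1)"
    using cp[OF le, of p] cm[OF le, of "v ^ (p - 1)" "(p - 1) * ?n"] cp[of v ?n "p - 1"] pn by (simp add: add.commute)
  moreover have "poly.coeff ([:c:] * v ^ p) (p * ?n) = c * ?v0 ^ p"
    using cp[of v ?n p] by simp
  ultimately have "?u0 ^ p - ?u0 * ?v0 ^ (p - 1) = c * ?v0 ^ p" unfolding eq by simp
  then show ?thesis using v by (metis leading_coeff_neq_0)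
qed

lemma fract_AS_rootD:
  fixes r :: "'d::idom fract"
  assumes p: "p > 1" and r: "r ^ p - r = to_fract q"
  obtains u v where "v \<noteq> 0" "u ^ p - u * v ^ (p - 1) = q * v ^ p"
proof -
  obtain u v where uv: "r = Fract u v" "v \<noteq> 0" by (cases r)
  have v0: "to_fract v \<noteq> 0" using uv by simp
  have vp: "to_fract v ^ p = to_fract v * to_fract v ^ (p - 1)" using p by (metis power_eq_if not_one_less_zero)
  have "(to_fract u / to_fract v) ^ p - to_fract u / to_fract v = to_fract q"
    using r by (simp add: uv Fract_conv_to_fract)
  then have "to_fract u ^ p / to_fract v ^ p - to_fract u * to_fract v ^ (p - 1) / to_fract v ^ p = to_fract q"
    using v0 by (simp add: power_divide vp)
  then have "to_fract u ^ p - to_fract u * to_fract v ^ (p - 1) = to_fract q * to_fract v ^ p"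
    using v0 by (simp add: field_simps)
  then have "to_fract (u ^ p - u * v ^ (p - 1)) = to_fract (q * v ^ p)" by (simp add: to_fract_power)
  then show ?thesis using that uv(2) unfolding to_fract_eq_iff by blast
qed

text \<open>Some power \<open>r = e\<^sup>q\<close> with \<open>q = p\<^sup>n\<close> lies in the base field, and \<open>r\<^sup>p - r = \<gamma>\<^sup>q\<close>. Subtracting
  \<open>\<delta>\<close> with \<open>\<delta>\<^sup>p = \<gamma>\<^sup>q\<close> from \<open>r\<close> turns the right-hand side into \<open>\<delta>\<close>; descend to \<open>\<gamma>\<close>.\<close>

lemma perfect_closure_AS_root:
  fixes \<gamma> :: "'q::Fields.field"
  assumes p: "Factorial_Ring.prime p" and char: "CHAR('q) = p"
    and e: "e ^ p - e = to_perf \<gamma>"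
  shows "\<exists>r. r ^ p - r = \<gamma>"
proof -
  interpret perf: field_embedding "to_perf :: 'q \<Rightarrow> _" by (rule field_embedding_to_perf)
  have charp: "CHAR('q perfect_closure) = p" using perf.char_emb char by simp
  have ce: "char_exponent TYPE('q) = p" using char p by (auto simp: char_exponent_def)
  obtain n r where r: "e ^ (p ^ n) = to_perf r"
    using perfect_closure_purely_inseparable[of e] unfolding ce by blast
  have "(e ^ p - e) ^ (p ^ n) = (e ^ (p ^ n)) ^ p - e ^ (p ^ n)"
  proof (induction n)
    case (Suc n)
    have "(e ^ p - e) ^ (p ^ Suc n) = ((e ^ p - e) ^ (p ^ n)) ^ p" by (simp add: power_mult mult.commute flip: power_mult)
    also have "\<dots> = ((e ^ (p ^ n)) ^ p - e ^ (p ^ n)) ^ p" using Suc by simp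
    also have "\<dots> = ((e ^ (p ^ n)) ^ p) ^ p - (e ^ (p ^ n)) ^ p" by (rule power_char_diff[OF p charp])
    finally show ?case by (simp add: mult.commute flip: power_mult)
  qed simp
  then have "to_perf (\<gamma> ^ (p ^ n)) = to_perf (r ^ p - r)"
    using e r by (simp add: perf.emb_power perf.emb_diff)
  then have "r ^ p - r = \<gamma> ^ (p ^ n)" using perf.emb_eq_iff by simp
  then show ?thesis
  proof (induction n arbitrary: r)
    case (Suc n)
    have "(r - \<gamma> ^ (p ^ n)) ^ p - (r - \<gamma> ^ (p ^ n)) = (r ^ p - r) - (\<gamma> ^ (p ^ n)) ^ p + \<gamma> ^ (p ^ n)"
      unfolding power_char_diff[OF p char] by simp
    also have "\<dots> = \<gamma> ^ (p ^ n)" using Suc.prems by (simp add: mult.commute flip: power_mult)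
    finally show ?case by (rule Suc.IH)
  qed auto
qed

abbreviation perf_\<alpha> :: "'e::Fields.field perf_ratfun2" where
  "perf_\<alpha> \<equiv> to_perf (to_fract [:[:0, 1:]:])"

abbreviation perf_\<beta> :: "'e::Fields.field perf_ratfun2" where
  "perf_\<beta> \<equiv> to_perf (to_fract [:0, 1:])"

context
  fixes p :: nat
  assumes prime_p: "Factorial_Ring.prime p" and char_E: "CHAR('e::Fields.field) = p"
begin

lemma char_ratfun2: "CHAR('e ratfun2) = p"
  using char_E by (simp add: char_fract)

lemma char_perf: "CHAR('e perf_ratfun2) = p"
  using field_embedding.char_emb[OF field_embedding_to_perf, where 'a = "'e ratfun2"] char_ratfun2 by simp

lemma char_main: "CHAR('e main_field) = p"
  using char_perf by (simp add: char_fract)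

lemma perf_perfect: "\<exists>d. d ^ p = (e :: 'e perf_ratfun2)"
proof -
  have "char_exponent TYPE('e ratfun2) = p" using char_ratfun2 prime_p by (auto simp: char_exponent_def)
  then show ?thesis using perfect_closure_perfect[of e] by simp
qed

text \<open>If \<open>p\<close> does not divide \<open>l\<close>, the right-hand side has degree \<open>1\<close> in \<open>\<beta>\<close>. Otherwise it is a multiple of
  \<open>\<alpha>\<close> and constant in \<open>\<beta>\<close>; the leading coefficients in \<open>\<beta>\<close> reduce this case to degree \<open>1\<close> in \<open>\<alpha>\<close>.\<close>

lemma no_AS_root_linear_comb:
  fixes k l :: nat
  assumes kl: "\<not> p dvd k \<or> \<not> p dvd l"
  shows "\<nexists>e :: 'e perf_ratfun2. e ^ p - e = of_nat k * perf_\<alpha> - of_nat l * perf_\<beta>"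
proof
  assume "\<exists>e :: 'e perf_ratfun2. e ^ p - e = of_nat k * perf_\<alpha> - of_nat l * perf_\<beta>"
  then obtain e :: "'e perf_ratfun2" where e: "e ^ p - e = of_nat k * perf_\<alpha> - of_nat l * perf_\<beta>" by blast
  have p1: "p > 1" using prime_p prime_gt_1_nat by blast
  interpret perf: field_embedding "to_perf :: 'e ratfun2 \<Rightarrow> _" by (rule field_embedding_to_perf)
  have nat_fract: "of_nat n = to_fract (of_nat n :: 'e poly poly)" for n by (induction n) simp_all
  let ?q = "of_nat k * [:[:0, 1:]:] - of_nat l * [:0, 1:] :: 'e poly poly"
  have mult: "of_nat n * to_perf (to_fract x) = to_perf (to_fract (of_nat n * x :: 'e poly poly))" for n x
    by (simp only: to_fract_mult perf.emb_mult nat_fract[symmetric] perf.emb_of_nat)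
  have "e ^ p - e = to_perf (to_fract ?q)"
    unfolding e mult by (simp only: perf.emb_diff to_fract_diff)
  then obtain r where "r ^ p - r = to_fract ?q"
    using perfect_closure_AS_root[OF prime_p char_ratfun2] by blast
  then obtain u v where uv: "v \<noteq> 0" "u ^ p - u * v ^ (p - 1) = ?q * v ^ p"
    using fract_AS_rootD[OF p1] by blast
  have q: "?q = [:[:0, of_nat k:], - of_nat l:]" by (simp add: of_nat_poly)
  show False
  proof (cases "p dvd l")
    case False
    then have "(of_nat l :: 'e) \<noteq> 0" using char_E of_nat_eq_0_iff_char_dvd by blast
    then have "(of_nat l :: 'e poly) \<noteq> 0" by (simp add: of_nat_poly)
    then have "degree ?q = 1" unfolding q by simp
    then show False using no_AS_root_degree_1[OF p1 uv] by blast
  next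
    case True
    then have "(of_nat l :: 'e poly) = 0" using char_E by (simp add: of_nat_poly of_nat_eq_0_iff_char_dvd)
    then have q': "?q = [:[:0, of_nat k:]:]" unfolding q by simp
    have k0: "(of_nat k :: 'e) \<noteq> 0" using kl True char_E of_nat_eq_0_iff_char_dvd by blast
    then have "[:0, of_nat k :: 'e:] \<noteq> 0" by simp
    then obtain u0 v0 :: "'e poly" where "v0 \<noteq> 0" "u0 ^ p - u0 * v0 ^ (p - 1) = [:0, of_nat k:] * v0 ^ p"
      using AS_root_leading_coeff[OF p1 uv(1) uv(2)[unfolded q']] by blast
    then show False using no_AS_root_degree_1[OF p1, of v0 u0 "[:0, of_nat k:]"] k0 by simp
  qed
qed

lemma no_AS_root_\<beta>: "\<nexists>e :: 'e perf_ratfun2. e ^ p - e = perf_\<beta>"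
proof
  assume "\<exists>e :: 'e perf_ratfun2. e ^ p - e = perf_\<beta>"
  then obtain e :: "'e perf_ratfun2" where e: "e ^ p - e = perf_\<beta>" by blast
  have p1: "p > 1" using prime_p prime_gt_1_nat by blast
  then have "(of_nat (p - 1) :: 'e perf_ratfun2) = - 1"
    using char_perf of_nat_CHAR[where 'a = "'e perf_ratfun2"] by (simp add: of_nat_diff)
  then have "e ^ p - e = of_nat 0 * perf_\<alpha> - of_nat (p - 1) * perf_\<beta>" using e by simp
  moreover have "\<not> p dvd p - 1" using p1 by (auto dest: dvd_imp_le)
  ultimately show False using no_AS_root_linear_comb[of 0 "p - 1"] by blast
qed

lemma no_AS_root_\<alpha>_\<beta>: "\<nexists>e :: 'e perf_ratfun2. e ^ p - e = perf_\<alpha> - of_nat k * perf_\<beta>"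
proof -
  have "\<not> p dvd 1" using prime_p by auto
  then show ?thesis using no_AS_root_linear_comb[of 1 k] by simp
qed

end

section \<open>Comparison of the two algebras\<close>

lemma embeds_imp_contains:
  fixes A :: "('f::Fields.field, 'a, 'm) module_scheme" and L :: "('f, 'l, 'n) module_scheme"
  assumes A: "type_algebra A" and L: "type_algebra L" and emb: "algebra_embeds \<F> L A"
  shows "contains_subalgebra_isomorphic_to \<F> A L"
proof -
  interpret A: type_algebra A by fact
  interpret L: type_algebra L by fact
  obtain h where h: "h \<in> algebra_hom \<F> L A" and inj: "inj_on h (carrier L)"
    using emb by (auto simp: algebra_embeds_def)
  note hom = algebra_hom_mem[OF h]
  let ?S = "h ` carrier L"
  have neg: "\<ominus>\<^bsub>A\<^esub> h u = h (\<ominus>\<^bsub>L\<^esub> u)" if "u \<in> carrier L" for u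
    using hom(4)[OF that, of "- 1"] hom(1)[OF that] that by (simp add: L.uminus_smult A.uminus_smult)
  have "subring ?S A"
  proof (rule A.subringI)
    show "\<one>\<^bsub>A\<^esub> \<in> ?S" using hom(5) by (metis L.one_closed imageI)
  next
    fix s assume "s \<in> ?S"
    then show "\<ominus>\<^bsub>A\<^esub> s \<in> ?S" using neg by auto
  next
    fix s s' assume "s \<in> ?S" "s' \<in> ?S"
    then obtain u u' where u: "u \<in> carrier L" "s = h u" "u' \<in> carrier L" "s' = h u'" by blast
    show "s \<otimes>\<^bsub>A\<^esub> s' \<in> ?S" using u hom(2)[of u u'] by (metis L.m_closed imageI)
    show "s \<oplus>\<^bsub>A\<^esub> s' \<in> ?S" using u hom(3)[of u u'] by (metis L.M.a_closed imageI)
  qed (use hom(1) in auto)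
  moreover have "c \<odot>\<^bsub>A\<^esub> s \<in> ?S" if "s \<in> ?S" for c s
    using that hom(4) by (metis (no_types, lifting) L.smult_mem imageE imageI)
  ultimately have "is_subalgebra \<F> ?S A" by (simp add: is_subalgebra_def)
  moreover have "h \<in> algebra_hom \<F> L (A\<lparr>carrier := ?S\<rparr>)"
    using hom by (auto simp: algebra_hom_def ring_hom_def)
  ultimately show ?thesis
    using inj by (auto simp: contains_subalgebra_isomorphic_to_def algebra_isomorphic_def bij_betw_def)
qed

lemma contains_imp_embeds:
  fixes A :: "('f::Fields.field, 'a, 'm) module_scheme" and L :: "('f, 'l, 'n) module_scheme"
  assumes A: "type_algebra A" and con: "contains_subalgebra_isomorphic_to \<F> A L"
  shows "algebra_embeds \<F> L A"
proof -
  obtain S h where S: "is_subalgebra \<F> S A"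
    and h: "h \<in> algebra_hom \<F> L (A\<lparr>carrier := S\<rparr>)" "bij_betw h (carrier L) S"
    using con by (auto simp: contains_subalgebra_isomorphic_to_def algebra_isomorphic_def)
  have "S \<subseteq> carrier A" using S subringE(1) by (auto simp: is_subalgebra_def)
  then have "h \<in> algebra_hom \<F> L A"
    using h(1) by (auto simp: algebra_hom_def ring_hom_def)
  then show ?thesis using h(2) by (auto simp: algebra_embeds_def bij_betw_def)
qed

theorem mainTheorem3:
  fixes p :: nat
    and F :: "'e::Fields.field main_field ring"
    and \<alpha> \<beta> t :: "'e main_field"
  assumes "Factorial_Ring.prime p"
    and "CHAR('e) = p"
    and "F = ring_of_type_algebra"
    and "\<alpha> = \<alpha>_main" and "\<beta> = \<beta>_main" and "t = t_main"
  shows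
    "field (artin_schreier_algebra p F \<alpha>) \<and>
     contains_subalgebra_isomorphic_to F (symbol_algebra p F \<alpha> t) (artin_schreier_algebra p F \<alpha>) \<and>
     \<not> contains_subalgebra_isomorphic_to F (symbol_algebra p F \<beta> t) (artin_schreier_algebra p F \<alpha>) \<and>
     p_algebra_of_degree_p p F (symbol_algebra p F \<alpha> t) \<and>
     p_algebra_of_degree_p p F (symbol_algebra p F \<beta> t) \<and>
     share_purely_inseparable TYPE('l) p F (symbol_algebra p F \<alpha> t) (symbol_algebra p F \<beta> t) \<and>
     \<not> share_cyclic_separable TYPE('e main_field list set) p F
         (symbol_algebra p F \<alpha> t) (symbol_algebra p F \<beta> t)"
proof -
  note p = assms(1) and char = assms(2)
  have F: "F = \<F>" by (rule assms(3))
  have p1: "p > 1" using p prime_gt_1_nat by blast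
  note charK = char_perf[OF p char] and charF = char_main[OF p char]
  have \<alpha>: "\<alpha> = to_fract [:perf_\<alpha>:]" and \<beta>: "\<beta> = to_fract [:perf_\<beta>:]" and t: "t = to_fract [:0, 1:]"
    using assms by (simp_all add: \<alpha>_main_def \<beta>_main_def const_main_def t_main_def)
  have root: "\<exists>z. z ^ p - z = to_ac c" for c :: "'e perf_ratfun2"
  proof -
    have "degree (AS_poly p (to_ac c)) > 0" using degree_AS_poly[OF p1, of "to_ac c"] p1 by linarith
    then obtain z where "poly (AS_poly p (to_ac c)) z = 0" using alg_closed_imp_poly_has_root by blast
    then show ?thesis by (intro exI[of _ z]) (simp add: poly_monom algebra_simps)
  qed
  obtain \<xi>\<alpha> where \<xi>\<alpha>: "\<xi>\<alpha> ^ p - \<xi>\<alpha> = to_ac (perf_\<alpha> :: 'e perf_ratfun2)" using root by blast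
  obtain \<xi>\<beta> where \<xi>\<beta>: "\<xi>\<beta> ^ p - \<xi>\<beta> = to_ac (perf_\<beta> :: 'e perf_ratfun2)" using root by blast
  interpret R\<alpha>: constant_symbol p "perf_\<alpha> :: 'e perf_ratfun2" \<xi>\<alpha>
    by unfold_locales (use p charK charF \<xi>\<alpha> in simp_all)
  interpret R\<beta>: constant_symbol p "perf_\<beta> :: 'e perf_ratfun2" \<xi>\<beta>
    by unfold_locales (use p charK charF \<xi>\<beta> in simp_all)
  let ?A\<alpha> = "symbol_algebra p \<F> \<alpha> t" and ?A\<beta> = "symbol_algebra p \<F> \<beta> t"
  interpret A\<alpha>: symbol_indep ?A\<alpha> p \<alpha> t "symb_x p \<alpha> t" "symb_y p \<alpha> t"
    unfolding \<alpha> t by (rule R\<alpha>.symbol_indep_A)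
  interpret A\<beta>: symbol_indep ?A\<beta> p \<beta> t "symb_x p \<beta> t" "symb_y p \<beta> t"
    unfolding \<beta> t by (rule R\<beta>.symbol_indep_A)
  let ?L = "artin_schreier_algebra p \<F> \<alpha>"
  have no\<alpha>: "\<nexists>c. c ^ p - c = \<alpha>"
    using AS_root_const[OF p1] no_AS_root_\<alpha>_\<beta>[OF p char, of 0] unfolding \<alpha> by fastforce
  obtain \<theta> where L: "presented_by ?L \<theta> (AS_poly p \<alpha>)" "field ?L"
    using AS_algebra_presented[OF p charF no\<alpha>] by blast
  have talgL: "type_algebra ?L" using L(1) by (simp add: presented_by_def)
  have emb\<alpha>: "algebra_embeds \<F> ?L ?A\<alpha>"
    by (rule presented_embeds[OF L A\<alpha>.type_algebra_axioms A\<alpha>.one_not_zero A\<alpha>.x A\<alpha>.ev_AS_zero])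
  have not\<beta>: "\<not> algebra_embeds \<F> ?L ?A\<beta>"
  proof
    assume "algebra_embeds \<F> ?L ?A\<beta>"
    then obtain h where h: "h \<in> algebra_hom \<F> ?L ?A\<beta>" by (auto simp: algebra_embeds_def)
    have \<theta>: "\<theta> \<in> carrier ?L" using L(1) by (simp add: presented_by_def)
    let ?z = "h \<theta>"
    have z: "?z \<in> carrier ?A\<beta>" using algebra_hom_mem(1)[OF h \<theta>] .
    interpret L: type_algebra ?L by (rule talgL)
    have "L.ev \<theta> (AS_poly p \<alpha>) = \<zero>\<^bsub>?L\<^esub>" using L(1) by (simp add: presented_by_def)
    then have "A\<beta>.ev ?z (AS_poly p \<alpha>) = h \<zero>\<^bsub>?L\<^esub>"
      using algebra_hom_ev[OF talgL A\<beta>.type_algebra_axioms h \<theta>, of "AS_poly p \<alpha>"] by simp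
    also have "\<dots> = \<zero>\<^bsub>?A\<beta>\<^esub>"
      using algebra_hom_ev[OF talgL A\<beta>.type_algebra_axioms h \<theta>, of 0] by simp
    finally have 0: "(?z [^]\<^bsub>?A\<beta>\<^esub> p \<ominus>\<^bsub>?A\<beta>\<^esub> ?z) \<ominus>\<^bsub>?A\<beta>\<^esub> \<alpha> \<odot>\<^bsub>?A\<beta>\<^esub> \<one>\<^bsub>?A\<beta>\<^esub> = \<zero>\<^bsub>?A\<beta>\<^esub>"
      unfolding A\<beta>.ev_AS_poly[OF z] .
    have z': "?z [^]\<^bsub>?A\<beta>\<^esub> p = ?z \<oplus>\<^bsub>?A\<beta>\<^esub> \<alpha> \<odot>\<^bsub>?A\<beta>\<^esub> \<one>\<^bsub>?A\<beta>\<^esub>"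
    proof -
      have "?z [^]\<^bsub>?A\<beta>\<^esub> p = A\<beta>.ev ?z (AS_poly p \<alpha> + ([:0, 1:] + [:\<alpha>:]))"
        using z by (simp add: A\<beta>.ev_monom)
      also have "\<dots> = ?z \<oplus>\<^bsub>?A\<beta>\<^esub> \<alpha> \<odot>\<^bsub>?A\<beta>\<^esub> \<one>\<^bsub>?A\<beta>\<^esub>"
        using z 0 by (simp only: A\<beta>.ev_add[OF z] A\<beta>.ev_AS_poly[OF z] A\<beta>.ev_X[OF z] A\<beta>.ev_const[OF z]) simp
      finally show ?thesis .
    qed
    have "\<exists>e k. e ^ p - e = perf_\<alpha> - of_nat k * (perf_\<beta> :: 'e perf_ratfun2)"
      using R\<beta>.AS_root_imp[OF no_AS_root_\<beta>[OF p char]] z z' unfolding \<alpha> \<beta> t by blast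
    then show False using no_AS_root_\<alpha>_\<beta>[OF p char] by blast
  qed
  have basis: "\<exists>d. c = (\<Sum>i<p. d i ^ p * t ^ i)" for c
    unfolding t by (rule rational_function_p_basis[OF p charF perf_perfect[OF p char]])
  have insep: "algebra_embeds \<F> M ?A\<alpha> \<and> algebra_embeds \<F> M ?A\<beta>"
    if "extension_of_degree \<F> M p" "purely_inseparable_extension p \<F> M"
    for M :: "('e main_field, 'l) module"
    using insep_embeds[OF p charF that basis A\<alpha>.type_algebra_axioms A\<alpha>.one_not_zero A\<alpha>.y A\<alpha>.y_power]
      insep_embeds[OF p charF that basis A\<beta>.type_algebra_axioms A\<beta>.one_not_zero A\<beta>.y A\<beta>.y_power]
    by blast
  show ?thesis
    unfolding F
  proof (intro conjI)
    show "field ?L" by (rule L(2))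
    show "contains_subalgebra_isomorphic_to \<F> ?A\<alpha> ?L"
      by (rule embeds_imp_contains[OF A\<alpha>.type_algebra_axioms talgL emb\<alpha>])
    show "\<not> contains_subalgebra_isomorphic_to \<F> ?A\<beta> ?L"
      using contains_imp_embeds[OF A\<beta>.type_algebra_axioms] not\<beta> by blast
    show "p_algebra_of_degree_p p \<F> ?A\<alpha>" by (rule A\<alpha>.p_algebra)
    show "p_algebra_of_degree_p p \<F> ?A\<beta>" by (rule A\<beta>.p_algebra)
    show "share_purely_inseparable TYPE('l) p \<F> ?A\<alpha> ?A\<beta>"
      unfolding share_purely_inseparable_def using insep by blast
    show "\<not> share_cyclic_separable TYPE('e main_field list set) p \<F> ?A\<alpha> ?A\<beta>"
      unfolding share_cyclic_separable_def using AS_cyclic[OF p charF L] emb\<alpha> not\<beta> by blast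
  qed
qed

end
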